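(* For every limiting density $\delta\in[1,\tfrac32)$ (i.e. every $\delta\in\mathbb L\cap[1,\tfrac32)$), it holds that $$\mathrm{cobs}(\mathbb C_{\le\delta})=\min\big(\mathbb A\cup\{\mathcal D,\mathcal M\}\cup\{\mathcal G^H : H\in\mathcal E_\delta\}\big),$$ where $\mathbb A=\{\mathcal G^A : A\in\mathcal A\}$ and the remaining objects are as defined in the context.
   Context: Graphs are finite, without loops or multiple edges, and considered up to isomorphism. All graph classes considered are minor-closed and proper (a class is proper if it does not contain all graphs). For a graph class $\mathcal G$ let $\mathrm{ex}(\mathcal G,n)=\max\{|E(G)| : G\in\mathcal G,\ |V(G)|=n\}$. The limiting density of an infinite class is $\delta(\mathcal G)=\lim_{n\to\infty}\mathrm{ex}(\mathcal G,n)/n$; if $\mathcal G$ is finite then $\delta(\mathcal G)=-\infty$. $\mathbb L$ is the set of all limiting densities of infinite proper minor-closed graph classes. $\mathbb C_{\le\delta}$ is the set of all minor-closed graph classes $\mathcal G$ with $\delta(\mathcal G)\le\delta$. For a set $\mathbb C$ of minor-closed classes, $\mathrm{cobs}(\mathbb C)$ is the set of all $\subseteq$-minimal minor-closed graph classes that do not belong to $\mathbb C$. For a finite set of minor-closed graph classes, $\min$ denotes the set of its $\subseteq$-minimal elements; for a set of graphs, $\min$ denotes the set of its minor-minimal elements. $k\cdot H$ is the disjoint union of $k$ copies of $H$, and $\mathcal G^H$ is the class of all minors of the graphs $k\cdot H$, $k\ge1$. The $k$-daisy $\mathscr D_k$ is the graph formed by $k$ triangles sharing one common vertex. The $k$-diamond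 $\mathscr M_k$ consists of two adjacent vertices and $k$ further pairwise non-adjacent vertices, each adjacent to both of them. $\mathcal D$ and $\mathcal M$ are the classes of all minors of the graphs $\mathscr D_k$ and $\mathscr M_k$ ($k\ge1$), respectively. A 2-tree is defined recursively: $K_3$ is a 2-tree, and every graph on more than 3 vertices having a vertex $v$ whose neighborhood induces a $K_2$ and such that $G-v$ is a 2-tree is a 2-tree. A block of a graph is a maximal 2-connected subgraph or a bridge. $\mathcal A=\mathcal A_4\cup\mathcal A_6\cup\mathcal A_8\cup\mathcal A_{10}$, where $\mathcal A_4=\{K_4\}$; $\mathcal A_6$ is the set of all 2-trees on 6 vertices; $\mathcal A_8$ is the set of all connected graphs with exactly two blocks, one isomorphic to a 5-vertex 2-tree and the other to the unique 4-vertex 2-tree; $\mathcal A_{10}$ is the set of all connected graphs with exactly three blocks, each isomorphic to the unique 4-vertex 2-tree. For $b\in\mathbb N$ (non-negative integers): $\mathcal E^1_b$ ($b\ge1$) is the set of connected graphs with exactly $b$ blocks, all triangles; $\mathcal E^2_b$ is the set of connected graphs with exactly $b+1$ blocks, $b$ of them triangles and one the unique 2-tree on 4 vertices; $\mathcal E^3_b$ is the set of connected graphs with exactly $b+1$ blocks, $b$ of them triangles and one a 2-tree on 5 vertices; $\mathcal E^4_b$ is the set of connected graphs with exactly $b+2$ blocks, $b$ of them triangles and two of them the unique 2-tree on 4 vertices. Put $(a_1,c_1)=(0,1)$, $(a_2,c_2)=(5,4)$, $(a_3,c_3)=(7,5)$, $(a_4,c_4)=(10,7)$, $b_1=1$,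 $b_2=b_3=b_4=0$, and $$\beta_i(\delta)=\max\Big\{b_i,\ 1+\Big\lfloor\frac{\delta c_i-a_i}{3-2\delta}\Big\rfloor\Big\}.$$ Finally $\mathcal U_\delta=\bigcup_{i=1}^4\mathcal E^i_{\beta_i(\delta)}$ and $\mathcal E_\delta=\min(\mathcal U_\delta)$ (the minor-minimal graphs of $\mathcal U_\delta$). *)

theory Defs
  imports "HOL-Library.Extended_Real"
begin

text \<open>
  Graphs are pairs of a vertex set and a set of two-element edges.  Graph classes are sets of
  simple graphs with vertices in \<^typ>\<open>nat\<close>; a minor-closed class is automatically closed under
  isomorphism, so these sets correspond exactly to classes of finite graphs taken up to
  isomorphism.  The graph without vertices is admitted as a graph; it is not connected.
\<close>

type_synonym 'a sgraph = "'a set \<times> 'a set set"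

abbreviation verts :: "'a sgraph \<Rightarrow> 'a set" where "verts \<equiv> fst"
abbreviation edges :: "'a sgraph \<Rightarrow> 'a set set" where "edges \<equiv> snd"

definition complete_graph :: "'a set \<Rightarrow> 'a sgraph" where
  "complete_graph S = (S, {e. e \<subseteq> S \<and> card e = 2})"

definition simple_graph :: "'a sgraph \<Rightarrow> bool" where
  "simple_graph G \<longleftrightarrow> finite (verts G) \<and> edges G \<subseteq> {e. e \<subseteq> verts G \<and> card e = 2}"

definition graph_iso :: "'a sgraph \<Rightarrow> 'b sgraph \<Rightarrow> bool" where
  "graph_iso G H \<longleftrightarrow> simple_graph G \<and> simple_graph H \<and>
     (\<exists>f. bij_betw f (verts G) (verts H) \<and> edges H = (\<lambda>e. f ` e) ` edges G)"

definition subgraph :: "'a sgraph \<Rightarrow> 'a sgraph \<Rightarrow> bool" where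
  "subgraph H G \<longleftrightarrow> simple_graph H \<and> verts H \<subseteq> verts G \<and> edges H \<subseteq> edges G"

definition induced :: "'a sgraph \<Rightarrow> 'a set \<Rightarrow> 'a sgraph" where
  "induced G S = (S, {e \<in> edges G. e \<subseteq> S})"

definition del_vertex :: "'a sgraph \<Rightarrow> 'a \<Rightarrow> 'a sgraph" where
  "del_vertex G v = induced G (verts G - {v})"

definition nbhd :: "'a sgraph \<Rightarrow> 'a \<Rightarrow> 'a set" where
  "nbhd G v = {u. {u, v} \<in> edges G}"

definition reachable :: "'a sgraph \<Rightarrow> 'a \<Rightarrow> 'a \<Rightarrow> bool" where
  "reachable G u v \<longleftrightarrow> (u, v) \<in> {(x, y). {x, y} \<in> edges G}\<^sup>*"

definition graph_connected :: "'a sgraph \<Rightarrow> bool" where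
  "graph_connected G \<longleftrightarrow> verts G \<noteq> {} \<and> (\<forall>u\<in>verts G. \<forall>v\<in>verts G. reachable G u v)"

definition two_connected :: "'a sgraph \<Rightarrow> bool" where
  "two_connected G \<longleftrightarrow> simple_graph G \<and> card (verts G) \<ge> 3 \<and> graph_connected G \<and>
     (\<forall>v\<in>verts G. graph_connected (del_vertex G v))"

definition bridge :: "'a sgraph \<Rightarrow> 'a set \<Rightarrow> bool" where
  "bridge G e \<longleftrightarrow> e \<in> edges G \<and>
     (\<exists>u v. e = {u, v} \<and> \<not> reachable (verts G, edges G - {e}) u v)"

definition blocks :: "'a sgraph \<Rightarrow> 'a sgraph set" where
  "blocks G =
     {B. subgraph B G \<and> two_connected B \<and>
         (\<forall>C. subgraph C G \<and> two_connected C \<and> subgraph B C \<longrightarrow> C = B)} \<union>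
     {(e, {e}) | e. bridge G e}"

text \<open>The minor relation, in terms of branch sets \<open>\<phi> x\<close> of \<open>G\<close> indexed by the vertices of \<open>H\<close>.\<close>

definition minor :: "'b sgraph \<Rightarrow> 'a sgraph \<Rightarrow> bool" where
  "minor H G \<longleftrightarrow> (\<exists>\<phi>.
     (\<forall>x\<in>verts H. \<phi> x \<subseteq> verts G \<and> graph_connected (induced G (\<phi> x))) \<and>
     (\<forall>x\<in>verts H. \<forall>y\<in>verts H. x \<noteq> y \<longrightarrow> \<phi> x \<inter> \<phi> y = {}) \<and>
     (\<forall>x y. {x, y} \<in> edges H \<longrightarrow> (\<exists>u\<in>\<phi> x. \<exists>v\<in>\<phi> y. {u, v} \<in> edges G)))"


subsection \<open>Classes of graphs and limiting densities\<close>

text \<open>As a standing convention, all minor-closed classes are proper.\<close>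

definition minor_closed_class :: "nat sgraph set \<Rightarrow> bool" where
  "minor_closed_class \<G> \<longleftrightarrow>
     (\<forall>G\<in>\<G>. simple_graph G) \<and>
     (\<forall>G\<in>\<G>. \<forall>H. simple_graph H \<and> minor H G \<longrightarrow> H \<in> \<G>) \<and>
     \<G> \<noteq> {G. simple_graph G}"

text \<open>Finiteness is up to isomorphism: a nonempty isomorphism-closed set of graphs on
  \<^typ>\<open>nat\<close> is typically infinite as a set.\<close>

definition finite_class :: "nat sgraph set \<Rightarrow> bool" where
  "finite_class \<G> \<longleftrightarrow> (\<exists>\<F>\<subseteq>\<G>. finite \<F> \<and> (\<forall>G\<in>\<G>. \<exists>H\<in>\<F>. graph_iso G H))"

definition ex_edges :: "nat sgraph set \<Rightarrow> nat \<Rightarrow> nat" where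
  "ex_edges \<G> n = Max {card (edges G) | G. G \<in> \<G> \<and> card (verts G) = n}"

text \<open>The limit exists for every minor-closed class that is not finite.\<close>

definition limiting_density :: "nat sgraph set \<Rightarrow> ereal" where
  "limiting_density \<G> = (if finite_class \<G> then - \<infinity> else lim (\<lambda>n. ereal (real (ex_edges \<G> n) / real n)))"

definition limiting_densities :: "ereal set" where
  "limiting_densities = {limiting_density \<G> | \<G>. minor_closed_class \<G> \<and> \<not> finite_class \<G>}"

definition classes_le :: "ereal \<Rightarrow> nat sgraph set set" where
  "classes_le \<delta> = {\<G>. minor_closed_class \<G> \<and> limiting_density \<G> \<le> \<delta>}"

definition min_classes :: "nat sgraph set set \<Rightarrow> nat sgraph set set" where
  "min_classes \<CC> = {\<G>\<in>\<CC>. \<forall>\<H>\<in>\<CC>. \<H> \<subseteq> \<G> \<longrightarrow> \<H> = \<G>}"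

definition cobs :: "nat sgraph set set \<Rightarrow> nat sgraph set set" where
  "cobs \<CC> = min_classes {\<G>. minor_closed_class \<G> \<and> \<G> \<notin> \<CC>}"

definition min_graphs :: "nat sgraph set \<Rightarrow> nat sgraph set" where
  "min_graphs U = {G\<in>U. \<forall>H\<in>U. minor H G \<longrightarrow> graph_iso H G}"


subsection \<open>The classes in the theorem\<close>

definition copies :: "nat \<Rightarrow> 'a sgraph \<Rightarrow> (nat \<times> 'a) sgraph" where
  "copies k H = ({..<k} \<times> verts H, {Pair i ` e | i e. i < k \<and> e \<in> edges H})"

definition copies_class :: "'a sgraph \<Rightarrow> nat sgraph set" where
  "copies_class H = {G. simple_graph G \<and> (\<exists>k\<ge>1. minor G (copies k H))}"

definition daisy :: "nat \<Rightarrow> nat sgraph" where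
  "daisy k = ({0..2*k}, {{0, i} | i. i \<in> {1..2*k}} \<union> {{2*i - 1, 2*i} | i. i \<in> {1..k}})"

definition diamond :: "nat \<Rightarrow> nat sgraph" where
  "diamond k = ({0..k+1}, {{0, 1}} \<union> {{0, i} | i. i \<in> {2..k+1}} \<union> {{1, i} | i. i \<in> {2..k+1}})"

definition daisy_class :: "nat sgraph set" where
  "daisy_class = {G. simple_graph G \<and> (\<exists>k\<ge>1. minor G (daisy k))}"

definition diamond_class :: "nat sgraph set" where
  "diamond_class = {G. simple_graph G \<and> (\<exists>k\<ge>1. minor G (diamond k))}"

definition triangle :: "'a sgraph \<Rightarrow> bool" where
  "triangle G \<longleftrightarrow> graph_iso G (complete_graph {..<3::nat})"

inductive two_tree :: "'a sgraph \<Rightarrow> bool" where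
  base: "triangle G \<Longrightarrow> two_tree G"
| step: "\<lbrakk>simple_graph G; card (verts G) > 3; v \<in> verts G;
          graph_iso (induced G (nbhd G v)) (complete_graph {..<2::nat});
          two_tree (del_vertex G v)\<rbrakk> \<Longrightarrow> two_tree G"

definition two_tree_on :: "nat \<Rightarrow> 'a sgraph \<Rightarrow> bool" where
  "two_tree_on n G \<longleftrightarrow> two_tree G \<and> card (verts G) = n"

definition \<A>4 :: "nat sgraph set" where
  "\<A>4 = {G. graph_iso G (complete_graph {..<4::nat})}"

definition \<A>6 :: "nat sgraph set" where
  "\<A>6 = {G. two_tree_on 6 G}"

definition \<A>8 :: "nat sgraph set" where
  "\<A>8 = {G. simple_graph G \<and> graph_connected G \<and>
     (\<exists>B C. B \<noteq> C \<and> blocks G = {B, C} \<and> two_tree_on 5 B \<and> two_tree_on 4 C)}"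

definition \<A>10 :: "nat sgraph set" where
  "\<A>10 = {G. simple_graph G \<and> graph_connected G \<and> card (blocks G) = 3 \<and>
     (\<forall>B\<in>blocks G. two_tree_on 4 B)}"

definition \<A> :: "nat sgraph set" where
  "\<A> = \<A>4 \<union> \<A>6 \<union> \<A>8 \<union> \<A>10"

definition \<E>1 :: "nat \<Rightarrow> nat sgraph set" where
  "\<E>1 b = {G. simple_graph G \<and> graph_connected G \<and> card (blocks G) = b \<and>
     (\<forall>B\<in>blocks G. triangle B)}"

definition \<E>2 :: "nat \<Rightarrow> nat sgraph set" where
  "\<E>2 b = {G. simple_graph G \<and> graph_connected G \<and> card (blocks G) = b + 1 \<and>
     (\<exists>B\<in>blocks G. two_tree_on 4 B \<and> (\<forall>C\<in>blocks G - {B}. triangle C))}"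

definition \<E>3 :: "nat \<Rightarrow> nat sgraph set" where
  "\<E>3 b = {G. simple_graph G \<and> graph_connected G \<and> card (blocks G) = b + 1 \<and>
     (\<exists>B\<in>blocks G. two_tree_on 5 B \<and> (\<forall>C\<in>blocks G - {B}. triangle C))}"

definition \<E>4 :: "nat \<Rightarrow> nat sgraph set" where
  "\<E>4 b = {G. simple_graph G \<and> graph_connected G \<and> card (blocks G) = b + 2 \<and>
     (\<exists>B\<in>blocks G. \<exists>B'\<in>blocks G. B \<noteq> B' \<and> two_tree_on 4 B \<and> two_tree_on 4 B' \<and>
        (\<forall>C\<in>blocks G - {B, B'}. triangle C))}"

text \<open>The graphs in \<open>\<E>i b\<close> have \<open>a + 3 * b\<close> edges and \<open>c + 2 * b\<close> vertices, for the constants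
  \<open>a\<close> and \<open>c\<close> passed to \<open>\<beta>\<close> in \<open>\<U>\<close>.  \<open>nat\<close> loses nothing here, since the maximum is at least \<open>b \<ge> 0\<close>.\<close>

definition \<beta> :: "nat \<Rightarrow> real \<Rightarrow> real \<Rightarrow> real \<Rightarrow> nat" where
  "\<beta> b a c \<delta> = nat (max (int b) (1 + \<lfloor>(\<delta> * c - a) / (3 - 2 * \<delta>)\<rfloor>))"

definition \<U> :: "real \<Rightarrow> nat sgraph set" where
  "\<U> \<delta> = \<E>1 (\<beta> 1 0 1 \<delta>) \<union> \<E>2 (\<beta> 0 5 4 \<delta>) \<union> \<E>3 (\<beta> 0 7 5 \<delta>) \<union> \<E>4 (\<beta> 0 10 7 \<delta>)"

definition \<E> :: "real \<Rightarrow> nat sgraph set" where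
  "\<E> \<delta> = min_graphs (\<U> \<delta>)"

end

theory Submission
  imports Defs "HOL-Library.Multiset"
begin

text \<open>
  Let a graph be dense if it has more than \<open>\<delta>\<close> times as many edges as vertices, and let the targets be
  the members of \<open>\<A>\<close> and \<open>\<U> \<delta>\<close>.  The theorem follows formally from two facts: every class on the right-hand
  side is a minor-closed class of density above \<open>\<delta>\<close>, and every minor-closed class that contains none of them has
  density at most \<open>\<delta>\<close>.

  For the first fact, the targets are dense: all their blocks are two-trees, blocks are edge-disjoint, and along a
  connected graph each further block brings at most all but one of its vertices (\<open>blocks_count\<close>).  In the
  class generated by the disjoint copies of a connected graph the components are bounded, so that the limit exists and
  is at least the density of that graph (\<open>copies_class_density\<close>).  For minors of daisies and
  diamonds edges are counted directly.

  For the second fact let \<open>\<G>\<close> contain none of the classes.  Then some daisy, some diamond, and some multiple of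
  each target are minors of no member of \<open>\<G>\<close>.  Two statements about single graphs bound the number of edges.

  A dense graph contains a target as a minor (\<open>dense_has_target\<close>).  A minor-minimal dense graph is connected and each of its
  edges lies in a triangle, as contracting any other edge would keep it dense.  Unless there is already
  a target in \<open>\<A>\<close>, inside such a graph one can grow an induced subgraph whose blocks are two-trees, by tips
  and by pendant triangles: an obstacle would be a vertex with two non-adjacent neighbours in the
  subgraph, and then a cycle through it, with triangles on its edges, contains \<open>K\<^sub>4\<close> or a two-tree on six vertices.  Adding up the
  sizes of the blocks minus \<open>3\<close>, growth stops either when the sum reaches \<open>3\<close>, and contracting the
  blocks that are triangles gives a member of \<open>\<A>\<close>; or with the whole graph, and then density forces so many triangles that
  contracting the surplus ones gives a member of \<open>\<U> \<delta>\<close>.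

  Without large daisies and diamonds, the edges in excess of density \<open>\<delta>\<close> are bounded by a constant times
  the number of disjoint dense vertex sets (\<open>excess_bounded_by_packing\<close>).  Two disjoint connected sets
  see each other in boundedly many vertices: if \<open>C\<close> has many neighbours of \<open>X\<close>, then \<open>C\<close> contains
  either many disjoint connected parts with two of them each, giving a daisy centred at the contracted \<open>X\<close>, or many branches at
  one vertex, giving a diamond.  With minimum degree two this bounds the degrees and the breadth-first
  layers, so a dense set can be cut off at a bounded cost.

  By pigeonhole a large packing of dense sets in a member of \<open>\<G>\<close> would contain a forbidden multiple of a target.  So the
  members have at most \<open>\<delta> n + C\<close> edges on \<open>n\<close> vertices.  The limit exists since the same applies
  to each \<open>d \<ge> 1\<close> in place of \<open>\<delta>\<close>: either \<open>d\<close> is an upper bound for the slope as well, or a target for \<open>d\<close> has unlimited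
  copies in \<open>\<G>\<close> and the slope is eventually larger than \<open>d\<close>.  If the slope can be less than \<open>1\<close>, components are bounded, and a finite
  list of small graphs takes over the role of the targets.
\<close>

section \<open>Connected vertex sets\<close>

definition conn :: "'a sgraph \<Rightarrow> 'a set \<Rightarrow> bool" where
  "conn G S \<longleftrightarrow> graph_connected (induced G S)"

definition touches :: "'a sgraph \<Rightarrow> 'a set \<Rightarrow> 'a set \<Rightarrow> bool" where
  "touches G A B \<longleftrightarrow> (\<exists>u\<in>A. \<exists>v\<in>B. {u, v} \<in> edges G)"

lemma touches_sym: "touches G A B \<longleftrightarrow> touches G B A"
  unfolding touches_def by (metis insert_commute)

lemma touches_mono: "touches G A B \<Longrightarrow> A \<subseteq> A' \<Longrightarrow> B \<subseteq> B' \<Longrightarrow> touches G A' B'"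
  unfolding touches_def by blast

lemma touchesI: "{u, v} \<in> edges G \<Longrightarrow> u \<in> A \<Longrightarrow> v \<in> B \<Longrightarrow> touches G A B"
  unfolding touches_def by blast

lemma touchesE:
  assumes "touches G A B"
  obtains u v where "u \<in> A" "v \<in> B" "{u, v} \<in> edges G"
  using assms unfolding touches_def by blast

lemma verts_induced [simp]: "verts (induced G S) = S"
  and edges_induced [simp]: "edges (induced G S) = {e \<in> edges G. e \<subseteq> S}"
  by (simp_all add: induced_def)

lemma simple_graph_induced: "simple_graph G \<Longrightarrow> S \<subseteq> verts G \<Longrightarrow> simple_graph (induced G S)"
  unfolding simple_graph_def by (auto intro: finite_subset)

lemma finite_verts: "simple_graph G \<Longrightarrow> finite (verts G)"
  by (simp add: simple_graph_def)

lemma finite_edges: "simple_graph G \<Longrightarrow> finite (edges G)"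
  unfolding simple_graph_def
  by (rule finite_subset[of _ "Pow (verts G)"]) auto

lemma edge_neq: "simple_graph G \<Longrightarrow> {u, v} \<in> edges G \<Longrightarrow> u \<noteq> v"
  unfolding simple_graph_def by auto

lemma edge_verts: "simple_graph G \<Longrightarrow> {u, v} \<in> edges G \<Longrightarrow> u \<in> verts G \<and> v \<in> verts G"
  unfolding simple_graph_def by auto

lemma edgeE:
  assumes "simple_graph G" "e \<in> edges G"
  obtains u v where "e = {u, v}" "u \<noteq> v" "u \<in> verts G" "v \<in> verts G"
proof -
  have "e \<subseteq> verts G" "card e = 2" using assms unfolding simple_graph_def by auto
  then show ?thesis using that by (metis card_2_iff insert_subset)
qed

lemma reachable_refl [simp]: "reachable G u u"
  by (simp add: reachable_def)

lemma reachable_step: "reachable G u v \<Longrightarrow> {v, w} \<in> edges G \<Longrightarrow> reachable G u w"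
  unfolding reachable_def by (metis (mono_tags, lifting) case_prodI mem_Collect_eq rtrancl.rtrancl_into_rtrancl)

lemma reachable_stays:
  assumes "reachable G u v" "u \<in> A" "\<And>a b. a \<in> A \<Longrightarrow> {a, b} \<in> edges G \<Longrightarrow> b \<in> A"
  shows "v \<in> A"
  using assms(1) unfolding reachable_def
  by (induction rule: rtrancl_induct) (use assms(2,3) in auto)

text \<open>Connectedness is used through cuts: every proper nonempty part of a connected set sends an
  edge to the remainder.  In this form unions and quotients need no walks.\<close>

lemma conn_cut_iff:
  "conn G S \<longleftrightarrow> S \<noteq> {} \<and> (\<forall>A. A \<subseteq> S \<and> A \<noteq> {} \<and> A \<noteq> S \<longrightarrow> touches G A (S - A))"
proof (intro iffI conjI allI impI)
  assume "conn G S"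
  then have S: "S \<noteq> {}" "\<And>u v. u \<in> S \<Longrightarrow> v \<in> S \<Longrightarrow> reachable (induced G S) u v"
    by (auto simp: conn_def graph_connected_def)
  show "S \<noteq> {}" by fact
  fix A assume A: "A \<subseteq> S \<and> A \<noteq> {} \<and> A \<noteq> S"
  then obtain a c where ac: "a \<in> A" "c \<in> S" "c \<notin> A" by auto
  show "touches G A (S - A)"
  proof (rule ccontr)
    assume n: "\<not> touches G A (S - A)"
    have "c \<in> A"
      by (rule reachable_stays[OF S(2)[of a c] ac(1)]) (use ac A n in \<open>auto simp: touches_def\<close>)
    with ac show False by simp
  qed
next
  assume cut: "S \<noteq> {} \<and> (\<forall>A. A \<subseteq> S \<and> A \<noteq> {} \<and> A \<noteq> S \<longrightarrow> touches G A (S - A))"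
  have "reachable (induced G S) u v" if uv: "u \<in> S" "v \<in> S" for u v
  proof (rule ccontr)
    let ?A = "{w \<in> S. reachable (induced G S) u w}"
    assume "\<not> reachable (induced G S) u v"
    then have "?A \<noteq> S" using uv by auto
    moreover have "?A \<noteq> {}" using uv by auto
    ultimately have "touches G ?A (S - ?A)" using cut by auto
    then obtain a b where "a \<in> ?A" "b \<in> S - ?A" "{a, b} \<in> edges G"
      by (auto simp: touches_def)
    then show False using reachable_step[of "induced G S" u a b] by auto
  qed
  then show "conn G S" using cut by (auto simp: conn_def graph_connected_def)
qed

lemma connD: "conn G S \<Longrightarrow> A \<subseteq> S \<Longrightarrow> A \<noteq> {} \<Longrightarrow> A \<noteq> S \<Longrightarrow> touches G A (S - A)"
  by (simp add: conn_cut_iff)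

lemma conn_nonempty: "conn G S \<Longrightarrow> S \<noteq> {}"
  by (simp add: conn_cut_iff)

lemma conn_singleton [simp]: "conn G {v}"
  by (auto simp: conn_cut_iff)

lemma conn_mono_edges: "conn G S \<Longrightarrow> edges G \<subseteq> edges H \<Longrightarrow> conn H S"
  unfolding conn_cut_iff touches_def by (metis subsetD)

lemma conn_UN:
  assumes X: "conn G X" and A: "\<And>i. i \<in> I \<Longrightarrow> conn G (A i)"
    and t: "\<And>i. i \<in> I \<Longrightarrow> A i \<inter> X \<noteq> {} \<or> touches G (A i) X"
  shows "conn G (X \<union> (\<Union>i\<in>I. A i))"
  unfolding conn_cut_iff
proof (intro conjI allI impI)
  let ?U = "X \<union> (\<Union>i\<in>I. A i)"
  show "?U \<noteq> {}" using conn_nonempty[OF X] by auto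
  fix B assume B: "B \<subseteq> ?U \<and> B \<noteq> {} \<and> B \<noteq> ?U"
  have split: "touches G B (?U - B)" if "conn G Y" "Y \<subseteq> ?U" "B \<inter> Y \<noteq> {}" "\<not> Y \<subseteq> B" for Y
    by (rule touches_mono[OF connD[OF that(1), of "B \<inter> Y"]]) (use that in auto)
  consider "X \<subseteq> B" | "X \<inter> B = {}" | "B \<inter> X \<noteq> {}" "\<not> X \<subseteq> B" by auto
  then show "touches G B (?U - B)"
  proof cases
    case 1
    then obtain i where i: "i \<in> I" "\<not> A i \<subseteq> B" using B by auto
    show ?thesis
    proof (cases "B \<inter> A i = {}")
      case True
      then have "touches G (A i) X" using t[OF i(1)] 1 by blast
      then have "touches G X (A i)" using touches_sym by blast
      then show ?thesis by (rule touches_mono) (use 1 True i in auto)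
    next
      case False
      show ?thesis by (rule split[OF A[OF i(1)]]) (use False i in auto)
    qed
  next
    case 2
    then obtain i where i: "i \<in> I" "B \<inter> A i \<noteq> {}" using B by blast
    show ?thesis
    proof (cases "A i \<subseteq> B")
      case True
      then have "touches G (A i) X" using t[OF i(1)] 2 by blast
      then show ?thesis by (rule touches_mono) (use True 2 in auto)
    next
      case False
      show ?thesis by (rule split[OF A[OF i(1)]]) (use False i in auto)
    qed
  next
    case 3
    show ?thesis by (rule split[OF X]) (use 3 in auto)
  qed
qed

lemma conn_Un:
  assumes "conn G A" "conn G B" "A \<inter> B \<noteq> {} \<or> touches G A B"
  shows "conn G (A \<union> B)"
proof -
  have "conn G (A \<union> (\<Union>i\<in>{()}. B))"
    by (rule conn_UN) (use assms in \<open>auto simp: touches_sym[of G B A]\<close>)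
  then show ?thesis by simp
qed

lemma conn_insert: "conn G A \<Longrightarrow> {u, v} \<in> edges G \<Longrightarrow> v \<in> A \<Longrightarrow> conn G (insert u A)"
  using conn_Un[of G "{u}" A] by (auto simp: touches_def)

lemma graph_connected_iff_conn: "simple_graph G \<Longrightarrow> graph_connected G \<longleftrightarrow> conn G (verts G)"
proof -
  assume "simple_graph G"
  then have "induced G (verts G) = G"
    by (auto simp: induced_def simple_graph_def prod_eq_iff)
  then show ?thesis by (simp add: conn_def)
qed

lemma conn_induced: "S \<subseteq> W \<Longrightarrow> conn (induced G W) S \<longleftrightarrow> conn G S"
proof -
  assume "S \<subseteq> W"
  then have "induced (induced G W) S = induced G S" by (auto simp: induced_def)
  then show ?thesis by (simp add: conn_def)
qed

text \<open>Components of a vertex set \<open>S\<close> appear as the parts \<open>T\<close> that are connected and closed in \<open>S\<close>.\<close>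

lemma component_exists:
  assumes "u \<in> S"
  obtains T where "u \<in> T" "T \<subseteq> S" "conn G T" "\<not> touches G T (S - T)"
proof -
  define F where "F = {T. u \<in> T \<and> T \<subseteq> S \<and> conn G T}"
  let ?T = "\<Union>F"
  have F: "u \<in> T" "T \<subseteq> S" "conn G T" if "T \<in> F" for T using that by (auto simp: F_def)
  have u: "{u} \<in> F" using assms by (simp add: F_def)
  have "conn G ({u} \<union> (\<Union>T\<in>F. T))"
  proof (rule conn_UN)
    show "T \<inter> {u} \<noteq> {} \<or> touches G T {u}" if "T \<in> F" for T using F(1)[OF that] by blast
  qed (use F in simp_all)
  moreover have "{u} \<union> (\<Union>T\<in>F. T) = ?T" using u by auto
  ultimately have c: "conn G ?T" by simp
  have sub: "u \<in> ?T" "?T \<subseteq> S" using u F by auto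
  have "\<not> touches G ?T (S - ?T)"
  proof
    assume "touches G ?T (S - ?T)"
    then obtain a b where ab: "a \<in> ?T" "b \<in> S" "b \<notin> ?T" "{a, b} \<in> edges G"
      by (auto simp: touches_def)
    have "conn G (insert b ?T)"
      using conn_insert[OF c, of b a] ab by (simp add: insert_commute)
    moreover have "u \<in> insert b ?T" "insert b ?T \<subseteq> S" using ab sub by auto
    ultimately have "insert b ?T \<in> F" unfolding F_def by (intro CollectI conjI)
    then show False using ab by blast
  qed
  then show ?thesis using that[of ?T] c sub by simp
qed

subsection \<open>Walks\<close>

definition walk :: "'a sgraph \<Rightarrow> 'a list \<Rightarrow> bool" where
  "walk G xs \<longleftrightarrow> xs \<noteq> [] \<and> successively (\<lambda>u v. {u, v} \<in> edges G) xs"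

lemma walk_Cons: "walk G (x # xs) \<longleftrightarrow> xs = [] \<or> ({x, hd xs} \<in> edges G \<and> walk G xs)"
  by (cases xs) (auto simp: walk_def)

lemma walk_append:
  "xs \<noteq> [] \<Longrightarrow> ys \<noteq> [] \<Longrightarrow>
   walk G (xs @ ys) \<longleftrightarrow> walk G xs \<and> walk G ys \<and> {last xs, hd ys} \<in> edges G"
  by (auto simp: walk_def successively_append_iff)

lemma conn_walk: "walk G xs \<Longrightarrow> conn G (set xs)"
proof (induction xs)
  case (Cons x xs)
  show ?case
  proof (cases "xs = []")
    case False
    then have "{x, hd xs} \<in> edges G" "walk G xs" using Cons.prems by (auto simp: walk_Cons)
    then show ?thesis using conn_insert[of G "set xs" x "hd xs"] Cons.IH False by simp
  qed simp
qed (simp add: walk_def)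

lemma reachable_walk:
  assumes "reachable G u v"
  obtains xs where "walk G xs" "hd xs = u" "last xs = v"
proof -
  have "(u, v) \<in> {(x, y). {x, y} \<in> edges G}\<^sup>*" using assms by (simp add: reachable_def)
  then have "\<exists>xs. walk G xs \<and> hd xs = u \<and> last xs = v"
  proof (induction rule: rtrancl_induct)
    case base
    show ?case by (rule exI[of _ "[u]"]) (simp add: walk_def)
  next
    case (step y z)
    then obtain xs where xs: "walk G xs" "hd xs = u" "last xs = y" by auto
    then have "xs \<noteq> []" by (simp add: walk_def)
    then have "walk G (xs @ [z])" using xs step.hyps by (simp add: walk_append, simp add: walk_def)
    then show ?case using xs \<open>xs \<noteq> []\<close> by (intro exI[of _ "xs @ [z]"]) simp
  qed
  then show ?thesis using that by blast
qed

text \<open>A walk with fewest vertices between its ends admits no shortcut.\<close>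

definition shortest_walk :: "'a sgraph \<Rightarrow> 'a list \<Rightarrow> bool" where
  "shortest_walk G xs \<longleftrightarrow> walk G xs \<and>
     (\<forall>ys. walk G ys \<and> hd ys = hd xs \<and> last ys = last xs \<longrightarrow> length xs \<le> length ys)"

lemma shortest_walk_exists:
  assumes "reachable G u v"
  obtains xs where "shortest_walk G xs" "hd xs = u" "last xs = v"
proof -
  let ?P = "\<lambda>xs. walk G xs \<and> hd xs = u \<and> last xs = v"
  obtain xs0 where xs0: "?P xs0" using reachable_walk[OF assms] by metis
  have m: "?P (arg_min length ?P)" by (rule arg_min_natI[of ?P, OF xs0])
  have "length (arg_min length ?P) \<le> length ys" if "?P ys" for ys
    by (rule arg_min_nat_le[of ?P, OF that])
  then show ?thesis using that[of "arg_min length ?P"] m unfolding shortest_walk_def by simp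
qed

lemma shortest_walk_no_shortcut:
  assumes s: "shortest_walk G (as @ x # bs @ y # cs)" and w: "walk G (x # ms @ [y])"
  shows "length bs \<le> length ms"
proof -
  have wx: "walk G (as @ x # bs @ y # cs)" using s by (simp add: shortest_walk_def)
  have "walk G (as @ x # ms @ y # cs)"
    using wx w unfolding walk_def
    by (cases "ms = []"; cases "bs = []") (auto simp: successively_append_iff successively_Cons)
  moreover have "hd (as @ x # ms @ y # cs) = hd (as @ x # bs @ y # cs)"
    by (cases as) auto
  moreover have "last (as @ x # ms @ y # cs) = last (as @ x # bs @ y # cs)"
    by simp
  ultimately have "length (as @ x # bs @ y # cs) \<le> length (as @ x # ms @ y # cs)"
    using s unfolding shortest_walk_def by blast
  then show ?thesis by simp
qed

lemma shortest_walk_distinct: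
  assumes s: "shortest_walk G xs"
  shows "distinct xs"
proof (rule ccontr)
  assume "\<not> distinct xs"
  then obtain as x bs cs where xs: "xs = as @ x # bs @ x # cs"
    using not_distinct_decomp by fastforce
  have "walk G (as @ x # cs)"
    using s unfolding walk_def shortest_walk_def xs
    by (auto simp: successively_append_iff successively_Cons)
  moreover have "hd (as @ x # cs) = hd xs" unfolding xs by (cases as) auto
  moreover have "last (as @ x # cs) = last xs" unfolding xs by simp
  ultimately have "length xs \<le> length (as @ x # cs)"
    using s unfolding shortest_walk_def by blast
  then show False by (simp add: xs)
qed

section \<open>Minors\<close>

lemma minor_iff:
  "minor H G \<longleftrightarrow> (\<exists>\<phi>. (\<forall>x\<in>verts H. \<phi> x \<subseteq> verts G \<and> conn G (\<phi> x)) \<and>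
     (\<forall>x\<in>verts H. \<forall>y\<in>verts H. x \<noteq> y \<longrightarrow> \<phi> x \<inter> \<phi> y = {}) \<and>
     (\<forall>x y. {x, y} \<in> edges H \<longrightarrow> touches G (\<phi> x) (\<phi> y)))"
  by (simp add: minor_def conn_def touches_def)

lemma touches_inducedD: "touches (induced G W) A B \<Longrightarrow> touches G A B"
  unfolding touches_def by auto

lemma minorI:
  assumes "\<And>x. x \<in> verts H \<Longrightarrow> \<phi> x \<subseteq> verts G" "\<And>x. x \<in> verts H \<Longrightarrow> conn G (\<phi> x)"
    and "\<And>x y. x \<in> verts H \<Longrightarrow> y \<in> verts H \<Longrightarrow> x \<noteq> y \<Longrightarrow> \<phi> x \<inter> \<phi> y = {}"
    and e: "\<And>e. e \<in> edges H \<Longrightarrow> \<exists>x y. e = {x, y} \<and> touches G (\<phi> x) (\<phi> y)"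
  shows "minor H G"
proof -
  have "touches G (\<phi> x) (\<phi> y)" if xy: "{x, y} \<in> edges H" for x y
  proof -
    obtain a b where "{x, y} = {a, b}" "touches G (\<phi> a) (\<phi> b)" using e[OF xy] by blast
    then show ?thesis using touches_sym[of G "\<phi> a"] by (auto simp: doubleton_eq_iff)
  qed
  then show ?thesis unfolding minor_iff using assms by (intro exI[of _ \<phi>]) simp
qed

text \<open>The pattern behind transitivity of minors: an edge between two vertices becomes an edge between
  their blow-ups, so a cut of the blown-up set either splits one blow-up or comes from a cut of \<open>S\<close>.\<close>

lemma conn_blowup:
  assumes S: "conn G S" and c: "\<And>y. y \<in> S \<Longrightarrow> conn K (\<psi> y)"
    and t: "\<And>y z. y \<in> S \<Longrightarrow> z \<in> S \<Longrightarrow> {y, z} \<in> edges G \<Longrightarrow> touches K (\<psi> y) (\<psi> z)"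
  shows "conn K (\<Union>y\<in>S. \<psi> y)"
  unfolding conn_cut_iff
proof (intro conjI allI impI)
  let ?U = "\<Union>y\<in>S. \<psi> y"
  obtain y where "y \<in> S" using conn_nonempty[OF S] by blast
  then show "?U \<noteq> {}" using conn_nonempty[OF c] by blast
  fix B assume B: "B \<subseteq> ?U \<and> B \<noteq> {} \<and> B \<noteq> ?U"
  show "touches K B (?U - B)"
  proof (cases "\<exists>y\<in>S. B \<inter> \<psi> y \<noteq> {} \<and> \<not> \<psi> y \<subseteq> B")
    case True
    then obtain y where y: "y \<in> S" "B \<inter> \<psi> y \<noteq> {}" "\<not> \<psi> y \<subseteq> B" by blast
    show ?thesis
      by (rule touches_mono[OF connD[OF c[OF y(1)], of "B \<inter> \<psi> y"]]) (use y in auto)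
  next
    case False
    let ?A = "{y \<in> S. \<psi> y \<subseteq> B}"
    have "?A \<noteq> {}" using B False by blast
    moreover have "?A \<noteq> S" using B by blast
    ultimately have "touches G ?A (S - ?A)" using connD[OF S, of ?A] by auto
    then obtain y z where yz: "y \<in> S" "\<psi> y \<subseteq> B" "z \<in> S" "\<not> \<psi> z \<subseteq> B" "{y, z} \<in> edges G"
      by (auto simp: touches_def)
    then have "\<psi> z \<inter> B = {}" using False by blast
    then show ?thesis
      by (intro touches_mono[OF t[OF yz(1,3,5)]]) (use yz in auto)
  qed
qed

lemma minor_trans:
  assumes H: "simple_graph H" and HG: "minor H G" and GK: "minor G K"
  shows "minor H K"
proof -
  obtain \<phi> where \<phi>: "\<And>x. x \<in> verts H \<Longrightarrow> \<phi> x \<subseteq> verts G" "\<And>x. x \<in> verts H \<Longrightarrow> conn G (\<phi> x)"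
    "\<And>x y. x \<in> verts H \<Longrightarrow> y \<in> verts H \<Longrightarrow> x \<noteq> y \<Longrightarrow> \<phi> x \<inter> \<phi> y = {}"
    "\<And>x y. {x, y} \<in> edges H \<Longrightarrow> touches G (\<phi> x) (\<phi> y)"
    using HG unfolding minor_iff by metis
  obtain \<psi> where \<psi>: "\<And>x. x \<in> verts G \<Longrightarrow> \<psi> x \<subseteq> verts K" "\<And>x. x \<in> verts G \<Longrightarrow> conn K (\<psi> x)"
    "\<And>x y. x \<in> verts G \<Longrightarrow> y \<in> verts G \<Longrightarrow> x \<noteq> y \<Longrightarrow> \<psi> x \<inter> \<psi> y = {}"
    "\<And>x y. {x, y} \<in> edges G \<Longrightarrow> touches K (\<psi> x) (\<psi> y)"
    using GK unfolding minor_iff by metis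
  show ?thesis
  proof (rule minorI[where \<phi> = "\<lambda>x. \<Union>y\<in>\<phi> x. \<psi> y"])
    show "(\<Union>y\<in>\<phi> x. \<psi> y) \<subseteq> verts K" if "x \<in> verts H" for x
      using \<phi>(1)[OF that] \<psi>(1) by blast
    show "conn K (\<Union>y\<in>\<phi> x. \<psi> y)" if "x \<in> verts H" for x
      by (rule conn_blowup[OF \<phi>(2)[OF that]]) (use \<phi>(1)[OF that] \<psi>(2,4) in auto)
    show "(\<Union>y\<in>\<phi> x. \<psi> y) \<inter> (\<Union>z\<in>\<phi> x'. \<psi> z) = {}"
      if "x \<in> verts H" "x' \<in> verts H" "x \<noteq> x'" for x x'
    proof -
      have "\<psi> y \<inter> \<psi> z = {}" if "y \<in> \<phi> x" "z \<in> \<phi> x'" for y z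
        using \<psi>(3)[of y z] \<phi>(1,3)[of x] \<phi>(1)[of x'] that \<open>x \<in> _\<close> \<open>x' \<in> _\<close> \<open>x \<noteq> x'\<close> by blast
      then show ?thesis by blast
    qed
    fix e assume e: "e \<in> edges H"
    then obtain x y where xy: "e = {x, y}" using edgeE[OF H] by metis
    then obtain u v where uv: "u \<in> \<phi> x" "v \<in> \<phi> y" "{u, v} \<in> edges G"
      using \<phi>(4)[of x y] e by (auto simp: touches_def)
    have "touches K (\<Union>y\<in>\<phi> x. \<psi> y) (\<Union>z\<in>\<phi> y. \<psi> z)"
      by (rule touches_mono[OF \<psi>(4)[OF uv(3)]]) (use uv in auto)
    then show "\<exists>x y. e = {x, y} \<and> touches K (\<Union>y\<in>\<phi> x. \<psi> y) (\<Union>z\<in>\<phi> y. \<psi> z)"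
      using xy by blast
  qed
qed

lemma minor_quotient:
  assumes q: "verts H \<subseteq> q ` verts G"
    and c: "\<And>x. x \<in> verts H \<Longrightarrow> conn G {v \<in> verts G. q v = x}"
    and G: "simple_graph G"
    and e: "\<And>e. e \<in> edges H \<Longrightarrow> \<exists>u v. e = {q u, q v} \<and> {u, v} \<in> edges G"
  shows "minor H G"
proof (rule minorI[where \<phi> = "\<lambda>x. {v \<in> verts G. q v = x}"])
  fix e' assume "e' \<in> edges H"
  then obtain u v where uv: "e' = {q u, q v}" "{u, v} \<in> edges G" using e by blast
  then have "touches G {v \<in> verts G. q v = q u} {w \<in> verts G. q w = q v}"
    using edge_verts[OF G uv(2)] by (auto intro: touchesI)
  then show "\<exists>x y. e' = {x, y} \<and> touches G {v \<in> verts G. q v = x} {v \<in> verts G. q v = y}"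
    using uv by blast
qed (use c in auto)

lemma minor_sub:
  assumes "simple_graph H" "verts H \<subseteq> verts G" "edges H \<subseteq> edges G"
  shows "minor H G"
proof (rule minorI[where \<phi> = "\<lambda>x. {x}"])
  fix e assume e: "e \<in> edges H"
  then obtain x y where "e = {x, y}" using edgeE[OF assms(1)] by metis
  then show "\<exists>x y. e = {x, y} \<and> touches G {x} {y}" using e assms(3) by (auto simp: touches_def)
qed (use assms in auto)

lemma minor_refl: "simple_graph G \<Longrightarrow> minor G G"
  by (simp add: minor_sub)

lemma minor_induced: "simple_graph G \<Longrightarrow> S \<subseteq> verts G \<Longrightarrow> minor (induced G S) G"
  by (rule minor_sub[OF simple_graph_induced]) auto

lemma minor_card_verts:
  assumes "minor H G" "finite (verts G)"
  shows "card (verts H) \<le> card (verts G)"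
proof -
  obtain \<phi> where \<phi>: "\<forall>x\<in>verts H. \<phi> x \<subseteq> verts G \<and> conn G (\<phi> x)"
    "\<forall>x\<in>verts H. \<forall>y\<in>verts H. x \<noteq> y \<longrightarrow> \<phi> x \<inter> \<phi> y = {}"
    using assms(1) unfolding minor_iff by metis
  have ne: "\<forall>x\<in>verts H. (SOME v. v \<in> \<phi> x) \<in> \<phi> x"
    using \<phi>(1) conn_nonempty by (metis some_in_eq)
  have "inj_on (\<lambda>x. SOME v. v \<in> \<phi> x) (verts H)"
    unfolding inj_on_def using ne \<phi>(2) by (metis disjoint_iff)
  moreover have "(\<lambda>x. SOME v. v \<in> \<phi> x) ` verts H \<subseteq> verts G" using ne \<phi>(1) by blast
  ultimately show ?thesis using assms(2) card_inj_on_le by blast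
qed

text \<open>Distinct edges of a minor are realised by distinct edges of the host.\<close>

lemma minor_card_edges:
  assumes "minor H G" "simple_graph H" "simple_graph G"
  shows "card (edges H) \<le> card (edges G)"
proof -
  obtain \<phi> where \<phi>: "\<forall>x\<in>verts H. \<phi> x \<subseteq> verts G \<and> conn G (\<phi> x)"
    "\<forall>x\<in>verts H. \<forall>y\<in>verts H. x \<noteq> y \<longrightarrow> \<phi> x \<inter> \<phi> y = {}"
    "\<forall>x y. {x, y} \<in> edges H \<longrightarrow> touches G (\<phi> x) (\<phi> y)"
    using assms(1) unfolding minor_iff by metis
  have "\<exists>f. f \<in> edges G \<and> (\<exists>x y u v. e = {x, y} \<and> f = {u, v} \<and> x \<in> verts H \<and> y \<in> verts H \<and> u \<in> \<phi> x \<and> v \<in> \<phi> y)"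
    if e: "e \<in> edges H" for e
  proof -
    obtain x y where xy: "e = {x, y}" "x \<in> verts H" "y \<in> verts H" using edgeE[OF assms(2) e] by metis
    have "touches G (\<phi> x) (\<phi> y)" using \<phi>(3) e xy(1) by blast
    then obtain u v where "u \<in> \<phi> x" "v \<in> \<phi> y" "{u, v} \<in> edges G"
      by (rule touchesE)
    then show ?thesis using xy by blast
  qed
  then obtain h where h: "\<And>e. e \<in> edges H \<Longrightarrow> h e \<in> edges G \<and> (\<exists>x y u v. e = {x, y} \<and> h e = {u, v} \<and> x \<in> verts H \<and> y \<in> verts H \<and> u \<in> \<phi> x \<and> v \<in> \<phi> y)"
    by metis
  have "inj_on h (edges H)"
  proof (rule inj_onI)
    fix e e' assume *: "e \<in> edges H" "e' \<in> edges H" "h e = h e'"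
    obtain x y u v where 1: "e = {x, y}" "h e = {u, v}" "x \<in> verts H" "y \<in> verts H" "u \<in> \<phi> x" "v \<in> \<phi> y"
      using h[OF *(1)] by blast
    obtain x' y' u' v' where 2: "e' = {x', y'}" "h e = {u', v'}" "x' \<in> verts H" "y' \<in> verts H" "u' \<in> \<phi> x'" "v' \<in> \<phi> y'"
      using h[OF *(2)] *(3) by metis
    have same: "a = b" if "a \<in> verts H" "b \<in> verts H" "w \<in> \<phi> a" "w \<in> \<phi> b" for a b w
      using \<phi>(2) that by blast
    have "u = u' \<and> v = v' \<or> u = v' \<and> v = u'" 
      using 1(2) 2(2) by (metis doubleton_eq_iff)
    then show "e = e'" using same 1 2 by blast
  qed
  then show ?thesis using h finite_edges[OF assms(3)] by (meson card_inj_on_le image_subsetI)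
qed

subsection \<open>Isomorphism\<close>

definition rename :: "('a \<Rightarrow> 'b) \<Rightarrow> 'a sgraph \<Rightarrow> 'b sgraph" where
  "rename f G = (f ` verts G, (\<lambda>e. f ` e) ` edges G)"

lemma verts_rename [simp]: "verts (rename f G) = f ` verts G"
  and edges_rename [simp]: "edges (rename f G) = (\<lambda>e. f ` e) ` edges G"
  by (simp_all add: rename_def)

lemma simple_rename:
  assumes G: "simple_graph G" and f: "inj_on f (verts G)"
  shows "simple_graph (rename f G)"
  unfolding simple_graph_def
proof (intro conjI subsetI)
  show "finite (verts (rename f G))" using finite_verts[OF G] by simp
  fix e assume "e \<in> edges (rename f G)"
  then obtain d where d: "d \<in> edges G" "e = f ` d" by auto
  then have "d \<subseteq> verts G" "card d = 2" using G by (auto simp: simple_graph_def)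
  then show "e \<in> {e. e \<subseteq> verts (rename f G) \<and> card e = 2}"
    using d card_image[OF inj_on_subset[OF f]] by auto
qed

lemma iso_rename: "simple_graph G \<Longrightarrow> inj_on f (verts G) \<Longrightarrow> graph_iso G (rename f G)"
  unfolding graph_iso_def using simple_rename[of G f]
  by (auto simp: bij_betw_def intro!: exI[of _ f])

lemma graph_isoE:
  assumes "graph_iso G H"
  obtains f where "simple_graph G" "simple_graph H" "inj_on f (verts G)" "H = rename f G"
  using assms unfolding graph_iso_def bij_betw_def rename_def by (metis prod.collapse)

lemma graph_iso_refl: "simple_graph G \<Longrightarrow> graph_iso G G"
  using iso_rename[of G id] by (simp add: rename_def)

lemma graph_iso_sym: "graph_iso G H \<Longrightarrow> graph_iso H G"
proof -
  assume "graph_iso G H"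
  then obtain f where f: "simple_graph G" "simple_graph H" "inj_on f (verts G)" "H = rename f G"
    by (metis graph_isoE)
  let ?g = "inv_into (verts G) f"
  have inj: "inj_on ?g (verts H)" using f by (simp add: inj_on_inv_into)
  have e: "?g ` f ` e = e" if "e \<in> edges G" for e
    using f(1,3) that by (intro inv_into_image_cancel) (auto simp: simple_graph_def)
  have "G = rename ?g H"
    unfolding f(4) using e f(3) by (auto simp: rename_def prod_eq_iff image_comp)
  then show ?thesis using iso_rename[OF f(2) inj] by simp
qed

lemma graph_iso_card:
  assumes "graph_iso G H"
  shows "card (verts H) = card (verts G)" "card (edges H) = card (edges G)"
proof -
  obtain f where f: "simple_graph G" "inj_on f (verts G)" "H = rename f G"
    using assms by (metis graph_isoE)
  show "card (verts H) = card (verts G)" using f by (simp add: card_image)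
  have "inj_on (\<lambda>e. f ` e) (edges G)"
    by (rule inj_on_subset[OF inj_on_image_Pow[OF f(2)]]) (use f(1) in \<open>auto simp: simple_graph_def\<close>)
  then show "card (edges H) = card (edges G)" using f by (simp add: card_image)
qed

lemma graph_iso_minor: "graph_iso G H \<Longrightarrow> minor G H"
proof -
  assume "graph_iso G H"
  then obtain f where f: "simple_graph G" "inj_on f (verts G)" "H = rename f G"
    by (metis graph_isoE)
  show ?thesis
  proof (rule minorI[where \<phi> = "\<lambda>x. {f x}"])
    fix e assume e: "e \<in> edges G"
    then obtain x y where xy: "e = {x, y}" using edgeE[OF f(1)] by metis
    have "f ` e \<in> edges H" using e f(3) by simp
    then have "touches H {f x} {f y}" by (simp add: touches_def xy)
    then show "\<exists>x y. e = {x, y} \<and> touches H {f x} {f y}" using xy by blast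
  qed (use f in \<open>auto simp: inj_on_def\<close>)
qed

text \<open>Disjoint nonempty branch sets, as many as there are vertices, are singletons; then the model is
  an embedding, onto the edges by their number.\<close>

lemma minor_same_size_iso:
  assumes m: "minor H G" and H: "simple_graph H" and G: "simple_graph G"
    and v: "card (verts H) = card (verts G)" and e: "card (edges H) = card (edges G)"
  shows "graph_iso H G"
proof -
  obtain \<phi> where \<phi>: "\<forall>x\<in>verts H. \<phi> x \<subseteq> verts G \<and> conn G (\<phi> x)"
    "\<forall>x\<in>verts H. \<forall>y\<in>verts H. x \<noteq> y \<longrightarrow> \<phi> x \<inter> \<phi> y = {}"
    "\<forall>x y. {x, y} \<in> edges H \<longrightarrow> touches G (\<phi> x) (\<phi> y)"
    using m unfolding minor_iff by metis
  have ne: "\<forall>x\<in>verts H. (SOME v. v \<in> \<phi> x) \<in> \<phi> x"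
    using \<phi>(1) conn_nonempty by (metis some_in_eq)
  define f where "f = (\<lambda>x. SOME v. v \<in> \<phi> x)"
  have f: "f x \<in> \<phi> x" if "x \<in> verts H" for x using ne that by (simp add: f_def)
  have inj: "inj_on f (verts H)"
    unfolding inj_on_def using f \<phi>(2) by (metis disjoint_iff)
  have "f ` verts H \<subseteq> verts G" using f \<phi>(1) by blast
  then have im: "f ` verts H = verts G"
    using v card_image[OF inj] finite_verts[OF G] by (metis card_subset_eq)
  have single: "\<phi> x = {f x}" if x: "x \<in> verts H" for x
  proof -
    have "w = f x" if w: "w \<in> \<phi> x" for w
    proof -
      obtain z where "z \<in> verts H" "w = f z" using im w x \<phi>(1) by blast
      then have "z = x" using f[of z] w x \<phi>(2) by blast
      then show ?thesis using \<open>w = f z\<close> by simp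
    qed
    then show ?thesis using f[OF x] by blast
  qed
  have sub: "(\<lambda>e. f ` e) ` edges H \<subseteq> edges G"
  proof
    fix d assume "d \<in> (\<lambda>e. f ` e) ` edges H"
    then obtain e where e: "e \<in> edges H" "d = f ` e" by auto
    then obtain x y where xy: "e = {x, y}" "x \<in> verts H" "y \<in> verts H"
      using edgeE[OF H] by metis
    then have "touches G {f x} {f y}" using \<phi>(3) e single by metis
    then show "d \<in> edges G" using e xy by (simp add: touches_def)
  qed
  have "card ((\<lambda>e. f ` e) ` edges H) = card (edges H)"
    using graph_iso_card(2)[OF iso_rename[OF H inj]] by simp
  then have "(\<lambda>e. f ` e) ` edges H = edges G"
    using sub e finite_edges[OF G] by (metis card_subset_eq)
  then have "G = rename f H" using im by (simp add: rename_def prod_eq_iff)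
  then show ?thesis using iso_rename[OF H inj] by simp
qed

lemma nat_copy:
  assumes "simple_graph G"
  obtains R :: "nat sgraph" where "graph_iso G R" "verts R = {..<card (verts G)}"
proof -
  obtain f where f: "bij_betw f (verts G) {..<card (verts G)}"
    using ex_bij_betw_finite_nat[OF finite_verts[OF assms]] by (auto simp: atLeast0LessThan)
  show ?thesis
    by (rule that[of "rename f G"]) (use f assms in \<open>auto simp: bij_betw_def intro: iso_rename\<close>)
qed

subsection \<open>Disjoint copies\<close>

lemma verts_copies [simp]: "verts (copies k H) = {..<k} \<times> verts H"
  by (simp add: copies_def)

lemma edges_copies: "edges (copies k H) = {Pair i ` e | i e. i < k \<and> e \<in> edges H}"
  by (simp add: copies_def)

lemma pair_edge_copies: "{(i, x), (j, y)} \<in> edges (copies k H) \<longleftrightarrow> i = j \<and> i < k \<and> {x, y} \<in> edges H"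
proof
  assume "{(i, x), (j, y)} \<in> edges (copies k H)"
  then obtain l e where l: "{(i, x), (j, y)} = Pair l ` e" "l < k" "e \<in> edges H"
    by (auto simp: edges_copies)
  then have "i = l" "j = l" by auto
  moreover have "e = snd ` (Pair l ` e)" by (simp add: image_comp)
  then have "e = {x, y}" unfolding l(1)[symmetric] by simp
  ultimately show "i = j \<and> i < k \<and> {x, y} \<in> edges H" using l by simp
next
  assume "i = j \<and> i < k \<and> {x, y} \<in> edges H"
  then show "{(i, x), (j, y)} \<in> edges (copies k H)"
    by (auto simp: edges_copies intro!: exI[of _ j] exI[of _ "{x, y}"])
qed

lemma simple_copies: "simple_graph H \<Longrightarrow> simple_graph (copies k H)"
  unfolding simple_graph_def by (auto simp: edges_copies card_image inj_on_def)

lemma minor_copies_disjoint: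
  assumes H: "simple_graph H"
    and S: "\<And>i. i < k \<Longrightarrow> S i \<subseteq> verts G" "\<And>i. i < k \<Longrightarrow> minor H (induced G (S i))"
    and d: "\<And>i j. i < k \<Longrightarrow> j < k \<Longrightarrow> i \<noteq> j \<Longrightarrow> S i \<inter> S j = {}"
  shows "minor (copies k H) G"
proof -
  have "\<forall>i. \<exists>\<phi>. i < k \<longrightarrow> (\<forall>x\<in>verts H. \<phi> x \<subseteq> S i \<and> conn G (\<phi> x)) \<and>
     (\<forall>x\<in>verts H. \<forall>y\<in>verts H. x \<noteq> y \<longrightarrow> \<phi> x \<inter> \<phi> y = {}) \<and>
     (\<forall>x y. {x, y} \<in> edges H \<longrightarrow> touches G (\<phi> x) (\<phi> y))"
  proof
    fix i
    show "\<exists>\<phi>. i < k \<longrightarrow> (\<forall>x\<in>verts H. \<phi> x \<subseteq> S i \<and> conn G (\<phi> x)) \<and>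
     (\<forall>x\<in>verts H. \<forall>y\<in>verts H. x \<noteq> y \<longrightarrow> \<phi> x \<inter> \<phi> y = {}) \<and>
     (\<forall>x y. {x, y} \<in> edges H \<longrightarrow> touches G (\<phi> x) (\<phi> y))"
    proof (cases "i < k")
      case True
      obtain \<phi> where f: "\<forall>x\<in>verts H. \<phi> x \<subseteq> S i \<and> conn (induced G (S i)) (\<phi> x)"
       "\<forall>x\<in>verts H. \<forall>y\<in>verts H. x \<noteq> y \<longrightarrow> \<phi> x \<inter> \<phi> y = {}"
       "\<forall>x y. {x, y} \<in> edges H \<longrightarrow> touches (induced G (S i)) (\<phi> x) (\<phi> y)"
        using S(2)[OF True] unfolding minor_iff by (auto simp del: edges_induced)
      have "\<forall>x\<in>verts H. \<phi> x \<subseteq> S i \<and> conn G (\<phi> x)" using f(1) conn_induced by metis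
      moreover have "\<forall>x y. {x, y} \<in> edges H \<longrightarrow> touches G (\<phi> x) (\<phi> y)"
        using f(3) touches_inducedD by metis
      ultimately show ?thesis using f(2) by (intro exI[of _ \<phi>] impI conjI)
    qed simp
  qed
  then obtain \<phi> where \<phi>: "\<And>i. i < k \<Longrightarrow> (\<forall>x\<in>verts H. \<phi> i x \<subseteq> S i \<and> conn G (\<phi> i x)) \<and>
     (\<forall>x\<in>verts H. \<forall>y\<in>verts H. x \<noteq> y \<longrightarrow> \<phi> i x \<inter> \<phi> i y = {}) \<and>
     (\<forall>x y. {x, y} \<in> edges H \<longrightarrow> touches G (\<phi> i x) (\<phi> i y))"
    by metis
  have sub: "\<phi> i x \<subseteq> S i" if "i < k" "x \<in> verts H" for i x using \<phi>[OF that(1)] that(2) by blast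
  show ?thesis
  proof (rule minorI[where \<phi> = "\<lambda>(i, x). \<phi> i x"])
    fix p q assume pq: "p \<in> verts (copies k H)" "q \<in> verts (copies k H)" "p \<noteq> q"
    then obtain i x j y where ij: "p = (i, x)" "q = (j, y)" "i < k" "j < k" "x \<in> verts H" "y \<in> verts H"
      by auto
    show "(case p of (i, x) \<Rightarrow> \<phi> i x) \<inter> (case q of (i, x) \<Rightarrow> \<phi> i x) = {}"
    proof (cases "i = j")
      case True
      then show ?thesis using \<phi>[OF ij(3)] ij pq(3) by auto
    next
      case False
      then show ?thesis using d[OF ij(3,4)] sub[OF ij(3,5)] sub[OF ij(4,6)] ij(1,2) by auto
    qed
  next
    fix e assume "e \<in> edges (copies k H)"
    then obtain i d where i: "i < k" "d \<in> edges H" "e = Pair i ` d" by (auto simp: edges_copies)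
    then obtain x y where "d = {x, y}" using edgeE[OF H] by metis
    then show "\<exists>p q. e = {p, q} \<and> touches G (case p of (i, x) \<Rightarrow> \<phi> i x) (case q of (i, x) \<Rightarrow> \<phi> i x)"
      using i \<phi>[OF i(1)] by (intro exI[of _ "(i, x)"] exI[of _ "(i, y)"]) auto
  next
    fix p assume "p \<in> verts (copies k H)"
    then obtain i x where p: "p = (i, x)" "i < k" "x \<in> verts H" by auto
    show "(case p of (i, x) \<Rightarrow> \<phi> i x) \<subseteq> verts G" using sub[OF p(2,3)] S(1)[OF p(2)] p(1) by auto
    show "conn G (case p of (i, x) \<Rightarrow> \<phi> i x)" using \<phi>[OF p(2)] p by simp
  qed
qed

lemma minor_in_copy:
  assumes H: "simple_graph H" and i: "i < k"
  shows "minor H (induced (copies k H) ({i} \<times> verts H))"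
proof (rule minorI[where \<phi> = "\<lambda>x. {(i, x)}"])
  fix e assume e: "e \<in> edges H"
  then obtain x y where "e = {x, y}" "x \<in> verts H" "y \<in> verts H" using edgeE[OF H] by metis
  then show "\<exists>x y. e = {x, y} \<and> touches (induced (copies k H) ({i} \<times> verts H)) {(i, x)} {(i, y)}"
    using e i by (auto simp: touches_def pair_edge_copies)
qed auto

lemma minor_copies_mono:
  assumes H: "simple_graph H" and m: "minor H K" and K: "simple_graph K" and le: "k \<le> l"
  shows "minor (copies k H) (copies l K)"
proof (rule minor_copies_disjoint[OF H, where S = "\<lambda>i. {i} \<times> verts K"])
  show "minor H (induced (copies l K) ({i} \<times> verts K))" if "i < k" for i
    using minor_trans[OF H m minor_in_copy[OF K]] that le by simp
qed (use le in auto)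

lemma conn_image:
  assumes S: "conn G S" and e: "\<And>u v. u \<in> S \<Longrightarrow> v \<in> S \<Longrightarrow> {u, v} \<in> edges G \<Longrightarrow> f u = f v \<or> {f u, f v} \<in> edges K"
  shows "conn K (f ` S)"
  unfolding conn_cut_iff
proof (intro conjI allI impI)
  show "f ` S \<noteq> {}" using conn_nonempty[OF S] by simp
  fix A assume A: "A \<subseteq> f ` S \<and> A \<noteq> {} \<and> A \<noteq> f ` S"
  let ?B = "{v \<in> S. f v \<in> A}"
  have "touches G ?B (S - ?B)"
    by (rule connD[OF S]) (use A in auto)
  then obtain u v where "u \<in> S" "f u \<in> A" "v \<in> S" "f v \<notin> A" "{u, v} \<in> edges G"
    by (auto simp: touches_def)
  then show "touches K A (f ` S - A)" using e[of u v] by (auto intro!: touchesI[of "f u" "f v"])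
qed

lemma conn_constant:
  assumes "conn G S" "\<And>u v. u \<in> S \<Longrightarrow> v \<in> S \<Longrightarrow> {u, v} \<in> edges G \<Longrightarrow> c u = c v" "a \<in> S" "b \<in> S"
  shows "c a = c b"
proof (rule ccontr)
  assume ne: "c a \<noteq> c b"
  let ?A = "{v \<in> S. c v = c a}"
  have "a \<in> ?A" "b \<notin> ?A" using assms(3) ne by auto
  then have "touches G ?A (S - ?A)"
    by (intro connD[OF assms(1)]) (use assms(4) in auto)
  then show False using assms(2) by (auto simp: touches_def)
qed

lemma minor_sub_minor_conn:
  assumes "conn H S" "\<And>x. x \<in> S \<Longrightarrow> conn G (\<phi> x)"
    "\<And>x y. {x, y} \<in> edges H \<Longrightarrow> touches G (\<phi> x) (\<phi> y)"
  shows "conn G (\<Union>x\<in>S. \<phi> x)"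
  using conn_blowup[of H S G \<phi>] assms by blast

text \<open>Edges of \<open>copies k H\<close> preserve the first coordinate, which is therefore constant on the union of
  the branch sets of a connected graph; projecting to the second coordinate loses nothing.\<close>

lemma connected_minor_of_copies:
  assumes H: "simple_graph H" and H': "simple_graph H'" and c: "graph_connected H'"
    and m: "minor H' (copies k H)"
  shows "minor H' H"
proof -
  obtain \<phi> where \<phi>: "\<And>x. x \<in> verts H' \<Longrightarrow> \<phi> x \<subseteq> verts (copies k H) \<and> conn (copies k H) (\<phi> x)"
    "\<And>x y. x \<in> verts H' \<Longrightarrow> y \<in> verts H' \<Longrightarrow> x \<noteq> y \<Longrightarrow> \<phi> x \<inter> \<phi> y = {}"
    "\<And>x y. {x, y} \<in> edges H' \<Longrightarrow> touches (copies k H) (\<phi> x) (\<phi> y)"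
    using m unfolding minor_iff by metis
  have "conn H' (verts H')" using c H' by (simp add: graph_connected_iff_conn)
  then have cU: "conn (copies k H) (\<Union>x\<in>verts H'. \<phi> x)"
    by (rule minor_sub_minor_conn) (use \<phi> in blast)+
  have eq: "fst a = fst b" if "{a, b} \<in> edges (copies k H)" for a b
    using that pair_edge_copies[of "fst a" "snd a" "fst b" "snd b" k H] by simp
  have same: "fst a = fst b" if "a \<in> \<phi> x" "x \<in> verts H'" "b \<in> \<phi> y" "y \<in> verts H'" for a b x y
    by (rule conn_constant[OF cU, of fst]) (use that eq in blast)+
  show ?thesis
  proof (rule minorI[where \<phi> = "\<lambda>x. snd ` \<phi> x"])
    show "snd ` \<phi> x \<subseteq> verts H" if "x \<in> verts H'" for x using \<phi>(1)[OF that] by auto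
    show "conn H (snd ` \<phi> x)" if "x \<in> verts H'" for x
      by (rule conn_image[of "copies k H"]) (use \<phi>(1)[OF that] in \<open>auto simp: pair_edge_copies\<close>)
    show "snd ` \<phi> x \<inter> snd ` \<phi> y = {}" if "x \<in> verts H'" "y \<in> verts H'" "x \<noteq> y" for x y
    proof (rule ccontr)
      assume "snd ` \<phi> x \<inter> snd ` \<phi> y \<noteq> {}"
      then obtain a b where ab: "a \<in> \<phi> x" "b \<in> \<phi> y" "snd a = snd b" by auto
      then have "a = b" using same[of a x b y] that by (simp add: prod_eq_iff)
      then show False using \<phi>(2)[OF that] ab by auto
    qed
    fix e assume e: "e \<in> edges H'"
    then obtain x y where xy: "e = {x, y}" using edgeE[OF H'] by metis
    have "touches (copies k H) (\<phi> x) (\<phi> y)" using \<phi>(3) e xy by blast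
    then obtain a b where "a \<in> \<phi> x" "b \<in> \<phi> y" "{a, b} \<in> edges (copies k H)"
      by (rule touchesE)
    then have "touches H (snd ` \<phi> x) (snd ` \<phi> y)"
      using pair_edge_copies[of "fst a" "snd a" "fst b" "snd b" k H]
      by (intro touchesI[of "snd a" "snd b"]) auto
    then show "\<exists>x y. e = {x, y} \<and> touches H (snd ` \<phi> x) (snd ` \<phi> y)" using xy by blast
  qed
qed

section \<open>Attachments in graphs without large daisies and diamonds\<close>

lemma indexed_subset:
  assumes "finite A" "k \<le> card A"
  obtains f where "inj_on f {..<k}" "f ` {..<k} \<subseteq> A"
proof -
  obtain B where B: "B \<subseteq> A" "card B = k" "finite B"
    using assms by (metis obtain_subset_with_card_n)
  then obtain f where "bij_betw f {0..<k} B" using ex_bij_betw_nat_finite[of B] by auto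
  then show ?thesis using B that[of f] by (auto simp: bij_betw_def atLeast0LessThan)
qed

lemma component_touches_rest:
  assumes "conn G S" "T \<noteq> {}" "T \<subseteq> S - R" "\<not> touches G T (S - R - T)" "S \<inter> R \<noteq> {}"
  shows "touches G T R"
proof -
  have "touches G T (S - T)" by (rule connD[OF assms(1)]) (use assms in auto)
  then obtain a b where "a \<in> T" "b \<in> S - T" "{a, b} \<in> edges G" by (rule touchesE)
  moreover from this have "b \<in> R" using assms(4) by (auto simp: touches_def)
  ultimately show ?thesis by (auto intro: touchesI)
qed

text \<open>Every component of \<open>S - {v}\<close> hangs at \<open>v\<close>, so removing one leaves the others joined through \<open>v\<close>.\<close>

lemma conn_remove_component:
  assumes S: "conn G S" and v: "v \<in> S" and T: "T \<subseteq> S - {v}" "\<not> touches G T (S - {v} - T)"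
  shows "conn G (S - T)"
  unfolding conn_cut_iff
proof (intro conjI allI impI)
  show "S - T \<noteq> {}" using v T by auto
  fix A assume A: "A \<subseteq> S - T \<and> A \<noteq> {} \<and> A \<noteq> S - T"
  have main: "touches G B (S - T - B)" if B: "B \<subseteq> S - T" "B \<noteq> {}" "v \<notin> B" for B
  proof -
    have "touches G B (S - B)" by (rule connD[OF S]) (use B v in auto)
    then obtain a b where ab: "a \<in> B" "b \<in> S - B" "{a, b} \<in> edges G" by (rule touchesE)
    have "b \<notin> T"
    proof
      assume "b \<in> T"
      then have "touches G T (S - {v} - T)"
        using ab B by (intro touchesI[of b a]) (auto simp: insert_commute)
      then show False using T by simp
    qed
    then show ?thesis using ab by (intro touchesI[of a b]) auto
  qed
  show "touches G A (S - T - A)"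
  proof (cases "v \<in> A")
    case True
    have "touches G (S - T - A) (S - T - (S - T - A))" by (rule main) (use A True in auto)
    moreover have "S - T - (S - T - A) = A" using A by auto
    ultimately show ?thesis using touches_sym by metis
  qed (use main A in auto)
qed

lemma components_equal_or_disjoint:
  assumes "conn G T'" "T' \<subseteq> S" "\<not> touches G T (S - T)" "T \<inter> T' \<noteq> {}"
  shows "T' \<subseteq> T"
proof (rule ccontr)
  assume "\<not> T' \<subseteq> T"
  then have "touches G (T' \<inter> T) (T' - T' \<inter> T)"
    by (intro connD[OF assms(1)]) (use assms in auto)
  then have "touches G T (S - T)" by (rule touches_mono) (use assms in auto)
  then show False using assms by simp
qed

lemma conn_split:
  assumes S: "conn G S" and ab: "a \<in> S" "b \<in> S" "a \<noteq> b"
  obtains P Q where "P \<subseteq> S" "Q \<subseteq> S" "P \<inter> Q = {}" "a \<in> P" "b \<in> Q" "conn G P" "conn G Q" "touches G P Q"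
proof -
  have "b \<in> S - {a}" using ab by simp
  then obtain Q where Q: "b \<in> Q" "Q \<subseteq> S - {a}" "conn G Q" "\<not> touches G Q (S - {a} - Q)"
    by (rule component_exists)
  have "touches G Q {a}"
    by (rule component_touches_rest[OF S _ Q(2,4)]) (use Q ab in auto)
  then have "touches G {a} Q" by (simp add: touches_sym)
  then show ?thesis using Q ab by (intro that[of "{a}" Q]) auto
qed

subsection \<open>Triangles through a contracted set\<close>

text \<open>Contracting \<open>X \<union> Z\<close>, \<open>P\<close> and \<open>Q\<close> gives a triangle.  The set \<open>Z\<close> may depend on \<open>S\<close>: for disjoint sets \<open>S\<close>
  the enlargements of \<open>X\<close> are united to the centre of a daisy.\<close>

definition tri_parts :: "'a sgraph \<Rightarrow> 'a set \<Rightarrow> 'a set \<Rightarrow> 'a set \<Rightarrow> 'a set \<Rightarrow> 'a set \<Rightarrow> bool" where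
  "tri_parts G X S Z P Q \<longleftrightarrow> Z \<subseteq> S \<and> P \<subseteq> S \<and> Q \<subseteq> S \<and> Z \<inter> P = {} \<and> Z \<inter> Q = {} \<and> P \<inter> Q = {} \<and>
     conn G (X \<union> Z) \<and> conn G P \<and> conn G Q \<and>
     touches G P Q \<and> touches G (X \<union> Z) P \<and> touches G (X \<union> Z) Q"

definition tri :: "'a sgraph \<Rightarrow> 'a set \<Rightarrow> 'a set \<Rightarrow> bool" where
  "tri G X S \<longleftrightarrow> (\<exists>Z P Q. tri_parts G X S Z P Q)"

lemma tri_two_attachments:
  assumes "conn G X" "conn G S" "a \<in> S" "b \<in> S" "a \<noteq> b" "touches G X {a}" "touches G X {b}"
  shows "tri G X S"
proof -
  obtain P Q where PQ: "P \<subseteq> S" "Q \<subseteq> S" "P \<inter> Q = {}" "a \<in> P" "b \<in> Q" "conn G P" "conn G Q" "touches G P Q"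
    using conn_split[OF assms(2-5)] by blast
  have "touches G X P" "touches G X Q"
    using touches_mono[OF assms(6), of X P] touches_mono[OF assms(7), of X Q] PQ by auto
  then show ?thesis unfolding tri_def tri_parts_def
    by (intro exI[of _ "{}"] exI[of _ P] exI[of _ Q]) (use PQ assms in simp)
qed

lemma tri_absorb:
  assumes "tri G (X \<union> W) T'" "W \<subseteq> T" "T' \<subseteq> T - W"
  shows "tri G X T"
proof -
  obtain Z P Q where *: "Z \<subseteq> T'" "P \<subseteq> T'" "Q \<subseteq> T'" "Z \<inter> P = {}" "Z \<inter> Q = {}" "P \<inter> Q = {}"
    "conn G (X \<union> W \<union> Z)" "conn G P" "conn G Q"
    "touches G P Q" "touches G (X \<union> W \<union> Z) P" "touches G (X \<union> W \<union> Z) Q"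
    using assms(1) unfolding tri_def tri_parts_def by blast
  show ?thesis unfolding tri_def tri_parts_def
    by (intro exI[of _ "W \<union> Z"] exI[of _ P] exI[of _ Q])
       (use * assms(2,3) in \<open>auto simp: Un_assoc\<close>)
qed

text \<open>Minimum degree two forces a cycle in \<open>T\<close>, which may lie far from \<open>X\<close>.  The way towards it absorbs
  attachment vertices into \<open>X\<close> one at a time, until two attachments are seen at once.\<close>

lemma tri_min_degree:
  assumes "simple_graph G" "finite T" "conn G X" "conn G T" "v \<in> T" "touches G X {v}" "T \<noteq> {v}"
    and "\<And>u. u \<in> T - {v} \<Longrightarrow> \<exists>a b. a \<noteq> b \<and> a \<in> T \<and> b \<in> T \<and> {u, a} \<in> edges G \<and> {u, b} \<in> edges G"
  shows "tri G X T"
  using assms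
proof (induction "card T" arbitrary: T X v rule: less_induct)
  case less
  note G = less.prems(1) and deg = less.prems(8)
  obtain u where "u \<in> T - {v}" using less.prems(5,7) by blast
  then obtain T' where T': "u \<in> T'" "T' \<subseteq> T - {v}" "conn G T'" "\<not> touches G T' (T - {v} - T')"
    by (rule component_exists)
  have "touches G T' {v}"
    by (rule component_touches_rest[OF less.prems(4) _ T'(2,4)]) (use T' less.prems in auto)
  then obtain w where w: "w \<in> T'" "{w, v} \<in> edges G" by (auto elim: touchesE)
  have cX: "conn G (X \<union> {v})" by (rule conn_Un) (use less.prems in auto)
  have stay: "a \<in> T'" if "x \<in> T'" "a \<in> T" "a \<noteq> v" "{x, a} \<in> edges G" for x a
    using T'(4) touchesI[OF that(4), of T' "T - {v} - T'"] that by blast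
  have "tri G (X \<union> {v}) T'"
  proof (cases "\<exists>w'\<in>T'. w' \<noteq> w \<and> {w', v} \<in> edges G")
    case True
    then obtain w' where "w' \<in> T'" "w' \<noteq> w" "{w', v} \<in> edges G" by blast
    then show ?thesis using w
      by (intro tri_two_attachments[OF cX T'(3), of w w'])
         (auto simp: insert_commute intro: touchesI[of v])
  next
    case False
    obtain a b where ab: "a \<noteq> b" "a \<in> T" "b \<in> T" "{w, a} \<in> edges G" "{w, b} \<in> edges G"
      using deg[of w] w T' by blast
    then have "a \<in> T' \<and> a \<noteq> w \<or> b \<in> T' \<and> b \<noteq> w"
      using stay[of w] w(1) edge_neq[OF G ab(4)] edge_neq[OF G ab(5)] by metis
    then have ne: "T' \<noteq> {w}" by auto
    show ?thesis
    proof (rule less.hyps[OF _ G _ cX T'(3) w(1) _ ne])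
      show "card T' < card T"
        using T'(2) less.prems(2,5) by (metis Diff_subset insert_Diff psubset_card_mono psubsetI subset_Diff_insert subset_insertI subset_trans)
      show "finite T'" using T'(2) less.prems(2) finite_subset by blast
      show "touches G (X \<union> {v}) {w}" using w by (auto simp: insert_commute intro: touchesI[of v])
      show "\<exists>a b. a \<noteq> b \<and> a \<in> T' \<and> b \<in> T' \<and> {x, a} \<in> edges G \<and> {x, b} \<in> edges G"
        if x: "x \<in> T' - {w}" for x
      proof -
        obtain a b where ab: "a \<noteq> b" "a \<in> T" "b \<in> T" "{x, a} \<in> edges G" "{x, b} \<in> edges G"
          using deg[of x] x T' by blast
        have "a \<noteq> v" "b \<noteq> v" using ab False x by auto
        then show ?thesis using stay[of x] ab x by blast
      qed
    qed
  qed
  then show ?case by (rule tri_absorb) (use T' less.prems in auto)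
qed

lemma simple_daisy: "simple_graph (daisy k)"
  unfolding simple_graph_def daisy_def by (auto simp: card_insert_if)

lemma simple_diamond: "simple_graph (diamond k)"
  unfolding simple_graph_def diamond_def by (auto simp: card_insert_if)

lemma daisy_minor:
  assumes X: "conn G X" "X \<subseteq> verts G"
    and S: "\<And>i. i < k \<Longrightarrow> S i \<subseteq> verts G - X" "\<And>i. i < k \<Longrightarrow> tri G X (S i)"
    and d: "\<And>i j. i < k \<Longrightarrow> j < k \<Longrightarrow> i \<noteq> j \<Longrightarrow> S i \<inter> S j = {}"
  shows "minor (daisy k) G"
proof -
  obtain Z P Q where "\<And>i. i < k \<Longrightarrow> tri_parts G X (S i) (Z i) (P i) (Q i)"
    using S(2) unfolding tri_def by metis
  note * = this[unfolded tri_parts_def]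
  define c where "c = X \<union> (\<Union>i\<in>{..<k}. X \<union> Z i)"
  have "conn G c" unfolding c_def
    by (rule conn_UN[OF X(1)]) (use * conn_nonempty[OF X(1)] in auto)
  \<comment> \<open>Vertices \<open>2 i + 1\<close> and \<open>2 i + 2\<close> of the daisy form the petal with index \<open>i\<close>, counted from \<open>0\<close>.\<close>
  define R where "R j = (if odd j then P (j div 2) else Q (j div 2 - 1))" for j
  define I where "I j = (if odd j then j div 2 else j div 2 - 1)" for j :: nat
  have I: "I j < k" if "1 \<le> j" "j \<le> 2 * k" for j using that unfolding I_def by (auto elim!: oddE evenE)
  have R: "R j \<subseteq> S (I j)" "conn G (R j)" "touches G c (R j)" "c \<inter> R j = {}" if j: "1 \<le> j" "j \<le> 2 * k" for j
  proof -
    note s = *[OF I[OF j]]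
    have RI: "R j = P (I j) \<or> R j = Q (I j)" by (auto simp: R_def I_def)
    then show "R j \<subseteq> S (I j)" "conn G (R j)" using s by auto
    have "touches G (X \<union> Z (I j)) (R j)" using s RI by auto
    then show "touches G c (R j)" by (rule touches_mono) (use I[OF j] in \<open>auto simp: c_def\<close>)
    have "Z i \<inter> R j = {}" if "i < k" for i
    proof (cases "i = I j")
      case True
      then show ?thesis using s RI by auto
    next
      case False
      then have "S i \<inter> S (I j) = {}" using d that I[OF j] by simp
      then show ?thesis using *[OF that] s RI by blast
    qed
    moreover have "X \<inter> R j = {}" using S(1)[OF I[OF j]] s RI by blast
    ultimately show "c \<inter> R j = {}" by (auto simp: c_def)
  qed
  have RR: "R i \<inter> R j = {}" if ij: "1 \<le> i" "i \<le> 2 * k" "1 \<le> j" "j \<le> 2 * k" "i \<noteq> j" for i j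
  proof (cases "I i = I j")
    case False
    then show ?thesis using d[OF I[OF ij(1,2)] I[OF ij(3,4)]] R(1)[OF ij(1,2)] R(1)[OF ij(3,4)] by blast
  next
    case True
    have "odd i \<noteq> odd j"
    proof
      assume par: "odd i = odd j"
      have "i = j"
      proof (cases "odd i")
        case True
        then show ?thesis using par \<open>I i = I j\<close> by (auto simp: I_def elim!: oddE)
      next
        case False
        then show ?thesis using par \<open>I i = I j\<close> ij by (auto simp: I_def elim!: evenE)
      qed
      then show False using ij by simp
    qed
    then have "{R i, R j} = {P (I i), Q (I i)}" using True by (auto simp: R_def I_def)
    moreover have "P (I i) \<inter> Q (I i) = {}" using *[OF I[OF ij(1,2)]] by blast
    ultimately show ?thesis by (auto simp: doubleton_eq_iff Int_commute)
  qed
  show ?thesis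
  proof (rule minorI[where \<phi> = "\<lambda>j. if j = 0 then c else R j"])
    fix x assume "x \<in> verts (daisy k)"
    then have x: "x \<noteq> 0 \<Longrightarrow> 1 \<le> x \<and> x \<le> 2 * k" by (auto simp: daisy_def)
    show "(if x = 0 then c else R x) \<subseteq> verts G"
    proof (cases "x = 0")
      case True
      have "Z i \<subseteq> verts G" if "i < k" for i using *[OF that] S(1)[OF that] by blast
      then have "c \<subseteq> verts G" using X(2) unfolding c_def by blast
      then show ?thesis using True by simp
    next
      case False
      then show ?thesis using R(1)[of x] x S(1)[OF I[of x]] by auto
    qed
    show "conn G (if x = 0 then c else R x)" using \<open>conn G c\<close> R(2)[of x] x by auto
    fix y assume "y \<in> verts (daisy k)" "x \<noteq> y"
    then have y: "y \<noteq> 0 \<Longrightarrow> 1 \<le> y \<and> y \<le> 2 * k" by (auto simp: daisy_def)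
    show "(if x = 0 then c else R x) \<inter> (if y = 0 then c else R y) = {}"
      using R(4)[of x] R(4)[of y] RR[of x y] x y \<open>x \<noteq> y\<close> by (cases "x = 0"; cases "y = 0") (auto simp: Int_commute)
  next
    fix e assume "e \<in> edges (daisy k)"
    then consider (spoke) i where "e = {0, i}" "1 \<le> i" "i \<le> 2 * k"
      | (rim) i where "e = {2 * i - 1, 2 * i}" "1 \<le> i" "i \<le> k"
      by (auto simp: daisy_def)
    then show "\<exists>x y. e = {x, y} \<and> touches G (if x = 0 then c else R x) (if y = 0 then c else R y)"
    proof cases
      case spoke
      then show ?thesis using R(3)[of i] by (intro exI[of _ 0] exI[of _ i]) auto
    next
      case rim
      have "R (2 * i - 1) = P (i - 1)" "R (2 * i) = Q (i - 1)"
        using rim(2) by (auto simp: R_def elim!: oddE) (cases i; auto)+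
      moreover have "touches G (P (i - 1)) (Q (i - 1))" using *[of "i - 1"] rim by auto
      ultimately show ?thesis using rim
        by (intro exI[of _ "2 * i - 1"] exI[of _ "2 * i"]) auto
    qed
  qed
qed

text \<open>One of the \<open>k + 1\<close> connectors is contracted into \<open>X\<close> to make the two hubs adjacent.\<close>

lemma diamond_minor:
  assumes X: "conn G X" "X \<subseteq> verts G" and Q: "conn G Q" "Q \<subseteq> verts G" "X \<inter> Q = {}"
    and R: "\<And>i. i \<le> k \<Longrightarrow> conn G (R i)" "\<And>i. i \<le> k \<Longrightarrow> R i \<subseteq> verts G - X - Q"
      "\<And>i. i \<le> k \<Longrightarrow> touches G X (R i)" "\<And>i. i \<le> k \<Longrightarrow> touches G Q (R i)"
    and d: "\<And>i j. i \<le> k \<Longrightarrow> j \<le> k \<Longrightarrow> i \<noteq> j \<Longrightarrow> R i \<inter> R j = {}"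
  shows "minor (diamond k) G"
proof -
  have c: "conn G (X \<union> R k)" by (rule conn_Un) (use X R in auto)
  let ?f = "\<lambda>j. if j = 0 then X \<union> R k else if j = 1 then Q else R (j - 2)"
  have sub: "R i \<subseteq> verts G" "R i \<inter> X = {}" "R i \<inter> Q = {}" if "i \<le> k" for i using R(2)[OF that] by auto
  have verts: "verts (diamond k) = {0..k + 1}" by (simp add: diamond_def)
  show ?thesis
  proof (rule minorI[where \<phi> = ?f])
    fix x assume x: "x \<in> verts (diamond k)"
    show "?f x \<subseteq> verts G" using X Q sub[of k] sub[of "x - 2"] x by (auto simp: verts)
    show "conn G (?f x)" using c Q R(1)[of "x - 2"] x by (auto simp: verts)
    fix y assume y: "y \<in> verts (diamond k)" "x \<noteq> y"
    have *: "?f x \<inter> ?f y = {}" if "x < y" "x \<in> verts (diamond k)" "y \<in> verts (diamond k)" for x y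
    proof -
      have "x = 0 \<and> y = 1 \<or> x = 0 \<and> y \<ge> 2 \<or> x = 1 \<and> y \<ge> 2 \<or> x \<ge> 2 \<and> y \<ge> 2"
        using that(1) by arith
      then consider "x = 0" "y = 1" | "x = 0" "y \<ge> 2" | "x = 1" "y \<ge> 2" | "x \<ge> 2" "y \<ge> 2"
        by blast
      then show ?thesis
      proof cases
        case 1 then show ?thesis using Q sub[of k] by auto
      next
        case 2
        then have "y - 2 < k" using that by (simp add: verts)
        then show ?thesis using 2 sub(2)[of "y - 2"] d[of k "y - 2"] by auto
      next
        case 3
        then have "y - 2 \<le> k" using that by (simp add: verts)
        then show ?thesis using 3 sub(3)[of "y - 2"] by auto
      next
        case 4
        then show ?thesis using that d[of "x - 2" "y - 2"] by (auto simp: verts)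
      qed
    qed
    show "?f x \<inter> ?f y = {}"
    proof (cases "x < y")
      case True
      then show ?thesis using *[of x y] x y(1) by blast
    next
      case False
      then have "y < x" using y(2) by simp
      then show ?thesis using *[of y x] x y(1) by (metis Int_commute)
    qed
  next
    fix e assume "e \<in> edges (diamond k)"
    then consider "e = {0, 1}" | i where "e = {0, i}" "2 \<le> i" "i \<le> k + 1" | i where "e = {1, i}" "2 \<le> i" "i \<le> k + 1"
      by (auto simp: diamond_def)
    then show "\<exists>x y. e = {x, y} \<and> touches G (?f x) (?f y)"
    proof cases
      case 1
      have "touches G (X \<union> R k) Q"
        using R(4)[of k] touches_mono[of G Q "R k" Q "X \<union> R k"] by (simp add: touches_sym[of G _ Q])
      then show ?thesis using 1 by (intro exI[of _ 0] exI[of _ 1]) simp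
    next
      case 2
      have "touches G (X \<union> R k) (R (i - 2))"
        using R(3)[of "i - 2"] touches_mono[of G X "R (i - 2)" "X \<union> R k"] 2 by auto
      then show ?thesis using 2 by (intro exI[of _ 0] exI[of _ i]) simp
    next
      case 3
      then show ?thesis using R(4)[of "i - 2"] by (intro exI[of _ 1] exI[of _ i]) simp
    qed
  qed
qed

subsection \<open>Pairs or a star\<close>

text \<open>Two ways in which a connected set can carry many terminals (vertices of \<open>Y\<close>): many disjoint connected parts with
  two terminals each, or many disjoint branches with a terminal at a common vertex.\<close>

definition pairing :: "'a sgraph \<Rightarrow> 'a set \<Rightarrow> 'a set \<Rightarrow> nat \<Rightarrow> (nat \<Rightarrow> 'a set) \<Rightarrow> bool" where
  "pairing G C Y m S \<longleftrightarrow> (\<forall>i<m. S i \<subseteq> C \<and> conn G (S i) \<and> card (S i \<inter> Y) \<ge> 2) \<and>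
     (\<forall>i<m. \<forall>j<m. i \<noteq> j \<longrightarrow> S i \<inter> S j = {})"

definition star_to :: "'a sgraph \<Rightarrow> 'a set \<Rightarrow> 'a set \<Rightarrow> nat \<Rightarrow> 'a \<Rightarrow> (nat \<Rightarrow> 'a set) \<Rightarrow> bool" where
  "star_to G C Y k v R \<longleftrightarrow> v \<in> C \<and>
     (\<forall>i<k. R i \<subseteq> C - {v} \<and> conn G (R i) \<and> R i \<inter> Y \<noteq> {} \<and> touches G {v} (R i)) \<and>
     (\<forall>i<k. \<forall>j<k. i \<noteq> j \<longrightarrow> R i \<inter> R j = {})"

text \<open>A smallest part with two terminals that can be split off is either small in terminals, or all
  branches at its attachment vertex carry at most one terminal each, and then there are many branches.\<close>

lemma split_off_or_star:
  assumes C: "conn G C" "finite C" and Y: "card (C \<inter> Y) \<ge> 2"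
  shows "(\<exists>S. S \<subseteq> C \<and> conn G S \<and> (C - S = {} \<or> conn G (C - S)) \<and> 2 \<le> card (S \<inter> Y) \<and> card (S \<inter> Y) \<le> k) \<or>
     (\<exists>v R. star_to G C Y k v R)"
proof -
  let ?P = "\<lambda>S. S \<subseteq> C \<and> conn G S \<and> (C - S = {} \<or> conn G (C - S)) \<and> 2 \<le> card (S \<inter> Y)"
  have PC: "?P C" using C Y by simp
  define S where "S = arg_min card ?P"
  have S: "?P S" unfolding S_def by (rule arg_min_natI[of ?P, OF PC])
  have min: "card S \<le> card T" if "?P T" for T unfolding S_def by (rule arg_min_nat_le[of ?P, OF that])
  show ?thesis
  proof (cases "card (S \<inter> Y) \<le> k")
    case True
    then show ?thesis using S by blast
  next
    case False
    have finS: "finite S" using S C finite_subset by blast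
    obtain v where v: "v \<in> S" "C - S = {} \<or> touches G {v} (C - S)"
    proof (cases "C - S = {}")
      case True
      then show ?thesis using that conn_nonempty[of G S] S by blast
    next
      case False
      then have "touches G S (C - S)" using connD[OF C(1), of S] S conn_nonempty[of G S] by auto
      then show ?thesis using that by (metis touchesE touchesI singletonI)
    qed
    have "\<exists>T. y \<in> T \<and> T \<subseteq> S - {v} \<and> conn G T \<and> \<not> touches G T (S - {v} - T)" if "y \<in> S \<inter> Y - {v}" for y
      using component_exists[of y "S - {v}" G] that by blast
    then obtain T where T: "\<And>y. y \<in> S \<inter> Y - {v} \<Longrightarrow>
        y \<in> T y \<and> T y \<subseteq> S - {v} \<and> conn G (T y) \<and> \<not> touches G (T y) (S - {v} - T y)"
      by metis
    have single: "T y \<inter> Y = {y}" if y: "y \<in> S \<inter> Y - {v}" for y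
    proof -
      have Ty: "y \<in> T y" "T y \<subseteq> S - {v}" "conn G (T y)" "\<not> touches G (T y) (S - {v} - T y)" using T[OF y] by auto
      have cS: "conn G (S - T y)" by (rule conn_remove_component[OF _ v(1) Ty(2,4)]) (use S in simp)
      have "conn G (C - T y)"
      proof (cases "C - S = {}")
        case True
        then have "C - T y = S - T y" using S by auto
        then show ?thesis using cS by simp
      next
        case False
        have "touches G (S - T y) (C - S)"
          by (rule touches_mono[of G "{v}" "C - S"]) (use v False Ty in auto)
        then have "conn G ((S - T y) \<union> (C - S))" by (intro conn_Un cS) (use S False in auto)
        moreover have "(S - T y) \<union> (C - S) = C - T y" using S Ty by auto
        ultimately show ?thesis by simp
      qed
      moreover have "card (T y) < card S"
        by (rule psubset_card_mono[OF finS]) (use Ty v in auto)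
      ultimately have "\<not> 2 \<le> card (T y \<inter> Y)" using min[of "T y"] Ty S by fastforce
      moreover have "finite (T y \<inter> Y)" using Ty finS by (meson finite_Diff finite_Int finite_subset)
      ultimately have "card (T y \<inter> Y) \<le> 1" "finite (T y \<inter> Y)" by auto
      then show ?thesis using Ty(1) y by (auto simp: card_le_Suc0_iff_eq)
    qed
    have disj: "T y \<inter> T z = {}" if yz: "y \<in> S \<inter> Y - {v}" "z \<in> S \<inter> Y - {v}" "y \<noteq> z" for y z
    proof (rule ccontr)
      assume "T y \<inter> T z \<noteq> {}"
      then have "T z \<subseteq> T y" using components_equal_or_disjoint[of G "T z" "S - {v}" "T y"] T[OF yz(1)] T[OF yz(2)] by blast
      then have "z \<in> T y \<inter> Y" using T[OF yz(2)] yz by auto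
      then show False using single[OF yz(1)] yz by auto
    qed
    have "k \<le> card (S \<inter> Y - {v})" using False finS by (auto simp: card_Diff_singleton_if)
    then obtain f where f: "inj_on f {..<k}" "f ` {..<k} \<subseteq> S \<inter> Y - {v}"
      using indexed_subset[of "S \<inter> Y - {v}" k] finS by blast
    have fi: "f i \<in> S \<inter> Y - {v}" if "i < k" for i using f that by auto
    have "star_to G C Y k v (\<lambda>i. T (f i))"
      unfolding star_to_def
    proof (intro conjI allI impI)
      show "v \<in> C" using v S by auto
      fix i assume i: "i < k"
      show "T (f i) \<subseteq> C - {v}" using T[OF fi[OF i]] S by auto
      show "conn G (T (f i))" using T[OF fi[OF i]] by simp
      show "T (f i) \<inter> Y \<noteq> {}" using single[OF fi[OF i]] by simp
      have "touches G (T (f i)) {v}"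
        by (rule component_touches_rest[of G S]) (use T[OF fi[OF i]] S v in auto)
      then show "touches G {v} (T (f i))" by (simp add: touches_sym)
      fix j assume "j < k" "i \<noteq> j"
      then show "T (f i) \<inter> T (f j) = {}" using f i fi by (intro disj) (auto simp: inj_on_def)
    qed
    then show ?thesis by blast
  qed
qed

text \<open>Each split-off part costs at most \<open>k\<close> terminals, hence \<open>m * k + 1\<close> of them suffice for \<open>m\<close> parts.\<close>

lemma pairs_or_star:
  assumes "conn G C" "finite C" "1 \<le> k" "m * k < card (C \<inter> Y)"
  shows "(\<exists>S. pairing G C Y m S) \<or> (\<exists>v R. star_to G C Y k v R)"
  using assms
proof (induction m arbitrary: C)
  case 0
  then show ?case by (auto simp: pairing_def)
next
  case (Suc m)
  have "2 \<le> card (C \<inter> Y)" using Suc.prems(3,4) by (cases k) auto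
  then consider (star) "\<exists>v R. star_to G C Y k v R"
    | (part) S where "S \<subseteq> C" "conn G S" "C - S = {} \<or> conn G (C - S)" "2 \<le> card (S \<inter> Y)" "card (S \<inter> Y) \<le> k"
    using split_off_or_star[OF Suc.prems(1,2), of Y k] by blast
  then show ?case
  proof cases
    case part
    have fin: "finite (C \<inter> Y)" "finite S" using Suc.prems(2) part(1) finite_subset by auto
    have "card (C \<inter> Y) = card (S \<inter> Y) + card ((C - S) \<inter> Y)"
      using fin part(1) by (subst card_Un_disjoint[symmetric]) (auto intro: finite_subset[OF _ Suc.prems(2)] arg_cong[of _ _ card])
    then have big: "m * k < card ((C - S) \<inter> Y)" using Suc.prems(4) part(5) by simp
    then have "C - S \<noteq> {}" by (metis Int_empty_left card.empty not_less_zero)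
    then have c: "conn G (C - S)" using part(3) by simp
    have "(\<exists>S'. pairing G (C - S) Y m S') \<or> (\<exists>v R. star_to G (C - S) Y k v R)"
      using Suc.IH[OF c _ Suc.prems(3) big] Suc.prems(2) by simp
    then show ?thesis
    proof
      assume "\<exists>S'. pairing G (C - S) Y m S'"
      then obtain S' where S': "pairing G (C - S) Y m S'" ..
      have "pairing G C Y (Suc m) (\<lambda>i. if i < m then S' i else S)"
        unfolding pairing_def
      proof (intro conjI allI impI)
        fix i assume "i < Suc m"
        show "(if i < m then S' i else S) \<subseteq> C" "conn G (if i < m then S' i else S)"
          "2 \<le> card ((if i < m then S' i else S) \<inter> Y)"
          using S' part unfolding pairing_def by auto
        fix j assume "j < Suc m" "i \<noteq> j"
        moreover have "S' a \<inter> S = {}" if "a < m" for a using S' that unfolding pairing_def by blast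
        moreover have "S' a \<inter> S' b = {}" if "a < m" "b < m" "a \<noteq> b" for a b using S' that unfolding pairing_def by blast
        ultimately show "(if i < m then S' i else S) \<inter> (if j < m then S' j else S) = {}"
          using \<open>i < Suc m\<close> by (auto simp: Int_commute less_Suc_eq)
      qed
      then show ?thesis by blast
    next
      assume "\<exists>v R. star_to G (C - S) Y k v R"
      then obtain v R where "star_to G (C - S) Y k v R" by blast
      then have "star_to G C Y k v R" unfolding star_to_def by blast
      then show ?thesis by blast
    qed
  qed simp
qed

text \<open>The terminals are the vertices of \<open>C\<close> next to \<open>X\<close>.  Many pairs give a daisy centred at the contracted \<open>X\<close>,
  and a large star gives a diamond with hubs \<open>X\<close> and the centre of the star.\<close>

lemma attachments_bounded:
  assumes X: "conn G X" "X \<subseteq> verts G" and C: "conn G C" "C \<subseteq> verts G" "X \<inter> C = {}" and fin: "finite (verts G)"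
    and D: "\<not> minor (daisy k) G" and M: "\<not> minor (diamond k) G"
  shows "card {c \<in> C. touches G X {c}} \<le> k * (k + 1)"
proof (rule ccontr)
  define Y where "Y = {c \<in> C. touches G X {c}}"
  assume "\<not> card {c \<in> C. touches G X {c}} \<le> k * (k + 1)"
  then have "k * (k + 1) < card (C \<inter> Y)" by (simp add: Y_def Collect_conj_eq Int_absorb1)
  then have "(\<exists>S. pairing G C Y k S) \<or> (\<exists>v R. star_to G C Y (k + 1) v R)"
    by (intro pairs_or_star) (use C fin finite_subset in auto)
  then show False
  proof
    assume "\<exists>S. pairing G C Y k S"
    then obtain S where S: "pairing G C Y k S" ..
    have "minor (daisy k) G"
    proof (rule daisy_minor[OF X])
      fix i assume i: "i < k"
      then have Si: "S i \<subseteq> C" "conn G (S i)" "2 \<le> card (S i \<inter> Y)" using S by (auto simp: pairing_def)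
      show "S i \<subseteq> verts G - X" using Si C by auto
      obtain a b where "a \<in> S i \<inter> Y" "b \<in> S i \<inter> Y" "a \<noteq> b"
        using Si(3) card_le_Suc0_iff_eq[of "S i \<inter> Y"] by (metis One_nat_def Suc_1 card.infinite not_less_eq_eq zero_le le_numeral_extra(4) order_trans)
      then show "tri G X (S i)" by (intro tri_two_attachments[OF X(1) Si(2), of a b]) (auto simp: Y_def)
    qed (use S in \<open>auto simp: pairing_def\<close>)
    then show False using D by simp
  next
    assume "\<exists>v R. star_to G C Y (k + 1) v R"
    then obtain v R where R: "star_to G C Y (k + 1) v R" by blast
    have "minor (diamond k) G"
    proof (rule diamond_minor[OF X])
      fix i assume i: "i \<le> k"
      then have Ri: "R i \<subseteq> C - {v}" "conn G (R i)" "R i \<inter> Y \<noteq> {}" "touches G {v} (R i)"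
        using R unfolding star_to_def by (metis le_imp_less_Suc Suc_eq_plus1)+
      then obtain c where "c \<in> R i" "touches G X {c}" by (auto simp: Y_def)
      then show "touches G X (R i)" using touches_mono[of G X "{c}" X "R i"] by simp
      show "R i \<subseteq> verts G - X - {v}" "conn G (R i)" "touches G {v} (R i)" using Ri C by auto
    qed (use R C in \<open>auto simp: star_to_def\<close>)
    then show False using M by simp
  qed
qed

section \<open>Packing dense subgraphs\<close>

text \<open>Minimum degree two, the situation left after repeatedly deleting vertices of degree at most one.\<close>

definition core :: "'a sgraph \<Rightarrow> bool" where
  "core G \<longleftrightarrow> simple_graph G \<and>
     (\<forall>v\<in>verts G. \<exists>a b. a \<noteq> b \<and> {v, a} \<in> edges G \<and> {v, b} \<in> edges G)"

locale thin_core =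
  fixes G :: "'a sgraph" and k :: nat
  assumes core: "core G"
    and no_daisy: "\<not> minor (daisy k) G"
    and no_diamond: "\<not> minor (diamond k) G"
begin

definition \<Delta> :: nat where "\<Delta> = k * (k * (k + 1))"

lemma simple: "simple_graph G" using core by (simp add: core_def)

lemma fin: "finite (verts G)" using simple by (rule finite_verts)

text \<open>Exactly the neighbours of \<open>X\<close> that do not form a component of \<open>G - X\<close> on their own.\<close>

definition rim :: "'a set \<Rightarrow> 'a set" where
  "rim X = {u \<in> verts G - X. touches G X {u} \<and> (\<exists>w\<in>verts G - X. {u, w} \<in> edges G)}"

text \<open>Every component of \<open>G - X\<close> that meets the rim carries a triangle at the contracted \<open>X\<close>, so there
  are fewer than \<open>k\<close> of them, and each attaches to \<open>X\<close> in boundedly many vertices.\<close>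

lemma card_rim:
  assumes X: "conn G X" "X \<subseteq> verts G"
  shows "card (rim X) \<le> \<Delta>"
proof -
  have "\<exists>T. u \<in> T \<and> T \<subseteq> verts G - X \<and> conn G T \<and> \<not> touches G T (verts G - X - T)" if "u \<in> rim X" for u
    using component_exists[of u "verts G - X" G] that unfolding rim_def by blast
  then obtain T where T: "\<And>u. u \<in> rim X \<Longrightarrow>
      u \<in> T u \<and> T u \<subseteq> verts G - X \<and> conn G (T u) \<and> \<not> touches G (T u) (verts G - X - T u)"
    by metis
  have tri: "tri G X (T u)" if u: "u \<in> rim X" for u
  proof -
    have Tu: "u \<in> T u" "T u \<subseteq> verts G - X" "conn G (T u)" "\<not> touches G (T u) (verts G - X - T u)"
      using T[OF u] by auto
    have stay: "b \<in> T u" if "a \<in> T u" "{a, b} \<in> edges G" "b \<notin> X" for a b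
      using Tu(4) touchesI[OF that(2), of "T u" "verts G - X - T u"] that edge_verts[OF simple that(2)] by blast
    have tu: "touches G X {u}" using u by (simp add: rim_def)
    show ?thesis
    proof (cases "\<exists>w\<in>T u. w \<noteq> u \<and> touches G X {w}")
      case True
      then obtain w where "w \<in> T u" "w \<noteq> u" "touches G X {w}" by blast
      then show ?thesis using tri_two_attachments[OF X(1) Tu(3,1), of w] tu by blast
    next
      case False
      obtain w where w: "w \<notin> X" "{u, w} \<in> edges G" using u by (auto simp: rim_def)
      have "w \<in> T u" "w \<noteq> u" using stay[OF Tu(1) w(2,1)] edge_neq[OF simple w(2)] by auto
      then have ne: "T u \<noteq> {u}" by auto
      show ?thesis
      proof (rule tri_min_degree[OF simple _ X(1) Tu(3,1) tu ne])
        show "finite (T u)" using Tu(2) fin by (meson finite_Diff finite_subset)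
        fix x assume x: "x \<in> T u - {u}"
        then have "x \<in> verts G" using Tu(2) by auto
        then obtain a b where ab: "a \<noteq> b" "{x, a} \<in> edges G" "{x, b} \<in> edges G"
          using core by (auto simp: core_def)
        have "c \<notin> X" if "{x, c} \<in> edges G" for c
        proof
          assume "c \<in> X"
          then have "touches G X {x}" using that by (intro touchesI[of c x]) (auto simp: insert_commute)
          then show False using False x by blast
        qed
        then show "\<exists>a b. a \<noteq> b \<and> a \<in> T u \<and> b \<in> T u \<and> {x, a} \<in> edges G \<and> {x, b} \<in> edges G"
          using ab stay[of x] x by blast
      qed
    qed
  qed
  let ?TT = "T ` rim X"
  have finR: "finite (rim X)" using fin by (simp add: rim_def)
  have disj: "A \<inter> B = {}" if AB: "A \<in> ?TT" "B \<in> ?TT" "A \<noteq> B" for A B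
  proof (rule ccontr)
    assume ne: "A \<inter> B \<noteq> {}"
    obtain u w where uw: "u \<in> rim X" "w \<in> rim X" "A = T u" "B = T w" using AB by auto
    have "B \<subseteq> A" using components_equal_or_disjoint[of G B "verts G - X" A] T[OF uw(1)] T[OF uw(2)] uw ne by blast
    moreover have "A \<subseteq> B" using components_equal_or_disjoint[of G A "verts G - X" B] T[OF uw(1)] T[OF uw(2)] uw ne by blast
    ultimately show False using AB(3) by simp
  qed
  \<comment> \<open>otherwise \<open>k\<close> of the components would form a daisy\<close>
  have "card ?TT < k"
  proof (rule ccontr)
    assume "\<not> card ?TT < k"
    then obtain S where S: "inj_on S {..<k}" "S ` {..<k} \<subseteq> ?TT"
      using indexed_subset[of ?TT k] finR by auto
    have "minor (daisy k) G"
    proof (rule daisy_minor[OF X])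
      fix i assume i: "i < k"
      then obtain u where u: "u \<in> rim X" "S i = T u" using S(2) by auto
      then show "S i \<subseteq> verts G - X" "tri G X (S i)" using T[OF u(1)] tri[OF u(1)] by auto
      fix j assume j: "j < k" "i \<noteq> j"
      then have "S i \<noteq> S j" using S(1) i by (auto simp: inj_on_def)
      moreover have "S i \<in> ?TT" "S j \<in> ?TT" using S(2) i j by auto
      ultimately show "S i \<inter> S j = {}" by (intro disj)
    qed
    then show False using no_daisy by simp
  qed
  have bound: "card {c \<in> C. touches G X {c}} \<le> k * (k + 1)" if C: "C \<in> ?TT" for C
  proof -
    obtain u where u: "u \<in> rim X" "C = T u" using C by auto
    show ?thesis
      by (rule attachments_bounded[OF X _ _ _ fin no_daisy no_diamond]) (use T[OF u(1)] u in auto)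
  qed
  have "rim X \<subseteq> (\<Union>C\<in>?TT. {c \<in> C. touches G X {c}})"
    using T by (auto simp: rim_def)
  moreover have "finite (\<Union>C\<in>?TT. {c \<in> C. touches G X {c}})"
    using finR T fin by (auto intro!: finite_subset[OF _ fin])
  ultimately have "card (rim X) \<le> card (\<Union>C\<in>?TT. {c \<in> C. touches G X {c}})" by (rule card_mono[rotated])
  also have "\<dots> \<le> (\<Sum>C\<in>?TT. card {c \<in> C. touches G X {c}})"
    by (rule card_UN_le) (use finR in simp)
  also have "\<dots> \<le> (\<Sum>C\<in>?TT. k * (k + 1))" by (rule sum_mono[OF bound])
  also have "\<dots> = card ?TT * (k * (k + 1))" by simp
  also have "\<dots> \<le> k * (k * (k + 1))" using \<open>card ?TT < k\<close> by (intro mult_right_mono) auto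
  finally show ?thesis by (simp add: \<Delta>_def)
qed

lemma finite_rim: "finite (rim X)" using fin by (simp add: rim_def)

lemma nbhd_sub: "nbhd G v \<subseteq> verts G"
  using edge_verts[OF simple] by (auto simp: nbhd_def)

text \<open>All neighbours of \<open>v\<close> belong to the rim of \<open>{v}\<close>, since they have a second neighbour.\<close>

lemma degree_bound:
  assumes v: "v \<in> verts G"
  shows "card (nbhd G v) \<le> \<Delta>"
proof -
  have "nbhd G v \<subseteq> rim {v}"
  proof
    fix u assume "u \<in> nbhd G v"
    then have uv: "{u, v} \<in> edges G" by (simp add: nbhd_def)
    then have u: "u \<in> verts G" "u \<noteq> v" using edge_verts[OF simple uv] edge_neq[OF simple uv] by auto
    obtain a b where ab: "a \<noteq> b" "{u, a} \<in> edges G" "{u, b} \<in> edges G"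
      using core u(1) by (auto simp: core_def)
    have "\<exists>w\<in>verts G - {v}. {u, w} \<in> edges G"
      using ab edge_verts[OF simple ab(2)] edge_verts[OF simple ab(3)] by blast
    then show "u \<in> rim {v}" using u uv unfolding rim_def touches_def by (auto simp: insert_commute)
  qed
  then have "card (nbhd G v) \<le> card (rim {v})" by (rule card_mono[OF finite_rim])
  also have "\<dots> \<le> \<Delta>" by (rule card_rim) (use v in simp_all)
  finally show ?thesis .
qed

primrec bfs :: "'a \<Rightarrow> nat \<Rightarrow> 'a set" where
  "bfs r 0 = {r}"
| "bfs r (Suc i) = bfs r i \<union> {u \<in> verts G. touches G (bfs r i) {u}}"

lemma bfs_sub: "r \<in> verts G \<Longrightarrow> bfs r i \<subseteq> verts G"
  by (induction i) auto

lemma conn_bfs: "conn G (bfs r i)"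
proof (induction i)
  case (Suc i)
  have "conn G (bfs r i \<union> (\<Union>u\<in>{u \<in> verts G. touches G (bfs r i) {u}}. {u}))"
    by (rule conn_UN[OF Suc]) (auto simp: touches_sym)
  then show ?case by simp
qed simp

lemma bfs_mono: "i \<le> j \<Longrightarrow> bfs r i \<subseteq> bfs r j"
  by (rule lift_Suc_mono_le) auto

lemma card_neighbours:
  assumes "A \<subseteq> verts G"
  shows "card (\<Union>x\<in>A. nbhd G x) \<le> card A * \<Delta>"
proof -
  have "card (\<Union>x\<in>A. nbhd G x) \<le> (\<Sum>x\<in>A. card (nbhd G x))"
    by (rule card_UN_le[OF finite_subset[OF assms fin]])
  also have "\<dots> \<le> (\<Sum>x\<in>A. \<Delta>)" by (rule sum_mono) (use assms degree_bound in blast)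
  finally show ?thesis by simp
qed

text \<open>A vertex at distance \<open>i + 2\<close> has a neighbour at distance \<open>i + 1\<close>, and this lies in the rim of the ball of
  radius \<open>i\<close>.\<close>

lemma card_layer:
  assumes r: "r \<in> verts G"
  shows "card (bfs r (Suc i) - bfs r i) \<le> \<Delta> * \<Delta> + \<Delta>"
proof (cases i)
  case 0
  have "bfs r (Suc i) - bfs r i \<subseteq> nbhd G r" using 0 by (auto simp: touches_def nbhd_def insert_commute)
  then have "card (bfs r (Suc i) - bfs r i) \<le> card (nbhd G r)"
    by (intro card_mono finite_subset[OF nbhd_sub fin])
  then show ?thesis using degree_bound[OF r] by simp
next
  case (Suc j)
  have "bfs r (Suc i) - bfs r i \<subseteq> (\<Union>x\<in>rim (bfs r j). nbhd G x)"
  proof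
    fix u assume u: "u \<in> bfs r (Suc i) - bfs r i"
    then obtain x where x: "x \<in> bfs r i" "{x, u} \<in> edges G" by (auto simp: touches_def)
    have uv: "u \<in> verts G" "x \<in> verts G" using edge_verts[OF simple x(2)] by auto
    have xj: "x \<notin> bfs r j"
    proof
      assume "x \<in> bfs r j"
      then have "u \<in> bfs r i" using Suc uv x by (auto simp: touches_def)
      then show False using u by simp
    qed
    have "touches G (bfs r j) {x}" using x(1) xj Suc by auto
    moreover have "u \<notin> bfs r j" using u Suc by auto
    ultimately have "x \<in> rim (bfs r j)" using uv xj x by (auto simp: rim_def)
    then show "u \<in> (\<Union>x\<in>rim (bfs r j). nbhd G x)" using x by (auto simp: nbhd_def insert_commute)
  qed
  then have "card (bfs r (Suc i) - bfs r i) \<le> card (\<Union>x\<in>rim (bfs r j). nbhd G x)"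
    by (intro card_mono finite_subset[OF _ fin] UN_least nbhd_sub)
  also have "\<dots> \<le> card (rim (bfs r j)) * \<Delta>" by (rule card_neighbours) (auto simp: rim_def)
  also have "\<dots> \<le> \<Delta> * \<Delta>" using card_rim[OF conn_bfs bfs_sub[OF r]] by simp
  finally show ?thesis by simp
qed

lemma bfs_exhausts:
  assumes "conn G (verts G)" "r \<in> verts G"
  obtains i where "bfs r i = verts G"
proof -
  have "(\<Union>i. bfs r i) = verts G"
  proof (rule ccontr)
    assume ne: "(\<Union>i. bfs r i) \<noteq> verts G"
    have "touches G (\<Union>i. bfs r i) (verts G - (\<Union>i. bfs r i))"
    proof (rule connD[OF assms(1) _ _ ne])
      show "(\<Union>i. bfs r i) \<noteq> {}" by (auto intro!: exI[of _ 0])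
    qed (use bfs_sub[OF assms(2)] in blast)
    then obtain x u where xu: "x \<in> (\<Union>i. bfs r i)" "u \<in> verts G" "u \<notin> (\<Union>i. bfs r i)" "{x, u} \<in> edges G"
      by (auto elim!: touchesE)
    then obtain i where "x \<in> bfs r i" by auto
    then have "u \<in> bfs r (Suc i)" using xu by (auto simp: touches_def)
    then show False using xu by blast
  qed
  then have "\<forall>v\<in>verts G. \<exists>i. v \<in> bfs r i" by blast
  then obtain f where f: "\<And>v. v \<in> verts G \<Longrightarrow> v \<in> bfs r (f v)" by metis
  have "v \<in> bfs r (Max (f ` verts G))" if "v \<in> verts G" for v
    using f[OF that] bfs_mono[of "f v" "Max (f ` verts G)" r] that fin by auto
  then show ?thesis using that bfs_sub[OF assms(2)] by blast
qed

lemma incident_edges: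
  assumes "L \<subseteq> verts G"
  shows "card {e \<in> edges G. e \<inter> L \<noteq> {}} \<le> card L * \<Delta>"
proof -
  have finL: "finite L" by (rule finite_subset[OF assms fin])
  have "{e \<in> edges G. e \<inter> L \<noteq> {}} \<subseteq> (\<Union>v\<in>L. (\<lambda>u. {u, v}) ` nbhd G v)"
  proof
    fix e assume "e \<in> {e \<in> edges G. e \<inter> L \<noteq> {}}"
    then obtain v where v: "e \<in> edges G" "v \<in> e" "v \<in> L" by auto
    then obtain u where "e = {u, v}" using edgeE[OF simple v(1)] by (metis insertE insert_commute singletonD)
    then show "e \<in> (\<Union>v\<in>L. (\<lambda>u. {u, v}) ` nbhd G v)" using v by (auto simp: nbhd_def)
  qed
  moreover have "finite (\<Union>v\<in>L. (\<lambda>u. {u, v}) ` nbhd G v)"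
    by (intro finite_UN_I finite_imageI finL finite_subset[OF nbhd_sub fin])
  ultimately have "card {e \<in> edges G. e \<inter> L \<noteq> {}} \<le> card (\<Union>v\<in>L. (\<lambda>u. {u, v}) ` nbhd G v)"
    by (rule card_mono[rotated])
  also have "\<dots> \<le> (\<Sum>v\<in>L. card ((\<lambda>u. {u, v}) ` nbhd G v))" by (rule card_UN_le[OF finL])
  also have "\<dots> \<le> (\<Sum>v\<in>L. \<Delta>)"
  proof (rule sum_mono)
    fix v assume "v \<in> L"
    have "finite (nbhd G v)" by (rule finite_subset[OF nbhd_sub fin])
    then show "card ((\<lambda>u. {u, v}) ` nbhd G v) \<le> \<Delta>"
      using card_image_le degree_bound[of v] assms \<open>v \<in> L\<close> by (meson le_trans subsetD)
  qed
  finally show ?thesis by simp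
qed

end

definition dense :: "real \<Rightarrow> 'a sgraph \<Rightarrow> 'a set \<Rightarrow> bool" where
  "dense \<delta> G S \<longleftrightarrow> real (card (edges (induced G S))) > \<delta> * real (card S)"

lemma dense_induced: "S \<subseteq> W \<Longrightarrow> dense \<delta> (induced G W) S \<longleftrightarrow> dense \<delta> G S"
proof -
  assume "S \<subseteq> W"
  then have "induced (induced G W) S = induced G S" by (auto simp: induced_def)
  then show ?thesis by (simp add: dense_def del: edges_induced)
qed

lemma induced_whole: "simple_graph G \<Longrightarrow> induced G (verts G) = G"
  by (auto simp: induced_def simple_graph_def prod_eq_iff)

definition dense_packing :: "real \<Rightarrow> 'a sgraph \<Rightarrow> 'a set set \<Rightarrow> bool" where
  "dense_packing \<delta> G \<S> \<longleftrightarrow> finite \<S> \<and> (\<forall>S\<in>\<S>. S \<subseteq> verts G \<and> dense \<delta> G S) \<and>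
     (\<forall>S\<in>\<S>. \<forall>T\<in>\<S>. S \<noteq> T \<longrightarrow> S \<inter> T = {})"

lemma dense_packing_empty: "dense_packing \<delta> G {}"
  by (simp add: dense_packing_def)

lemma dense_packing_induced:
  assumes "dense_packing \<delta> (induced G W) \<S>" "W \<subseteq> verts G"
  shows "dense_packing \<delta> G \<S>"
  using assms dense_induced[of _ W \<delta> G] unfolding dense_packing_def
  by (auto simp del: edges_induced)

lemma edges_induced_empty: "simple_graph G \<Longrightarrow> edges (induced G {}) = {}"
  by (auto simp: simple_graph_def)

lemma dense_nonempty: "dense \<delta> G S \<Longrightarrow> simple_graph G \<Longrightarrow> S \<noteq> {}"
  using edges_induced_empty[of G] by (auto simp: dense_def simp del: edges_induced)

lemma dense_packing_Un:
  assumes "dense_packing \<delta> (induced G A) \<S>" "dense_packing \<delta> (induced G B) \<T>"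
    "A \<subseteq> verts G" "B \<subseteq> verts G" "A \<inter> B = {}" "simple_graph G"
  shows "dense_packing \<delta> G (\<S> \<union> \<T>)" "card (\<S> \<union> \<T>) = card \<S> + card \<T>"
proof -
  have S: "S \<subseteq> A \<and> dense \<delta> G S" if "S \<in> \<S>" for S
    using assms(1) that dense_induced[of S A \<delta> G] by (auto simp: dense_packing_def simp del: edges_induced)
  have T: "S \<subseteq> B \<and> dense \<delta> G S" if "S \<in> \<T>" for S
    using assms(2) that dense_induced[of S B \<delta> G] by (auto simp: dense_packing_def simp del: edges_induced)
  show "dense_packing \<delta> G (\<S> \<union> \<T>)"
    unfolding dense_packing_def
  proof (intro conjI ballI impI)
    show "finite (\<S> \<union> \<T>)" using assms(1,2) by (simp add: dense_packing_def)
    fix U assume U: "U \<in> \<S> \<union> \<T>"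
    show "U \<subseteq> verts G" "dense \<delta> G U" using U S T assms(3,4) by blast+
    fix V assume V: "V \<in> \<S> \<union> \<T>" "U \<noteq> V"
    have "U \<inter> V = {}" if "U \<in> \<S>" "V \<in> \<S>" using assms(1) that V by (simp add: dense_packing_def)
    moreover have "U \<inter> V = {}" if "U \<in> \<T>" "V \<in> \<T>" using assms(2) that V by (simp add: dense_packing_def)
    moreover have "U \<inter> V = {}" if "U \<in> \<S>" "V \<in> \<T>" using S[OF that(1)] T[OF that(2)] assms(5) by blast
    moreover have "U \<inter> V = {}" if "U \<in> \<T>" "V \<in> \<S>" using T[OF that(1)] S[OF that(2)] assms(5) by blast
    ultimately show "U \<inter> V = {}" using U V(1) by blast
  qed
  have "\<S> \<inter> \<T> = {}"
  proof (rule ccontr)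
    assume "\<S> \<inter> \<T> \<noteq> {}"
    then obtain U where "U \<in> \<S>" "U \<in> \<T>" by blast
    then have "U \<subseteq> {}" "dense \<delta> G U" using S T assms(5) by blast+
    then show False using dense_nonempty assms(6) by blast
  qed
  then show "card (\<S> \<union> \<T>) = card \<S> + card \<T>"
    using assms(1,2) by (simp add: dense_packing_def card_Un_disjoint)
qed

lemma dense_packing_single:
  "dense \<delta> G S \<Longrightarrow> S \<subseteq> verts G \<Longrightarrow> dense_packing \<delta> G {S}"
  by (simp add: dense_packing_def)

lemma not_minor_induced:
  assumes "simple_graph G" "W \<subseteq> verts G" "simple_graph H" "\<not> minor H G"
  shows "\<not> minor H (induced G W)"
  using minor_trans[OF assms(3) _ minor_induced[OF assms(1,2)]] assms(4) by blast

lemma card_edges_le3: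
  assumes "simple_graph G" "edges G \<subseteq> edges (induced G A) \<union> edges (induced G B) \<union> E" "finite E"
  shows "card (edges G) \<le> card (edges (induced G A)) + card (edges (induced G B)) + card E"
proof -
  have f: "finite (edges (induced G A))" "finite (edges (induced G B))"
    using finite_edges[OF assms(1)] by simp_all
  have "card (edges G) \<le> card (edges (induced G A) \<union> edges (induced G B) \<union> E)"
    by (rule card_mono[OF _ assms(2)]) (use f assms(3) in simp)
  also have "\<dots> \<le> card (edges (induced G A)) + card (edges (induced G B)) + card E"
    by (meson add_le_mono card_Un_le le_refl le_trans)
  finally show ?thesis .
qed

lemma closed_split:
  assumes G: "simple_graph G" and A: "A \<subseteq> verts G" "\<not> touches G A (verts G - A)"
  shows "card (edges G) \<le> card (edges (induced G A)) + card (edges (induced G (verts G - A)))"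
    "card (verts G) = card A + card (verts G - A)"
proof -
  let ?B = "verts G - A"
  have "edges G \<subseteq> edges (induced G A) \<union> edges (induced G ?B) \<union> {}"
  proof
    fix e assume e: "e \<in> edges G"
    then obtain x y where xy: "e = {x, y}" "x \<in> verts G" "y \<in> verts G" using edgeE[OF G] by metis
    have "x \<in> A \<longleftrightarrow> y \<in> A"
      using A(2) touchesI[of x y G A ?B] touchesI[of y x G A ?B] e xy by (auto simp: insert_commute)
    then show "e \<in> edges (induced G A) \<union> edges (induced G ?B) \<union> {}" using e xy by auto
  qed
  from card_edges_le3[OF G this] show "card (edges G) \<le> card (edges (induced G A)) + card (edges (induced G ?B))"
    by simp
  show "card (verts G) = card A + card ?B" using A(1) finite_verts[OF G]
    by (metis card_Diff_subset card_mono finite_subset le_add_diff_inverse)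
qed

text \<open>The density excess is charged to disjoint dense sets.  Vertices of degree at most one never
  increase the excess since \<open>\<delta> \<ge> 1\<close>.  In a connected graph of minimum degree two, cut at the first
  breadth-first layer whose ball contains a dense set: the interior of the ball has no excess, the
  layer meets boundedly many edges, and the exterior is treated by induction.\<close>

lemma excess_bounded_by_packing:
  fixes \<delta> :: real and k :: nat
  assumes \<delta>: "1 \<le> \<delta>"
  defines "D \<equiv> k * (k * (k + 1))"
  defines "c \<equiv> (D * D + D + 1) * D"
  assumes "simple_graph G" "\<not> minor (daisy k) G" "\<not> minor (diamond k) G"
  shows "\<exists>\<S>. dense_packing \<delta> G \<S> \<and> real (card (edges G)) \<le> \<delta> * real (card (verts G)) + real c * real (card \<S>)"
  using assms(4-)
proof (induction "card (verts G)" arbitrary: G rule: less_induct)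
  case less
  note G = less.prems(1)
  have fin: "finite (verts G)" by (rule finite_verts[OF G])
  have IH: "\<exists>\<S>. dense_packing \<delta> (induced G W) \<S> \<and>
      real (card (edges (induced G W))) \<le> \<delta> * real (card W) + real c * real (card \<S>)"
    if W: "W \<subset> verts G" for W
  proof -
    have "card (verts (induced G W)) < card (verts G)" using psubset_card_mono[OF fin W] by simp
    then show ?thesis
      using less.hyps[of "induced G W"] W simple_graph_induced[OF G, of W]
        not_minor_induced[OF G _ simple_daisy less.prems(2), of W]
        not_minor_induced[OF G _ simple_diamond less.prems(3), of W] by auto
  qed
  consider (sparse) "\<not> dense \<delta> G (verts G)"
    | (leaf) v where "v \<in> verts G" "\<not> (\<exists>a b. a \<noteq> b \<and> {v, a} \<in> edges G \<and> {v, b} \<in> edges G)"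
    | (disconn) "\<not> conn G (verts G)" "verts G \<noteq> {}"
    | (main) "dense \<delta> G (verts G)" "core G" "conn G (verts G)"
  proof (cases "core G \<and> conn G (verts G) \<and> dense \<delta> G (verts G)")
    case False
    then consider "\<not> dense \<delta> G (verts G)" | "\<not> core G" | "dense \<delta> G (verts G)" "\<not> conn G (verts G)"
      by argo
    then show ?thesis
    proof cases
      case 2
      then show ?thesis using leaf G unfolding core_def by auto
    next
      case 3
      then show ?thesis using disconn dense_nonempty[OF 3(1) G] by simp
    qed (use sparse in simp)
  qed (use main in simp)
  then show ?case
  proof cases
    case sparse
    then have "real (card (edges G)) \<le> \<delta> * real (card (verts G))"
      by (simp add: dense_def induced_whole[OF G] del: edges_induced)
    then show ?thesis by (intro exI[of _ "{}"]) (simp add: dense_packing_empty)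
  next
    case leaf
    let ?W = "verts G - {v}" and ?E = "{e \<in> edges G. v \<in> e}"
    obtain \<S> where S: "dense_packing \<delta> (induced G ?W) \<S>"
      "real (card (edges (induced G ?W))) \<le> \<delta> * real (card ?W) + real c * real (card \<S>)"
      using IH[of ?W] leaf(1) by blast
    have finE: "finite ?E" using finite_edges[OF G] by simp
    have "e = e'" if e: "e \<in> ?E" "e' \<in> ?E" for e e'
    proof -
      have "\<exists>a. e = {v, a}" if "e \<in> ?E" for e
        using that edgeE[OF G, of e] by (metis (no_types, lifting) insertE insert_commute mem_Collect_eq singletonD)
      then obtain a b where "e = {v, a}" "e' = {v, b}" using e by metis
      then show ?thesis using leaf(2) e by blast
    qed
    then have "card ?E \<le> 1" using finE by (simp add: card_le_Suc0_iff_eq)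
    moreover have "card (edges G) \<le> card (edges (induced G ?W)) + card (edges (induced G {})) + card ?E"
      by (rule card_edges_le3[OF G _ finE]) (use G in \<open>auto simp: simple_graph_def\<close>)
    moreover have "card (edges (induced G {})) = 0" using edges_induced_empty[OF G] by (simp del: edges_induced)
    ultimately have "card (edges G) \<le> card (edges (induced G ?W)) + 1" by linarith
    moreover have "card (verts G) = card ?W + 1" using leaf(1) fin by (metis Suc_eq_plus1 card_Suc_Diff1)
    ultimately have "real (card (edges G)) \<le> \<delta> * real (card (verts G)) + real c * real (card \<S>)"
      using S(2) \<delta> by (simp add: algebra_simps)
    then show ?thesis using dense_packing_induced[OF S(1)] by blast
  next
    case disconn
    then obtain A where A: "A \<subseteq> verts G" "A \<noteq> {}" "A \<noteq> verts G" "\<not> touches G A (verts G - A)"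
      by (auto simp: conn_cut_iff)
    let ?B = "verts G - A"
    obtain \<S> where S: "dense_packing \<delta> (induced G A) \<S>"
      "real (card (edges (induced G A))) \<le> \<delta> * real (card A) + real c * real (card \<S>)"
      using IH[of A] A by blast
    obtain \<T> where T: "dense_packing \<delta> (induced G ?B) \<T>"
      "real (card (edges (induced G ?B))) \<le> \<delta> * real (card ?B) + real c * real (card \<T>)"
      using IH[of ?B] A by blast
    note closed_split[OF G A(1,4)]
    moreover note dense_packing_Un[OF S(1) T(1) A(1) _ _ G]
    ultimately show ?thesis using S(2) T(2) by (intro exI[of _ "\<S> \<union> \<T>"]) (auto simp: algebra_simps)
  next
    case main
    interpret thin_core G k by unfold_locales (use main less.prems in auto)
    have D: "\<Delta> = D" by (simp add: \<Delta>_def D_def)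
    obtain r where r: "r \<in> verts G" using dense_nonempty[OF main(1) G] by blast
    obtain n where n: "bfs r n = verts G" using bfs_exhausts[OF main(3) r] .
    let ?P = "\<lambda>i. \<exists>S\<subseteq>bfs r i. dense \<delta> G S"
    define i where "i = (LEAST i. ?P i)"
    have "?P n" using main(1) n by blast
    then have Pi: "?P i" unfolding i_def by (rule LeastI)
    have least: "\<not> ?P j" if "j < i" for j using that unfolding i_def by (rule not_less_Least)
    \<comment> \<open>\<open>i\<close> is the least radius of a ball with a dense subset, \<open>A\<close> is the open ball and \<open>L\<close> its boundary layer.\<close>
    define A where "A = (if i = 0 then {} else bfs r (i - 1))"
    have A: "A \<subseteq> bfs r i" "\<not> dense \<delta> G A"
      using least[of "i - 1"] bfs_mono[of "i - 1" i r] dense_nonempty[of \<delta> G "{}"] G by (auto simp: A_def)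
    define L where "L = bfs r i - A"
    let ?B = "verts G - bfs r i"
    have cardL: "card L \<le> D * D + D + 1"
      using card_layer[OF r, of "i - 1"] unfolding L_def A_def D by (cases i) auto
    have Lsub: "L \<subseteq> verts G" using bfs_sub[OF r, of i] by (auto simp: L_def)
    have "?B \<subset> verts G" using r bfs_mono[of 0 i r] by auto
    from IH[OF this] obtain \<T> where T: "dense_packing \<delta> (induced G ?B) \<T>"
      "real (card (edges (induced G ?B))) \<le> \<delta> * real (card ?B) + real c * real (card \<T>)" by blast
    obtain S where S: "S \<subseteq> bfs r i" "dense \<delta> G S" using Pi by blast
    let ?X = "bfs r i" and ?E = "{e \<in> edges G. e \<inter> L \<noteq> {}}"
    have "dense_packing \<delta> (induced G ?X) {S}"
      using S by (intro dense_packing_single) (simp_all add: dense_induced)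
    note pack = dense_packing_Un[OF this T(1) bfs_sub[OF r] _ _ G]
    have "edges G \<subseteq> edges (induced G A) \<union> edges (induced G ?B) \<union> ?E"
    proof
      fix e assume e: "e \<in> edges G"
      then obtain x y where xy: "e = {x, y}" "x \<in> verts G" "y \<in> verts G" using edgeE[OF G] by metis
      have no: "\<not> (a \<in> A \<and> b \<in> ?B)" if "{a, b} \<in> edges G" for a b
      proof
        assume ab: "a \<in> A \<and> b \<in> ?B"
        then obtain j where j: "i = Suc j" "a \<in> bfs r j" by (cases i) (auto simp: A_def)
        then have "b \<in> bfs r i" using ab that by (auto simp: touches_def)
        then show False using ab by simp
      qed
      have "\<not> (x \<in> A \<and> y \<in> ?B)" "\<not> (y \<in> A \<and> x \<in> ?B)"
        using no[of x y] no[of y x] e xy by (auto simp: insert_commute)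
      moreover have "z \<in> A \<or> z \<in> L \<or> z \<in> ?B" if "z \<in> verts G" for z using that by (auto simp: L_def)
      ultimately show "e \<in> edges (induced G A) \<union> edges (induced G ?B) \<union> ?E" using e xy by auto
    qed
    then have "card (edges G) \<le> card (edges (induced G A)) + card (edges (induced G ?B)) + card ?E"
      by (rule card_edges_le3[OF G]) (use finite_edges[OF G] in simp)
    moreover have "card ?E \<le> c"
      using incident_edges[OF Lsub] cardL unfolding c_def D by (meson le_trans mult_le_mono1)
    moreover have "real (card (edges (induced G A))) \<le> \<delta> * real (card A)"
      using A(2) by (simp add: dense_def del: edges_induced)
    moreover have "card (verts G) = card ?X + card ?B" using bfs_sub[OF r] fin
      by (metis card_Diff_subset card_mono finite_subset le_add_diff_inverse)
    moreover have "card A \<le> card ?X" using A(1) bfs_sub[OF r] fin by (meson card_mono finite_subset)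
    then have "\<delta> * real (card A) \<le> \<delta> * real (card ?X)" using \<delta> by simp
    moreover have "card ({S} \<union> \<T>) = 1 + card \<T>" using pack(2) by auto
    ultimately have "real (card (edges G)) \<le> \<delta> * real (card (verts G)) + real c * real (card ({S} \<union> \<T>))"
      using T(2) by (simp add: algebra_simps del: edges_induced Un_insert_left card.insert)
    then show ?thesis using pack(1) by (intro exI[of _ "{S} \<union> \<T>"]) auto
  qed
qed

section \<open>Two-trees\<close>

definition tri_graph :: "'a \<Rightarrow> 'a \<Rightarrow> 'a \<Rightarrow> 'a sgraph" where
  "tri_graph x y z = ({x, y, z}, {{x, y}, {y, z}, {x, z}})"

definition add_tip :: "'a sgraph \<Rightarrow> 'a \<Rightarrow> 'a \<Rightarrow> 'a \<Rightarrow> 'a sgraph" where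
  "add_tip H y a b = (insert y (verts H), insert {y, a} (insert {y, b} (edges H)))"

lemma rename_tri_graph: "rename f (tri_graph x y z) = tri_graph (f x) (f y) (f z)"
  by (simp add: rename_def tri_graph_def)

lemma rename_add_tip: "rename f (add_tip H y a b) = add_tip (rename f H) (f y) (f a) (f b)"
  by (simp add: rename_def add_tip_def)

lemma complete_3: "complete_graph {..<3::nat} = tri_graph 0 1 2"
proof -
  have "e \<in> {{0, 1}, {1, 2}, {0, 2}}" if "e \<subseteq> {..<3::nat}" "card e = 2" for e
  proof -
    obtain x y where e: "e = {x, y}" "x \<noteq> y" using \<open>card e = 2\<close> by (meson card_2_iff)
    then have "x \<in> {0, 1, 2}" "y \<in> {0, 1, 2}" using \<open>e \<subseteq> _\<close> by auto
    then show ?thesis using e by auto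
  qed
  then have "{e. e \<subseteq> {..<3::nat} \<and> card e = 2} = {{0, 1}, {1, 2}, {0, 2}}" by auto
  moreover have "{..<3::nat} = {0, 1, 2}" by auto
  ultimately show ?thesis by (simp add: complete_graph_def tri_graph_def)
qed

lemma complete_2: "complete_graph {..<2::nat} = ({0, 1}, {{0, 1}})"
proof -
  have "e = {0, 1}" if "e \<subseteq> {..<2::nat}" "card e = 2" for e
  proof -
    obtain x y where e: "e = {x, y}" "x \<noteq> y" using \<open>card e = 2\<close> by (meson card_2_iff)
    then have "x \<in> {0, 1}" "y \<in> {0, 1}" using \<open>e \<subseteq> _\<close> by auto
    then show ?thesis using e by auto
  qed
  then have "{e. e \<subseteq> {..<2::nat} \<and> card e = 2} = {{0, 1}}" by auto
  moreover have "{..<2::nat} = {0, 1}" by auto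
  ultimately show ?thesis by (simp add: complete_graph_def)
qed

lemma simple_tri_graph: "x \<noteq> y \<Longrightarrow> y \<noteq> z \<Longrightarrow> x \<noteq> z \<Longrightarrow> simple_graph (tri_graph x y z)"
  by (simp add: simple_graph_def tri_graph_def)

lemma triangle_tri_graph:
  assumes "x \<noteq> y" "y \<noteq> z" "x \<noteq> z"
  shows "triangle (tri_graph x y z)"
proof -
  let ?f = "\<lambda>i::nat. if i = 0 then x else if i = 1 then y else z"
  have "graph_iso (tri_graph 0 1 (2::nat)) (rename ?f (tri_graph 0 1 2))"
    by (rule iso_rename[OF simple_tri_graph]) (use assms in \<open>auto simp: inj_on_def tri_graph_def\<close>)
  moreover have "rename ?f (tri_graph 0 1 2) = tri_graph x y z" by (simp add: rename_tri_graph)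
  ultimately show ?thesis unfolding triangle_def complete_3 by (metis graph_iso_sym)
qed

lemma triangleE:
  assumes "triangle G"
  obtains x y z where "G = tri_graph x y z" "x \<noteq> y" "y \<noteq> z" "x \<noteq> z"
proof -
  obtain f where f: "inj_on f {0, 1, 2::nat}" "G = rename f (tri_graph 0 1 2)"
    using assms graph_iso_sym[of G] unfolding triangle_def complete_3
    by (metis graph_isoE tri_graph_def fst_conv)
  show ?thesis using that[of "f 0" "f 1" "f 2"] f by (auto simp: rename_tri_graph inj_on_def)
qed

lemma graph_iso_edge:
  assumes "graph_iso (induced G N) (complete_graph {..<2::nat})"
  obtains a b where "N = {a, b}" "a \<noteq> b" "{a, b} \<in> edges G"
proof -
  have "graph_iso ({0, 1::nat}, {{0, 1}}) (induced G N)"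
    using graph_iso_sym[OF assms] by (simp add: complete_2)
  then obtain f where f: "inj_on f {0, 1::nat}" "induced G N = rename f ({0, 1}, {{0, 1}})"
    by (metis graph_isoE fst_conv)
  have "N = {f 0, f 1}" using arg_cong[OF f(2), of verts] by simp
  moreover have "{f 0, f 1} \<in> edges G" using arg_cong[OF f(2), of edges] by auto
  ultimately show ?thesis using that f(1) by auto
qed

lemma two_tree_simple: "two_tree G \<Longrightarrow> simple_graph G"
  by (induction rule: two_tree.induct) (auto simp: triangle_def graph_iso_def)

lemma simple_add_tip:
  assumes "simple_graph H" "y \<notin> verts H" "{a, b} \<in> edges H"
  shows "simple_graph (add_tip H y a b)"
  using assms edge_verts[OF assms(1,3)] edge_neq[OF assms(1,3)]
  unfolding simple_graph_def add_tip_def by (auto simp: card_insert_if)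

lemma two_tree_add_tip:
  assumes H: "two_tree H" and y: "y \<notin> verts H" and ab: "{a, b} \<in> edges H" and c: "3 \<le> card (verts H)"
  shows "two_tree (add_tip H y a b)"
proof (rule two_tree.step)
  note sH = two_tree_simple[OF H]
  have abv: "a \<in> verts H" "b \<in> verts H" "a \<noteq> b" using edge_verts[OF sH ab] edge_neq[OF sH ab] by auto
  show "simple_graph (add_tip H y a b)" by (rule simple_add_tip[OF sH y ab])
  show "3 < card (verts (add_tip H y a b))"
    using c y finite_verts[OF sH] by (simp add: add_tip_def)
  show "y \<in> verts (add_tip H y a b)" by (simp add: add_tip_def)
  have noy: "y \<notin> e" if "e \<in> edges H" for e using that sH y by (auto simp: simple_graph_def)
  have "nbhd (add_tip H y a b) y = {a, b}"
    using noy abv y by (auto simp: nbhd_def add_tip_def doubleton_eq_iff)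
  moreover have "induced (add_tip H y a b) {a, b} = ({a, b}, {{a, b}})"
  proof -
    have "e = {a, b}" if "e \<in> edges H" "e \<subseteq> {a, b}" for e
      using edgeE[OF sH that(1)] that(2) by (metis doubleton_eq_iff insert_iff insert_subset singletonD)
    then show ?thesis using ab abv y by (auto simp: induced_def add_tip_def)
  qed
  moreover have "graph_iso ({0, 1::nat}, {{0, 1}}) ({a, b}, {{a, b}})"
  proof -
    have "graph_iso ({0, 1::nat}, {{0, 1}}) (rename (\<lambda>i. if i = 0 then a else b) ({0, 1::nat}, {{0, 1}}))"
      by (rule iso_rename) (use abv in \<open>auto simp: simple_graph_def inj_on_def\<close>)
    then show ?thesis by (simp add: rename_def insert_commute)
  qed
  ultimately show "graph_iso (induced (add_tip H y a b) (nbhd (add_tip H y a b) y)) (complete_graph {..<2::nat})"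
    using graph_iso_sym by (simp add: complete_2)
  have "del_vertex (add_tip H y a b) y = H"
    using noy y sH by (auto simp: del_vertex_def induced_def add_tip_def prod_eq_iff simple_graph_def)
  then show "two_tree (del_vertex (add_tip H y a b) y)" using H by simp
qed

text \<open>Reading the removal of a vertex of degree two backwards: two-trees arise from a triangle by adding
  tips to edges.\<close>

lemma two_tree_build_induct [consumes 1, case_names triangle tip]:
  assumes "two_tree G"
    and base: "\<And>x y z. x \<noteq> y \<Longrightarrow> y \<noteq> z \<Longrightarrow> x \<noteq> z \<Longrightarrow> P (tri_graph x y z)"
    and step: "\<And>H y a b. two_tree H \<Longrightarrow> P H \<Longrightarrow> y \<notin> verts H \<Longrightarrow> {a, b} \<in> edges H \<Longrightarrow> P (add_tip H y a b)"
  shows "P G"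
  using assms(1)
proof (induction rule: two_tree.induct)
  case (base G)
  then show ?case using assms(2) triangleE by metis
next
  case (step G v)
  obtain a b where ab: "nbhd G v = {a, b}" "a \<noteq> b" "{a, b} \<in> edges G"
    using graph_iso_edge[OF step.hyps(4)] .
  let ?H = "del_vertex G v"
  have nb: "{u, v} \<in> edges G \<longleftrightarrow> u = a \<or> u = b" for u using ab(1) by (auto simp: nbhd_def)
  have "a \<noteq> v" "b \<noteq> v" using nb[of a] nb[of b] edge_neq[OF step.hyps(1)] by blast+
  then have "{a, b} \<in> edges ?H"
    using ab(3) step.hyps(1) by (auto simp: del_vertex_def simple_graph_def)
  moreover have "G = add_tip ?H v a b"
  proof -
    have "edges G = insert {v, a} (insert {v, b} (edges ?H))"
    proof (intro equalityI subsetI)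
      fix e assume e: "e \<in> edges G"
      then obtain x y where xy: "e = {x, y}" "x \<in> verts G" "y \<in> verts G" using edgeE[OF step.hyps(1)] by metis
      consider "x = v" | "y = v" | "x \<noteq> v" "y \<noteq> v" by blast
      then show "e \<in> insert {v, a} (insert {v, b} (edges ?H))"
      proof cases
        case 1
        then have "{y, v} \<in> edges G" using e xy by (simp add: insert_commute)
        then have "y = a \<or> y = b" by (simp add: nb)
        then show ?thesis using 1 xy(1) by blast
      next
        case 2
        then have "{x, v} \<in> edges G" using e xy by simp
        then have "x = a \<or> x = b" by (simp add: nb)
        moreover have "e = {v, x}" using 2 xy(1) by auto
        ultimately show ?thesis by blast
      next
        case 3
        then show ?thesis using e xy by (simp add: del_vertex_def)
      qed
    next
      fix e assume "e \<in> insert {v, a} (insert {v, b} (edges ?H))"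
      moreover have "{v, a} \<in> edges G" "{v, b} \<in> edges G" using nb[of a] nb[of b] by (simp_all add: insert_commute)
      ultimately show "e \<in> edges G" by (auto simp: del_vertex_def)
    qed
    then show ?thesis using step.hyps(3) by (auto simp: add_tip_def prod_eq_iff del_vertex_def)
  qed
  moreover have "v \<notin> verts ?H" by (simp add: del_vertex_def)
  ultimately show ?case using assms(3)[of ?H v a b] step by metis
qed

lemma two_tree_card:
  assumes "two_tree G"
  shows "3 \<le> card (verts G)" "card (edges G) + 3 = 2 * card (verts G)"
proof -
  have "3 \<le> card (verts G) \<and> card (edges G) + 3 = 2 * card (verts G)"
    using assms
  proof (induction rule: two_tree_build_induct)
    case (triangle x y z)
    then show ?case by (simp add: tri_graph_def card_insert_if doubleton_eq_iff)
  next
    case (tip H y a b)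
    note sH = two_tree_simple[OF tip.hyps(1)]
    have ab: "a \<noteq> b" using edge_neq[OF sH tip.hyps(3)] .
    have "{y, a} \<notin> edges H" "{y, b} \<notin> edges H" using edge_verts[OF sH] tip.hyps(2) by blast+
    then show ?case using tip.IH tip.hyps finite_verts[OF sH] finite_edges[OF sH] ab
      by (simp add: add_tip_def card_insert_if doubleton_eq_iff)
  qed
  then show "3 \<le> card (verts G)" "card (edges G) + 3 = 2 * card (verts G)" by auto
qed

lemma two_tree_rename:
  assumes "two_tree G" "inj_on f (verts G)"
  shows "two_tree (rename f G)"
  using assms
proof (induction rule: two_tree_build_induct)
  case (triangle x y z)
  then have "f x \<noteq> f y" "f y \<noteq> f z" "f x \<noteq> f z" by (auto simp: tri_graph_def inj_on_def)
  then show ?case by (simp add: rename_tri_graph two_tree.base triangle_tri_graph)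
next
  case (tip H y a b)
  have inj: "inj_on f (insert y (verts H))" using tip.prems by (simp add: add_tip_def)
  then have "two_tree (rename f H)" using tip.IH by simp
  moreover have "f y \<notin> verts (rename f H)" using inj tip.hyps(2) by simp
  moreover have "{f a, f b} \<in> edges (rename f H)" using imageI[OF tip.hyps(3), of "(`) f"] by simp
  moreover have "3 \<le> card (verts (rename f H))"
    using inj two_tree_card(1)[OF tip.hyps(1)] by (simp add: card_image)
  ultimately show ?case by (simp add: rename_add_tip two_tree_add_tip)
qed

lemma two_tree_edge_in_triangle:
  assumes "two_tree G" "{a, b} \<in> edges G"
  shows "\<exists>c. {a, c} \<in> edges G \<and> {b, c} \<in> edges G"
  using assms
proof (induction arbitrary: a b rule: two_tree_build_induct)
  case (triangle x y z)
  then show ?case by (auto simp: tri_graph_def doubleton_eq_iff)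
next
  case (tip H y p q)
  consider "{a, b} \<in> edges H" | "{a, b} = {y, p}" | "{a, b} = {y, q}"
    using tip.prems by (auto simp: add_tip_def)
  then show ?case
  proof cases
    case 1
    then show ?thesis using tip.IH[OF 1] by (auto simp: add_tip_def)
  next
    case 2
    then have "{y, q} \<in> edges (add_tip H y p q)" "{p, q} \<in> edges (add_tip H y p q)"
      using tip.hyps(3) by (auto simp: add_tip_def)
    then show ?thesis using 2 by (intro exI[of _ q]) (metis doubleton_eq_iff)
  next
    case 3
    then have "{y, p} \<in> edges (add_tip H y p q)" "{q, p} \<in> edges (add_tip H y p q)"
      using tip.hyps(3) by (auto simp: add_tip_def insert_commute)
    then show ?thesis using 3 by (intro exI[of _ p]) (metis doubleton_eq_iff)
  qed
qed

lemma conn_doubleton: "{a, b} \<in> edges G \<Longrightarrow> conn G {a, b}"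
  using conn_insert[of G "{b}" a b] by simp

lemma two_tree_conn_delete:
  assumes "two_tree G"
  shows "conn G (verts G) \<and> (\<forall>v. conn G (verts G - {v}))"
  using assms
proof (induction rule: two_tree_build_induct)
  case (triangle x y z)
  let ?G = "tri_graph x y z"
  have e: "{x, y} \<in> edges ?G" "{y, z} \<in> edges ?G" "{x, z} \<in> edges ?G" by (auto simp: tri_graph_def)
  have w: "conn ?G {x, y, z}" using conn_insert[OF conn_doubleton[OF e(2)], of x y] e by simp
  have "conn ?G ({x, y, z} - {v})" for v
  proof -
    have "{x, y, z} - {v} = {x, y} \<or> {x, y, z} - {v} = {y, z} \<or> {x, y, z} - {v} = {x, z} \<or>
        {x, y, z} - {v} = {x, y, z}" using triangle by auto
    then show ?thesis using w conn_doubleton[OF e(1)] conn_doubleton[OF e(2)] conn_doubleton[OF e(3)] by metis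
  qed
  moreover have "verts ?G = {x, y, z}" by (simp add: tri_graph_def)
  ultimately show ?case using w by simp
next
  case (tip H y a b)
  let ?G = "add_tip H y a b"
  note sH = two_tree_simple[OF tip.hyps(1)]
  have ab: "a \<in> verts H" "b \<in> verts H" "a \<noteq> b" using edge_verts[OF sH tip.hyps(3)] edge_neq[OF sH tip.hyps(3)] by auto
  have m: "edges H \<subseteq> edges ?G" by (auto simp: add_tip_def)
  have e: "{y, a} \<in> edges ?G" "{y, b} \<in> edges ?G" by (auto simp: add_tip_def)
  have c: "conn ?G (verts H)" "\<And>v. conn ?G (verts H - {v})" using tip.IH conn_mono_edges[OF _ m] by auto
  have V: "verts ?G = insert y (verts H)" by (simp add: add_tip_def)
  have "conn ?G (verts ?G - {v})" for v
  proof (cases "v = y")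
    case True
    then show ?thesis using c V tip.hyps(2) by simp
  next
    case False
    then have "verts ?G - {v} = insert y (verts H - {v})" using V by auto
    moreover have "conn ?G (insert y (verts H - {v}))"
    proof (cases "a = v")
      case True
      then show ?thesis using conn_insert[OF c(2) e(2), of v] ab by simp
    next
      case False
      then show ?thesis using conn_insert[OF c(2) e(1), of v] ab by simp
    qed
    ultimately show ?thesis by simp
  qed
  moreover have "conn ?G (verts ?G)" using conn_insert[OF c(1) e(1)] ab V by simp
  ultimately show ?case by blast
qed

lemma two_tree_two_connected:
  assumes "two_tree G"
  shows "two_connected G"
  unfolding two_connected_def del_vertex_def
  using two_tree_simple[OF assms] two_tree_card[OF assms] two_tree_conn_delete[OF assms]
  by (simp add: graph_connected_iff_conn conn_def)

lemma two_tree_3_triangle: "two_tree G \<Longrightarrow> card (verts G) = 3 \<Longrightarrow> triangle G"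
  by (erule two_tree.cases) auto

section \<open>Trees of two-trees\<close>

definition glue :: "'a sgraph list \<Rightarrow> 'a sgraph" where
  "glue Hs = (\<Union>H\<in>set Hs. verts H, \<Union>H\<in>set Hs. edges H)"

lemma glue_Nil [simp]: "verts (glue []) = {}" "edges (glue []) = {}"
  and glue_Cons [simp]: "verts (glue (H # Hs)) = verts H \<union> verts (glue Hs)"
    "edges (glue (H # Hs)) = edges H \<union> edges (glue Hs)"
  and glue_append [simp]: "verts (glue (Hs @ Ks)) = verts (glue Hs) \<union> verts (glue Ks)"
    "edges (glue (Hs @ Ks)) = edges (glue Hs) \<union> edges (glue Ks)"
  by (simp_all add: glue_def)

lemma glue_member: "H \<in> set Hs \<Longrightarrow> verts H \<subseteq> verts (glue Hs)" "H \<in> set Hs \<Longrightarrow> edges H \<subseteq> edges (glue Hs)"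
  by (auto simp: glue_def)

text \<open>The parts are listed so that each one meets the union of those after it in a single vertex; thus \<open>glue\<close>
  arranges them like the blocks of a connected graph, along a tree.\<close>

primrec block_seq :: "'a sgraph list \<Rightarrow> bool" where
  "block_seq [] \<longleftrightarrow> False"
| "block_seq (H # Hs) \<longleftrightarrow> two_tree H \<and>
     (Hs = [] \<or> block_seq Hs \<and> (\<exists>x. verts H \<inter> verts (glue Hs) = {x}))"

definition sizes :: "'a sgraph list \<Rightarrow> nat multiset" where
  "sizes Hs = mset (map (\<lambda>H. card (verts H)) Hs)"

lemma sizes_simps [simp]: "sizes [] = {#}" "sizes (H # Hs) = add_mset (card (verts H)) (sizes Hs)"
  "sizes (Hs @ Ks) = sizes Hs + sizes Ks"
  by (simp_all add: sizes_def)

lemma block_seq_two_tree: "block_seq Hs \<Longrightarrow> H \<in> set Hs \<Longrightarrow> two_tree H"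
  by (induction Hs) auto

lemma block_seq_simple: "block_seq Hs \<Longrightarrow> simple_graph (glue Hs)"
proof -
  assume "block_seq Hs"
  then have s: "simple_graph H" if "H \<in> set Hs" for H using that two_tree_simple block_seq_two_tree by blast
  have "e \<subseteq> verts (glue Hs) \<and> card e = 2" if "H \<in> set Hs" "e \<in> edges H" for H e
    using s[OF that(1)] glue_member(1)[OF that(1)] that(2) by (auto simp: simple_graph_def)
  moreover have "\<exists>H\<in>set Hs. e \<in> edges H" if "e \<in> edges (glue Hs)" for e using that by (simp add: glue_def)
  moreover have "finite (verts (glue Hs))" using finite_verts[OF s] by (simp add: glue_def)
  ultimately show ?thesis unfolding simple_graph_def by blast
qed

lemma block_seq_conn: "block_seq Hs \<Longrightarrow> conn (glue Hs) (verts (glue Hs))"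
proof (induction Hs)
  case (Cons H Hs)
  have H: "conn H (verts H)" using two_tree_conn_delete[of H] Cons.prems by simp
  show ?case
  proof (cases "Hs = []")
    case True
    then show ?thesis using H by (auto intro: conn_mono_edges)
  next
    case False
    then have "conn (glue Hs) (verts (glue Hs))" "verts H \<inter> verts (glue Hs) \<noteq> {}"
      using Cons by auto
    then show ?thesis using conn_Un[of "glue (H # Hs)" "verts H" "verts (glue Hs)"]
        conn_mono_edges[OF H, of "glue (H # Hs)"] conn_mono_edges[of "glue Hs" _ "glue (H # Hs)"] by simp
  qed
qed simp

lemma edges_share_vertex:
  assumes "simple_graph G" "simple_graph H" "verts G \<inter> verts H \<subseteq> {x}"
  shows "edges G \<inter> edges H = {}"
proof (rule ccontr)
  assume "edges G \<inter> edges H \<noteq> {}"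
  then obtain e where e: "e \<in> edges G" "e \<in> edges H" by blast
  then have "e \<subseteq> verts G" "e \<subseteq> verts H" "card e = 2" using assms(1,2) by (auto simp: simple_graph_def)
  then have "e \<subseteq> {x}" "card e = 2" using assms(3) by blast+
  then show False using card_mono[of "{x}" e] by simp
qed

lemma block_seq_card:
  assumes "block_seq Hs"
  shows "card (verts (glue Hs)) + length Hs = sum_mset (sizes Hs) + 1"
    "card (edges (glue Hs)) + 3 * length Hs = 2 * sum_mset (sizes Hs)"
proof -
  have "card (verts (glue Hs)) + length Hs = sum_mset (sizes Hs) + 1 \<and>
    card (edges (glue Hs)) + 3 * length Hs = 2 * sum_mset (sizes Hs)"
    using assms
  proof (induction Hs)
    case (Cons H Hs)
    have H: "two_tree H" using Cons.prems by simp
    note c = two_tree_card[OF H] finite_verts[OF two_tree_simple[OF H]] finite_edges[OF two_tree_simple[OF H]]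
    show ?case
    proof (cases "Hs = []")
      case True
      then show ?thesis using c by simp
    next
      case False
      then obtain x where x: "block_seq Hs" "verts H \<inter> verts (glue Hs) = {x}" using Cons.prems by auto
      note s = block_seq_simple[OF x(1)]
      have "edges H \<inter> edges (glue Hs) = {}"
        by (rule edges_share_vertex[OF two_tree_simple[OF H] s]) (use x in auto)
      then have "card (edges H \<union> edges (glue Hs)) = card (edges H) + card (edges (glue Hs))"
        using c finite_edges[OF s] by (simp add: card_Un_disjoint)
      moreover have "card (verts H \<union> verts (glue Hs)) + 1 = card (verts H) + card (verts (glue Hs))"
        using card_Un_Int[of "verts H" "verts (glue Hs)"] c finite_verts[OF s] x(2) by simp
      ultimately show ?thesis using Cons.IH[OF x(1)] c(2) by simp
    qed
  qed simp
  then show "card (verts (glue Hs)) + length Hs = sum_mset (sizes Hs) + 1"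
    "card (edges (glue Hs)) + 3 * length Hs = 2 * sum_mset (sizes Hs)" by auto
qed

lemma block_seq_edge_in_triangle:
  assumes "block_seq Hs" "{a, b} \<in> edges (glue Hs)"
  shows "\<exists>c. {a, c} \<in> edges (glue Hs) \<and> {b, c} \<in> edges (glue Hs)"
proof -
  obtain H where "H \<in> set Hs" "{a, b} \<in> edges H" using assms(2) by (auto simp: glue_def)
  then show ?thesis
    using two_tree_edge_in_triangle[OF block_seq_two_tree[OF assms(1)]] glue_member(2) by blast
qed

subsection \<open>The parts are the blocks\<close>

lemma two_connectedD:
  assumes "two_connected B"
  shows "simple_graph B" "3 \<le> card (verts B)" "conn B (verts B)" "conn B (verts B - {v})"
proof -
  show s: "simple_graph B" "3 \<le> card (verts B)" using assms by (auto simp: two_connected_def)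
  show c: "conn B (verts B)" using assms s by (simp add: two_connected_def graph_connected_iff_conn)
  show "conn B (verts B - {v})"
    using assms c by (cases "v \<in> verts B") (auto simp: two_connected_def del_vertex_def conn_def)
qed

text \<open>Deleting \<open>x\<close> leaves \<open>B\<close> connected, while no edge joins the two sides outside \<open>x\<close>.\<close>

lemma two_connected_in_union:
  assumes B: "two_connected B" and sub: "edges B \<subseteq> edges G \<union> edges H" "verts B \<subseteq> verts G \<union> verts H"
    and G: "simple_graph G" and H: "simple_graph H" and x: "verts G \<inter> verts H \<subseteq> {x}"
  shows "subgraph B G \<or> subgraph B H"
proof -
  let ?S = "verts B - {x}"
  have same: "p \<in> verts G \<longleftrightarrow> q \<in> verts G" if "p \<in> ?S" "q \<in> ?S" for p q
  proof (rule conn_constant[OF two_connectedD(4)[OF B, of x], of "\<lambda>v. v \<in> verts G"])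
    fix u v assume uv: "u \<in> ?S" "v \<in> ?S" "{u, v} \<in> edges B"
    then consider "{u, v} \<in> edges G" | "{u, v} \<in> edges H" using sub by blast
    then show "(u \<in> verts G) = (v \<in> verts G)"
    proof cases
      case 1
      then show ?thesis using edge_verts[OF G] by blast
    next
      case 2
      then have "u \<in> verts H" "v \<in> verts H" using edge_verts[OF H] by blast+
      then show ?thesis using x uv by blast
    qed
  qed (use that in auto)
  obtain p where p: "p \<in> ?S" using conn_nonempty[OF two_connectedD(4)[OF B, of x]] by blast
  have noloop: "\<not> e \<subseteq> {x}" if "e \<in> edges B" for e
    using edgeE[OF two_connectedD(1)[OF B] that] by (metis insert_subset singletonD)
  have part: "subgraph B K" if K: "simple_graph K" "simple_graph L" "verts K \<inter> verts L \<subseteq> {x}"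
      "edges B \<subseteq> edges K \<union> edges L" "?S \<subseteq> verts K" "verts B \<subseteq> verts K \<union> verts L" for K L
  proof -
    have e: "e \<in> edges K" if "e \<in> edges B" for e
    proof (rule ccontr)
      assume "e \<notin> edges K"
      then have "e \<in> edges L" using K(4) that by blast
      then have "e \<subseteq> verts L" "e \<subseteq> verts B" using K(2) two_connectedD(1)[OF B] that by (auto simp: simple_graph_def)
      then have "e \<subseteq> {x}" using K(3,5) by blast
      then show False using noloop[OF that] by simp
    qed
    have "x \<in> verts K" if x: "x \<in> verts B"
    proof -
      have "touches B {x} (verts B - {x})"
        by (rule connD[OF two_connectedD(3)[OF B]]) (use x p in auto)
      then obtain v where "{x, v} \<in> edges B" by (auto simp: touches_def)
      then show ?thesis using e edge_verts[OF K(1)] by blast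
    qed
    then show ?thesis using e K(5) two_connectedD(1)[OF B] unfolding subgraph_def by blast
  qed
  show ?thesis
  proof (cases "p \<in> verts G")
    case True
    then have "?S \<subseteq> verts G" using same p by blast
    then have "subgraph B G" by (intro part[OF G H]) (use sub x in auto)
    then show ?thesis ..
  next
    case False
    then have "?S \<subseteq> verts H" using same p sub by blast
    then have "subgraph B H" by (intro part[OF H G]) (use sub x in auto)
    then show ?thesis ..
  qed
qed

lemma two_connected_in_part:
  assumes "block_seq Hs" "two_connected B" "subgraph B (glue Hs)"
  shows "\<exists>H\<in>set Hs. subgraph B H"
  using assms
proof (induction Hs)
  case (Cons H Hs)
  have sub: "edges B \<subseteq> edges H \<union> edges (glue Hs)" "verts B \<subseteq> verts H \<union> verts (glue Hs)"
    using Cons.prems(3) by (auto simp: subgraph_def)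
  show ?case
  proof (cases "Hs = []")
    case True
    then show ?thesis using Cons.prems sub by (auto simp: subgraph_def)
  next
    case False
    then obtain x where x: "two_tree H" "block_seq Hs" "verts H \<inter> verts (glue Hs) = {x}"
      using Cons.prems(1) by auto
    have "subgraph B H \<or> subgraph B (glue Hs)"
      by (rule two_connected_in_union[OF Cons.prems(2) sub two_tree_simple[OF x(1)] block_seq_simple[OF x(2)]])
         (use x in auto)
    then show ?thesis using Cons.IH[OF x(2) Cons.prems(2)] by auto
  qed
qed simp

lemma block_seq_share:
  assumes "block_seq (As @ H # Bs)" "K \<in> set As \<union> set Bs"
  shows "card (verts H \<inter> verts K) \<le> 1"
  using assms
proof (induction As)
  case Nil
  then have "Bs \<noteq> []" "K \<in> set Bs" by auto
  then obtain x where "verts H \<inter> verts (glue Bs) = {x}" using Nil.prems(1) by auto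
  then have "verts H \<inter> verts K \<subseteq> {x}" using glue_member(1)[OF \<open>K \<in> set Bs\<close>] by blast
  then show ?case using card_mono[of "{x}" "verts H \<inter> verts K"] by simp
next
  case (Cons A As)
  then obtain x where x: "block_seq (As @ H # Bs)" "verts A \<inter> verts (glue (As @ H # Bs)) = {x}" by auto
  show ?case
  proof (cases "K \<in> set As \<union> set Bs")
    case True
    then show ?thesis using Cons.IH x by blast
  next
    case False
    then have "K = A" using Cons.prems by simp
    moreover have "verts H \<subseteq> verts (glue (As @ H # Bs))" by auto
    ultimately have "verts H \<inter> verts K \<subseteq> {x}" using x(2) by blast
    then show ?thesis using card_mono[of "{x}" "verts H \<inter> verts K"] by simp
  qed
qed

lemma block_seq_distinct: "block_seq Hs \<Longrightarrow> distinct Hs"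
proof (rule ccontr)
  assume *: "block_seq Hs" "\<not> distinct Hs"
  then obtain As H Bs Cs where Hs: "Hs = As @ [H] @ Bs @ [H] @ Cs" using not_distinct_decomp by metis
  then have "card (verts H \<inter> verts H) \<le> 1" using block_seq_share[of As H "Bs @ H # Cs" H] * by simp
  moreover have "3 \<le> card (verts H)" using two_tree_card(1)[OF block_seq_two_tree[OF *(1)]] Hs by simp
  ultimately show False by simp
qed

text \<open>There are no bridges as every edge lies in a triangle, and a two-connected subgraph lies in one part.\<close>

lemma blocks_glue:
  assumes Hs: "block_seq Hs"
  shows "blocks (glue Hs) = set Hs"
proof -
  have tc: "two_connected H" if "H \<in> set Hs" for H
    using two_tree_two_connected block_seq_two_tree[OF Hs that] .
  have mem: "subgraph H (glue Hs)" if "H \<in> set Hs" for H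
    using glue_member[OF that] two_connectedD(1)[OF tc[OF that]] by (simp add: subgraph_def)
  have eq: "H = K" if "H \<in> set Hs" "K \<in> set Hs" "subgraph H K" for H K
  proof (rule ccontr)
    assume ne: "H \<noteq> K"
    obtain As Bs where AB: "Hs = As @ H # Bs" using \<open>H \<in> set Hs\<close> split_list by metis
    then have "card (verts H \<inter> verts K) \<le> 1" using block_seq_share[of As H Bs K] Hs that ne by auto
    moreover have "verts H \<inter> verts K = verts H" using that(3) by (auto simp: subgraph_def)
    ultimately show False using two_connectedD(2)[OF tc[OF that(1)]] by simp
  qed
  have antisym: "C = B" if "subgraph B C" "subgraph C B" for B C :: "'a sgraph"
    using that by (auto simp: subgraph_def prod_eq_iff)
  have strans: "subgraph B D" if "subgraph B C" "subgraph C D" for B C D :: "'a sgraph"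
    using that by (auto simp: subgraph_def)
  have nobridge: "\<not> bridge (glue Hs) e" for e
  proof
    assume "bridge (glue Hs) e"
    then obtain u v where uv: "e = {u, v}" "{u, v} \<in> edges (glue Hs)"
        "\<not> reachable (verts (glue Hs), edges (glue Hs) - {{u, v}}) u v"
      unfolding bridge_def by blast
    obtain w where w: "{u, w} \<in> edges (glue Hs)" "{v, w} \<in> edges (glue Hs)"
      using block_seq_edge_in_triangle[OF Hs uv(2)] by blast
    note s = block_seq_simple[OF Hs]
    have "u \<noteq> w" "v \<noteq> w" using edge_neq[OF s] w by blast+
    then have "{u, w} \<in> edges (glue Hs) - {{u, v}}" "{w, v} \<in> edges (glue Hs) - {{u, v}}"
      using w by (auto simp: doubleton_eq_iff insert_commute)
    then have "reachable (verts (glue Hs), edges (glue Hs) - {{u, v}}) u v"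
      by (intro reachable_step[of _ u w v] reachable_step[of _ u u w]) auto
    then show False using uv by simp
  qed
  show ?thesis
  proof (intro equalityI subsetI)
    fix B assume "B \<in> blocks (glue Hs)"
    then have B: "subgraph B (glue Hs)" "two_connected B"
      "\<And>C. subgraph C (glue Hs) \<Longrightarrow> two_connected C \<Longrightarrow> subgraph B C \<Longrightarrow> C = B"
      using nobridge unfolding blocks_def by blast+
    obtain H where "H \<in> set Hs" "subgraph B H" using two_connected_in_part[OF Hs B(2,1)] by blast
    then show "B \<in> set Hs" using B(3)[of H] mem tc by metis
  next
    fix H assume H: "H \<in> set Hs"
    have "C = H" if C: "subgraph C (glue Hs)" "two_connected C" "subgraph H C" for C
    proof -
      obtain K where K: "K \<in> set Hs" "subgraph C K" using two_connected_in_part[OF Hs C(2,1)] by blast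
      then have "H = K" using eq H strans[OF C(3) K(2)] by blast
      then show ?thesis using antisym C(3) K(2) by blast
    qed
    then show "H \<in> blocks (glue Hs)" using mem[OF H] tc[OF H] unfolding blocks_def by blast
  qed
qed

subsection \<open>Rearranging and collapsing parts\<close>

lemma block_seq_suffix: "block_seq (As @ Bs) \<Longrightarrow> Bs \<noteq> [] \<Longrightarrow> block_seq Bs"
  by (induction As) auto

lemma block_seq_replace_suffix:
  assumes "block_seq (As @ Bs)" "block_seq Bs'" "verts (glue Bs') = verts (glue Bs)" "Bs \<noteq> []"
  shows "block_seq (As @ Bs')"
  using assms by (induction As) auto

text \<open>As \<open>y\<close> is a new vertex, no intersection with another part changes.\<close>

lemma block_seq_grow_part:
  assumes "block_seq (As @ H # Bs)" "two_tree H'" "verts H' = insert y (verts H)"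
    "y \<notin> verts (glue (As @ H # Bs))"
  shows "block_seq (As @ H' # Bs)"
  using assms
proof (induction As)
  case (Cons A As)
  have "verts A \<inter> verts (glue (As @ H' # Bs)) = verts A \<inter> verts (glue (As @ H # Bs))"
    using Cons.prems(3,4) by auto
  then show ?case using Cons by auto
qed auto

text \<open>Collapsing one part to the vertex \<open>r\<close> where it meets the later parts renames the vertices of the
  earlier ones, injectively on each.\<close>

lemma block_seq_collapse:
  assumes "block_seq (As @ H # Bs)" "Bs \<noteq> []" "verts H \<inter> verts (glue Bs) = {r}"
  defines "q \<equiv> \<lambda>v. if v \<in> verts H then r else v"
  shows "block_seq (map (rename q) As @ Bs) \<and>
    verts (glue (map (rename q) As @ Bs)) = q ` verts (glue (As @ H # Bs)) \<and>
    edges (glue (map (rename q) As @ Bs)) \<subseteq> (\<lambda>e. q ` e) ` edges (glue (As @ H # Bs)) \<and>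
    sizes (map (rename q) As @ Bs) = sizes As + sizes Bs"
  using assms(1)
proof (induction As)
  case Nil
  have B: "block_seq Bs" using Nil assms(2) by simp
  have id: "q v = v" if "v \<in> verts (glue Bs)" for v using assms(3) that by (auto simp: q_def)
  have r: "r \<in> verts H" "r \<in> verts (glue Bs)" using assms(3) by auto
  have "q ` verts H = {r}" using r by (auto simp: q_def)
  moreover have "q ` verts (glue Bs) = verts (glue Bs)" using id by simp
  moreover have "q ` e = e" if "e \<in> edges (glue Bs)" for e
  proof -
    have "e \<subseteq> verts (glue Bs)" using block_seq_simple[OF B] that by (auto simp: simple_graph_def)
    then show ?thesis using id by force
  qed
  ultimately show ?case using B r by (auto simp: image_Un)
next
  case (Cons K As)
  let ?old = "verts (glue (As @ H # Bs))"
  obtain x where x: "two_tree K" "block_seq (As @ H # Bs)" "verts K \<inter> ?old = {x}"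
    using Cons.prems by auto
  note IH = Cons.IH[OF x(2)]
  have rH: "r \<in> verts H" using assms(3) by auto
  have Hold: "verts H \<subseteq> ?old" by auto
  have Kx: "v = x" if "v \<in> verts K" "v \<in> verts H" for v using x(3) Hold that by blast
  have inj: "inj_on q (verts K)"
  proof (rule inj_onI)
    fix u v assume uv: "u \<in> verts K" "v \<in> verts K" "q u = q v"
    show "u = v"
    proof (cases "u \<in> verts H")
      case True
      moreover have "v \<in> verts H" using uv(3) True rH unfolding q_def by metis
      ultimately show ?thesis using Kx uv(1,2) by metis
    next
      case False
      moreover have "v \<notin> verts H" using uv(3) False rH unfolding q_def by metis
      ultimately show ?thesis using uv(3) by (simp add: q_def)
    qed
  qed
  have "q ` verts K \<inter> q ` ?old = {q x}"
  proof
    show "{q x} \<subseteq> q ` verts K \<inter> q ` ?old" using x(3) by blast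
    show "q ` verts K \<inter> q ` ?old \<subseteq> {q x}"
    proof
      fix w assume "w \<in> q ` verts K \<inter> q ` ?old"
      then obtain p g where pg: "w = q p" "p \<in> verts K" "q p = q g" "g \<in> ?old" by auto
      show "w \<in> {q x}"
      proof (cases "p \<in> verts H")
        case True
        then show ?thesis using Kx pg by simp
      next
        case False
        then have "g \<notin> verts H" using pg(3) rH unfolding q_def by metis
        then have "p = g" using False pg(3) by (simp add: q_def)
        then have "p = x" using x(3) pg(2,4) by blast
        then show ?thesis using pg(1) by simp
      qed
    qed
  qed
  then show ?case using IH two_tree_rename[OF x(1) inj] assms(2) card_image[OF inj]
    by (auto simp: image_Un)
qed

lemma collapse_part_aux:
  fixes H :: "'a sgraph"
  assumes Hs: "block_seq (As @ H # Bs)" and ne: "Bs \<noteq> []"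
  shows "\<exists>Hs' :: 'a sgraph list. block_seq Hs' \<and> sizes Hs' = sizes As + sizes Bs \<and> minor (glue Hs') (glue (As @ H # Bs))"
proof -
  let ?G = "glue (As @ H # Bs)"
  obtain r where r: "verts H \<inter> verts (glue Bs) = {r}"
    using block_seq_suffix[OF Hs] ne by auto
  let ?q = "\<lambda>v. if v \<in> verts H then r else v"
  let ?Hs' = "map (rename ?q) As @ Bs"
  note * = block_seq_collapse[OF Hs ne r]
  have rH: "r \<in> verts H" using r by auto
  have "minor (glue ?Hs') ?G"
  proof (rule minor_quotient[where q = ?q])
    show "verts (glue ?Hs') \<subseteq> ?q ` verts ?G" using * by blast
    show "simple_graph ?G" by (rule block_seq_simple[OF Hs])
    fix x assume "x \<in> verts (glue ?Hs')"
    then obtain v where v: "v \<in> verts ?G" "x = ?q v" using * by blast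
    have H: "two_tree H" using block_seq_two_tree[OF Hs] by simp
    show "conn ?G {w \<in> verts ?G. ?q w = x}"
    proof (cases "x = r")
      case True
      then have "{w \<in> verts ?G. ?q w = x} = verts H" using rH by auto
      moreover have "conn ?G (verts H)"
        by (rule conn_mono_edges[of H]) (use two_tree_conn_delete[OF H] in auto)
      ultimately show ?thesis by simp
    next
      case False
      then have "{w \<in> verts ?G. ?q w = x} = {x}" using v rH by (auto split: if_splits)
      then show ?thesis by simp
    qed
  next
    fix e assume "e \<in> edges (glue ?Hs')"
    then obtain d where d: "d \<in> edges ?G" "e = ?q ` d" using * by blast
    then obtain u v where "d = {u, v}" using edgeE[OF block_seq_simple[OF Hs]] by metis
    then show "\<exists>u v. e = {?q u, ?q v} \<and> {u, v} \<in> edges ?G" using d by (intro exI[of _ u] exI[of _ v]) auto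
  qed
  then show ?thesis using * by (intro exI[of _ ?Hs']) simp
qed

text \<open>The last part has no later part to collapse to; exchanging it with its predecessor is harmless, since
  the condition on the last two parts is symmetric.\<close>

lemma collapse_part:
  fixes Hs :: "'a sgraph list"
  assumes Hs: "block_seq Hs" and H: "H \<in> set Hs" and len: "2 \<le> length Hs"
  obtains Hs' :: "'a sgraph list" where "block_seq Hs'" "sizes Hs' = sizes Hs - {#card (verts H)#}" "minor (glue Hs') (glue Hs)"
proof -
  obtain As Bs where AB: "Hs = As @ H # Bs" using H split_list by metis
  have "\<exists>As Bs. Bs \<noteq> [] \<and> block_seq (As @ H # Bs) \<and> glue (As @ H # Bs) = glue Hs \<and> sizes (As @ H # Bs) = sizes Hs"
  proof (cases "Bs = []")
    case True
    then have "As \<noteq> []" using len AB by auto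
    then obtain As' K where As: "As = As' @ [K]" by (metis append_butlast_last_id)
    then have Hs': "block_seq (As' @ [K, H])" using Hs AB True by simp
    then have "block_seq [K, H]" by (rule block_seq_suffix) simp
    then have "block_seq [H, K]" by (auto simp: Int_commute)
    then have "block_seq (As' @ [H, K])" by (rule block_seq_replace_suffix[OF Hs']) auto
    moreover have "glue (As' @ [H, K]) = glue Hs" using AB True As by (auto simp: glue_def)
    ultimately show ?thesis using AB True As by (intro exI[of _ As'] exI[of _ "[K]"]) auto
  qed (use AB Hs in blast)
  then obtain As Bs where *: "Bs \<noteq> []" "block_seq (As @ H # Bs)" "glue (As @ H # Bs) = glue Hs"
    "sizes (As @ H # Bs) = sizes Hs" by blast
  obtain Hs' :: "'a sgraph list" where "block_seq Hs'" "sizes Hs' = sizes As + sizes Bs" "minor (glue Hs') (glue (As @ H # Bs))"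
    using collapse_part_aux[OF *(2,1)] by blast
  then show ?thesis using that[of Hs'] * by (simp add: *(4)[symmetric])
qed

lemma collapse_triangles:
  fixes Hs :: "'a sgraph list"
  assumes "block_seq Hs" "sizes Hs = M + replicate_mset n 3" "M \<noteq> {#}"
  shows "\<exists>Hs' :: 'a sgraph list. block_seq Hs' \<and> sizes Hs' = M \<and> minor (glue Hs') (glue Hs)"
  using assms
proof (induction n arbitrary: Hs)
  case 0
  then show ?case using minor_refl[OF block_seq_simple[OF 0(1)]] by (intro exI[of _ Hs]) simp
next
  case (Suc n)
  have "3 \<in># sizes Hs" using Suc.prems by simp
  then obtain H where H: "H \<in> set Hs" "card (verts H) = 3" by (auto simp: sizes_def)
  have "length Hs = size (sizes Hs)" by (simp add: sizes_def)
  then have "2 \<le> length Hs" using Suc.prems(2,3) by (cases "size M") auto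
  then obtain Hs1 :: "'a sgraph list" where Hs1: "block_seq Hs1" "sizes Hs1 = sizes Hs - {#card (verts H)#}" "minor (glue Hs1) (glue Hs)"
    using collapse_part[OF Suc.prems(1) H(1)] by blast
  then have "sizes Hs1 = M + replicate_mset n 3" using Suc.prems(2) H(2) by simp
  then obtain Hs2 :: "'a sgraph list" where "block_seq Hs2" "sizes Hs2 = M" "minor (glue Hs2) (glue Hs1)"
    using Suc.IH[OF Hs1(1) _ Suc.prems(3)] by blast
  then show ?case using minor_trans[OF block_seq_simple _ Hs1(3)] by blast
qed

subsection \<open>Membership in the target families\<close>

lemma glue_basic:
  assumes "block_seq Hs"
  shows "simple_graph (glue Hs)" "graph_connected (glue Hs)" "card (blocks (glue Hs)) = size (sizes Hs)"
  using block_seq_simple[OF assms] block_seq_conn[OF assms] blocks_glue[OF assms]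
    distinct_card[OF block_seq_distinct[OF assms]]
  by (simp_all add: graph_connected_iff_conn sizes_def)

lemma sizes_pick:
  assumes "block_seq Hs" "sizes Hs = add_mset m M"
  obtains H where "H \<in> set Hs" "two_tree_on m H" "\<And>K. K \<in> set Hs - {H} \<Longrightarrow> card (verts K) \<in># M"
    "\<And>n M'. M = add_mset n M' \<Longrightarrow> \<exists>K\<in>set Hs - {H}. two_tree_on n K \<and> (\<forall>L\<in>set Hs - {H, K}. card (verts L) \<in># M')"
proof -
  have "m \<in># sizes Hs" using assms(2) by simp
  then obtain H where H: "H \<in> set Hs" "card (verts H) = m" by (auto simp: sizes_def)
  obtain As Bs where AB: "Hs = As @ H # Bs" using H split_list by metis
  then have M: "M = sizes (As @ Bs)" using assms(2) H(2) by simp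
  have d: "distinct (As @ H # Bs)" using block_seq_distinct[OF assms(1)] AB by simp
  then have rest: "set Hs - {H} = set (As @ Bs)" using AB by auto
  show ?thesis
  proof (rule that[OF H(1)])
    show "two_tree_on m H" using block_seq_two_tree[OF assms(1) H(1)] H(2) by (simp add: two_tree_on_def)
    show "card (verts K) \<in># M" if "K \<in> set Hs - {H}" for K
      using that unfolding rest M sizes_def by auto
    fix n M' assume n: "M = add_mset n M'"
    then have "n \<in># sizes (As @ Bs)" using M by simp
    then obtain K where K: "K \<in> set (As @ Bs)" "card (verts K) = n" by (auto simp: sizes_def)
    obtain Cs Ds where CD: "As @ Bs = Cs @ K # Ds" using K split_list by metis
    then have M': "M' = sizes (Cs @ Ds)" using n M K(2) by simp
    have "distinct (Cs @ K # Ds)" using d CD by (metis distinct_append distinct.simps(2) Int_insert_right_if0 disjoint_insert(2) list.simps(15) Int_commute)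
    then have "set Hs - {H, K} = set (Cs @ Ds)" using rest CD by auto
    moreover have "two_tree_on n K" using block_seq_two_tree[OF assms(1), of K] K rest by (auto simp: two_tree_on_def)
    moreover have "card (verts L) \<in># M'" if "L \<in> set (Cs @ Ds)" for L using that unfolding M' sizes_def by auto
    ultimately show "\<exists>K\<in>set Hs - {H}. two_tree_on n K \<and> (\<forall>L\<in>set Hs - {H, K}. card (verts L) \<in># M')"
      using K(1) rest by blast
  qed
qed

lemma part_triangle:
  "block_seq Hs \<Longrightarrow> K \<in> set Hs \<Longrightarrow> card (verts K) \<in># replicate_mset b 3 \<Longrightarrow> triangle K"
  using two_tree_3_triangle[OF block_seq_two_tree, of Hs K] by (cases "b = 0") simp_all

lemma glue_A6: "block_seq Hs \<Longrightarrow> sizes Hs = {#6#} \<Longrightarrow> glue Hs \<in> \<A>6"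
proof -
  assume *: "block_seq Hs" "sizes Hs = {#6#}"
  then obtain H where "Hs = [H]" "card (verts H) = 6" by (cases Hs) (auto simp: sizes_def)
  moreover have "glue [H] = H" by (simp add: glue_def)
  ultimately show ?thesis using * by (simp add: \<A>6_def two_tree_on_def)
qed

lemma glue_A8:
  assumes "block_seq Hs" "sizes Hs = {#5, 4#}"
  shows "glue Hs \<in> \<A>8"
proof -
  obtain H where H: "H \<in> set Hs" "two_tree_on 5 H"
    "\<exists>K\<in>set Hs - {H}. two_tree_on 4 K \<and> (\<forall>L\<in>set Hs - {H, K}. card (verts L) \<in># {#})"
    using sizes_pick[OF assms] by metis
  then obtain K where K: "K \<in> set Hs - {H}" "two_tree_on 4 K"
    "\<forall>L\<in>set Hs - {H, K}. card (verts L) \<in># {#}" by blast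
  have "L \<notin> set Hs - {H, K}" for L
  proof
    assume "L \<in> set Hs - {H, K}"
    then have "card (verts L) \<in># {#}" using K(3) by blast
    then show False by simp
  qed
  then have "K \<noteq> H" "set Hs = {H, K}" using K(1) H(1) by blast+
  then have "\<exists>B C. B \<noteq> C \<and> blocks (glue Hs) = {B, C} \<and> two_tree_on 5 B \<and> two_tree_on 4 C"
    using H(2) K(2) blocks_glue[OF assms(1)] by (intro exI[of _ H] exI[of _ K]) simp
  then show ?thesis using glue_basic[OF assms(1)] by (simp add: \<A>8_def)
qed

lemma glue_A10:
  assumes "block_seq Hs" "sizes Hs = {#4, 4, 4#}"
  shows "glue Hs \<in> \<A>10"
proof -
  have "two_tree_on 4 H" if "H \<in> set Hs" for H
  proof -
    have "card (verts H) \<in># sizes Hs" using that by (simp add: sizes_def)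
    then show ?thesis using block_seq_two_tree[OF assms(1) that] assms(2) by (simp add: two_tree_on_def)
  qed
  then show ?thesis using glue_basic[OF assms(1)] blocks_glue[OF assms(1)] assms(2) by (simp add: \<A>10_def)
qed

lemma glue_E1:
  assumes "block_seq Hs" "sizes Hs = replicate_mset b 3"
  shows "glue Hs \<in> \<E>1 b"
proof -
  have "triangle H" if "H \<in> set Hs" for H
  proof -
    have "card (verts H) \<in># sizes Hs" using that by (simp add: sizes_def)
    then show ?thesis using part_triangle[OF assms(1) that] assms(2) by simp
  qed
  then show ?thesis using glue_basic[OF assms(1)] blocks_glue[OF assms(1)] assms(2) by (simp add: \<E>1_def)
qed

lemma glue_E23:
  assumes "block_seq Hs" "sizes Hs = add_mset m (replicate_mset b 3)"
  shows "card (blocks (glue Hs)) = b + 1 \<and>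
    (\<exists>B\<in>blocks (glue Hs). two_tree_on m B \<and> (\<forall>C\<in>blocks (glue Hs) - {B}. triangle C))"
proof -
  obtain H where H: "H \<in> set Hs" "two_tree_on m H" "\<And>K. K \<in> set Hs - {H} \<Longrightarrow> card (verts K) \<in># replicate_mset b 3"
    using sizes_pick[OF assms] by metis
  then have "\<forall>C\<in>set Hs - {H}. triangle C" using part_triangle[OF assms(1)] by blast
  then show ?thesis using H glue_basic[OF assms(1)] blocks_glue[OF assms(1)] assms(2) by auto
qed

lemma glue_E2: "block_seq Hs \<Longrightarrow> sizes Hs = add_mset 4 (replicate_mset b 3) \<Longrightarrow> glue Hs \<in> \<E>2 b"
  using glue_E23[of Hs 4 b] glue_basic[of Hs] by (simp add: \<E>2_def)

lemma glue_E3: "block_seq Hs \<Longrightarrow> sizes Hs = add_mset 5 (replicate_mset b 3) \<Longrightarrow> glue Hs \<in> \<E>3 b"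
  using glue_E23[of Hs 5 b] glue_basic[of Hs] by (simp add: \<E>3_def)

lemma glue_E4:
  assumes "block_seq Hs" "sizes Hs = add_mset 4 (add_mset 4 (replicate_mset b 3))"
  shows "glue Hs \<in> \<E>4 b"
proof -
  obtain H where H: "H \<in> set Hs" "two_tree_on 4 H"
    "\<exists>K\<in>set Hs - {H}. two_tree_on 4 K \<and> (\<forall>L\<in>set Hs - {H, K}. card (verts L) \<in># replicate_mset b 3)"
    using sizes_pick[OF assms] by metis
  then obtain K where K: "K \<in> set Hs" "K \<noteq> H" "two_tree_on 4 K"
    "\<And>L. L \<in> set Hs - {H, K} \<Longrightarrow> card (verts L) \<in># replicate_mset b 3" by blast
  then have "\<forall>L\<in>set Hs - {H, K}. triangle L" using part_triangle[OF assms(1)] by blast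
  then have "\<exists>B\<in>blocks (glue Hs). \<exists>B'\<in>blocks (glue Hs). B \<noteq> B' \<and> two_tree_on 4 B \<and> two_tree_on 4 B' \<and>
      (\<forall>C\<in>blocks (glue Hs) - {B, B'}. triangle C)"
    unfolding blocks_glue[OF assms(1)] using H(1,2) K(1-3) by metis
  then show ?thesis using glue_basic[OF assms(1)] assms(2) by (simp add: \<E>4_def)
qed

section \<open>Dense graphs contain a target\<close>

lemma nat_less_4: "(i::nat) < 4 \<longleftrightarrow> i = 0 \<or> i = 1 \<or> i = 2 \<or> i = 3" by auto
lemma simple_complete: "finite S \<Longrightarrow> simple_graph (complete_graph S)"
  by (simp add: simple_graph_def complete_graph_def)

lemma K4_in_A4: "complete_graph {..<4::nat} \<in> \<A>4"
  by (simp add: \<A>4_def graph_iso_refl simple_complete)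

lemma K4_minor:
  assumes c: "conn G A" "conn G B" "conn G C" "conn G D"
    and sub: "A \<union> B \<union> C \<union> D \<subseteq> verts G"
    and d: "A \<inter> B = {}" "A \<inter> C = {}" "A \<inter> D = {}" "B \<inter> C = {}" "B \<inter> D = {}" "C \<inter> D = {}"
    and t: "touches G A B" "touches G A C" "touches G A D" "touches G B C" "touches G B D" "touches G C D"
  shows "minor (complete_graph {..<4::nat}) G"
proof (rule minorI[where \<phi> = "(!) [A, B, C, D]"])
  have v: "verts (complete_graph {..<4::nat}) = {..<4}" by (simp add: complete_graph_def)
  fix x assume "x \<in> verts (complete_graph {..<4::nat})"
  then have x: "x = 0 \<or> x = 1 \<or> x = 2 \<or> x = 3" by (auto simp: v nat_less_4)
  show "[A, B, C, D] ! x \<subseteq> verts G" using x sub by (elim disjE) simp_all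
  show "conn G ([A, B, C, D] ! x)" using x c by (elim disjE) simp_all
  fix y assume "y \<in> verts (complete_graph {..<4::nat})" "x \<noteq> y"
  then have "y = 0 \<or> y = 1 \<or> y = 2 \<or> y = 3" by (auto simp: v nat_less_4)
  then show "[A, B, C, D] ! x \<inter> [A, B, C, D] ! y = {}"
    using x d \<open>x \<noteq> y\<close> by (elim disjE) (simp_all add: Int_commute)
next
  fix e assume "e \<in> edges (complete_graph {..<4::nat})"
  then have e: "e \<subseteq> {..<4}" "card e = 2" by (auto simp: complete_graph_def)
  then obtain x y where xy: "e = {x, y}" "x \<noteq> y" by (meson card_2_iff)
  then have "x < 4" "y < 4" using e by auto
  then have "touches G ([A, B, C, D] ! x) ([A, B, C, D] ! y)"
    unfolding nat_less_4 using xy(2) t by (elim disjE) (simp_all add: touches_sym)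
  then show "\<exists>x y. e = {x, y} \<and> touches G ([A, B, C, D] ! x) ([A, B, C, D] ! y)" using xy by blast
qed

text \<open>The two two-trees on six vertices that arise: a triangle with a tip on each side, and a fan.\<close>

definition sun :: "nat sgraph" where
  "sun = add_tip (add_tip (add_tip (tri_graph 0 1 2) 3 0 1) 4 1 2) 5 0 2"

definition fan :: "nat sgraph" where
  "fan = add_tip (add_tip (add_tip (tri_graph 0 1 2) 3 1 2) 4 0 1) 5 1 3"

lemma sun_simps: "verts sun = {5, 4, 3, 0, 1, 2}"
  "edges sun = {{5, 0}, {5, 2}, {4, 1}, {4, 2}, {3, 0}, {3, 1}, {0, 1}, {1, 2}, {0, 2}}"
  by (simp_all add: sun_def add_tip_def tri_graph_def)

lemma fan_simps: "verts fan = {5, 4, 3, 0, 1, 2}"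
  "edges fan = {{5, 1}, {5, 3}, {4, 0}, {4, 1}, {3, 1}, {3, 2}, {0, 1}, {1, 2}, {0, 2}}"
  by (simp_all add: fan_def add_tip_def tri_graph_def)

lemma sun_in_A6: "sun \<in> \<A>6"
proof -
  have "two_tree (tri_graph 0 1 (2::nat))" by (simp add: two_tree.base triangle_tri_graph)
  then have "two_tree sun" unfolding sun_def
    by (intro two_tree_add_tip) (auto simp: add_tip_def tri_graph_def)
  then show ?thesis by (simp add: \<A>6_def two_tree_on_def sun_simps)
qed

lemma fan_in_A6: "fan \<in> \<A>6"
proof -
  have "two_tree (tri_graph 0 1 (2::nat))" by (simp add: two_tree.base triangle_tri_graph)
  then have "two_tree fan" unfolding fan_def
    by (intro two_tree_add_tip) (auto simp: add_tip_def tri_graph_def)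
  then show ?thesis by (simp add: \<A>6_def two_tree_on_def fan_simps)
qed

lemma sun_minor:
  assumes c: "conn G A" "conn G B" "conn G C" and sub: "A \<union> B \<union> C \<union> {r, s, t} \<subseteq> verts G"
    and d: "A \<inter> B = {}" "A \<inter> C = {}" "B \<inter> C = {}" "r \<notin> A \<union> B \<union> C" "s \<notin> A \<union> B \<union> C" "t \<notin> A \<union> B \<union> C"
      "r \<noteq> s" "r \<noteq> t" "s \<noteq> t"
    and t: "touches G A B" "touches G B C" "touches G A C" "touches G {r} A" "touches G {r} B"
      "touches G {s} B" "touches G {s} C" "touches G {t} A" "touches G {t} C"
  shows "minor sun G"
proof (rule minorI[where \<phi> = "(!) [A, B, C, {r}, {s}, {t}]"])
  let ?f = "(!) [A, B, C, {r}, {s}, {t}]"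
  fix x assume "x \<in> verts sun"
  then have x: "x = 0 \<or> x = 1 \<or> x = 2 \<or> x = 3 \<or> x = 4 \<or> x = 5" by (auto simp: sun_simps)
  show "?f x \<subseteq> verts G" using x sub by (elim disjE) simp_all
  show "conn G (?f x)" using x c by (elim disjE) simp_all
  fix y assume "y \<in> verts sun" "x \<noteq> y"
  then have "y = 0 \<or> y = 1 \<or> y = 2 \<or> y = 3 \<or> y = 4 \<or> y = 5" by (auto simp: sun_simps)
  then show "?f x \<inter> ?f y = {}"
    using x d \<open>x \<noteq> y\<close> by (elim disjE) (simp_all add: Int_commute)
next
  let ?f = "(!) [A, B, C, {r}, {s}, {t}]"
  have *: "\<And>x y. e = {x, y} \<Longrightarrow> touches G (?f x) (?f y) \<Longrightarrow> \<exists>x y. e = {x, y} \<and> touches G (?f x) (?f y)" for e by blast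
  fix e assume "e \<in> edges sun"
  then show "\<exists>x y. e = {x, y} \<and> touches G (?f x) (?f y)"
    unfolding sun_simps using t by (elim insertE emptyE) (rule *, assumption, simp)+
qed

lemma fan_minor:
  assumes sub: "{a, b, c, d, r, s} \<subseteq> verts G" and dist: "distinct [a, b, c, d, r, s]"
    and t: "{a, b} \<in> edges G" "{b, c} \<in> edges G" "{a, c} \<in> edges G" "{d, b} \<in> edges G" "{d, c} \<in> edges G"
      "{r, a} \<in> edges G" "{r, b} \<in> edges G" "{s, b} \<in> edges G" "{s, d} \<in> edges G"
  shows "minor fan G"
proof (rule minorI[where \<phi> = "(!) [{a}, {b}, {c}, {d}, {r}, {s}]"])
  let ?f = "(!) [{a}, {b}, {c}, {d}, {r}, {s}]"
  fix x assume "x \<in> verts fan"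
  then have x: "x = 0 \<or> x = 1 \<or> x = 2 \<or> x = 3 \<or> x = 4 \<or> x = 5" by (auto simp: fan_simps)
  show "?f x \<subseteq> verts G" using x sub by (elim disjE) simp_all
  show "conn G (?f x)" using x by (elim disjE) simp_all
  fix y assume "y \<in> verts fan" "x \<noteq> y"
  then have "y = 0 \<or> y = 1 \<or> y = 2 \<or> y = 3 \<or> y = 4 \<or> y = 5" by (auto simp: fan_simps)
  then show "?f x \<inter> ?f y = {}"
    using x dist \<open>x \<noteq> y\<close> by (elim disjE) simp_all
next
  let ?f = "(!) [{a}, {b}, {c}, {d}, {r}, {s}]"
  have *: "\<And>x y. e = {x, y} \<Longrightarrow> touches G (?f x) (?f y) \<Longrightarrow> \<exists>x y. e = {x, y} \<and> touches G (?f x) (?f y)" for e by blast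
  fix e assume "e \<in> edges fan"
  then show "\<exists>x y. e = {x, y} \<and> touches G (?f x) (?f y)"
    unfolding fan_simps using t by (elim insertE emptyE) (rule *, assumption, simp add: touches_def)+
qed

lemma walk_verts:
  assumes "simple_graph G" "walk G xs" "2 \<le> length xs"
  shows "set xs \<subseteq> verts G"
  using assms(2,3)
proof (induction xs)
  case (Cons x xs)
  then have e: "{x, hd xs} \<in> edges G" "walk G xs" "xs \<noteq> []" by (auto simp: walk_Cons)
  show ?case
  proof (cases "2 \<le> length xs")
    case True
    then show ?thesis using Cons.IH e edge_verts[OF assms(1) e(1)] by auto
  next
    case False
    then have "xs = [hd xs]" using e(3) by (cases xs) (auto simp: not_le numeral_2_eq_2)
    then show ?thesis using edge_verts[OF assms(1) e(1)] by (metis empty_set insert_subset list.set(2) list.simps(15) empty_subsetI)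
  qed
qed simp

text \<open>What remains of a minor-minimal dense graph: connected, every edge in a triangle, and free of
  the three members of \<open>\<A>\<close> that an obstacle to growth produces.\<close>

locale reduced =
  fixes C :: "'a sgraph"
  assumes simple: "simple_graph C" and connected: "conn C (verts C)"
    and in_triangle: "\<And>a b. {a, b} \<in> edges C \<Longrightarrow> \<exists>c. {a, c} \<in> edges C \<and> {b, c} \<in> edges C"
    and no_K4: "\<not> minor (complete_graph {..<4::nat}) C"
    and no_sun: "\<not> minor sun C" and no_fan: "\<not> minor fan C"
begin

lemma adj_sym: "{a, b} \<in> edges C \<Longrightarrow> {b, a} \<in> edges C"
  by (simp add: insert_commute)

lemma touch1: "{a, b} \<in> edges C \<Longrightarrow> a \<in> A \<Longrightarrow> b \<in> B \<Longrightarrow> touches C A B"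
  by (rule touchesI)

lemma touch2: "{a, b} \<in> edges C \<Longrightarrow> b \<in> A \<Longrightarrow> a \<in> B \<Longrightarrow> touches C A B"
  using touchesI[of b a C A B] adj_sym by blast

text \<open>If the two neighbours of \<open>y\<close> were not adjacent, a shortest path in \<open>T\<close> between
  them, closed up through \<open>y\<close>, would be a cycle of length at least four.  The edges of the path have
  tips in \<open>T\<close>, off the path since it is shortest.  A shared tip gives a complete graph on four
  vertices, three different tips give a sun; if the path has only two edges, the third
  tip is sought at an edge at \<open>y\<close>.\<close>

lemma outside_neighbours_adjacent:
  assumes Hs: "block_seq Hs" "glue Hs = induced C T" "T \<subseteq> verts C"
    and y: "y \<in> verts C - T" and u: "u \<in> T" "{u, y} \<in> edges C" and u': "u' \<in> T" "{u', y} \<in> edges C" "u \<noteq> u'"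
  shows "{u, u'} \<in> edges C"
proof (rule ccontr)
  assume na: "{u, u'} \<notin> edges C"
  let ?T = "induced C T"
  have sT: "simple_graph ?T" by (rule simple_graph_induced[OF simple Hs(3)])
  have "conn ?T T" using block_seq_conn[OF Hs(1)] Hs(2) by simp
  then have "conn C T" by (simp add: conn_induced)
  then have "reachable ?T u u'" using u(1) u'(1) by (simp add: conn_def graph_connected_def)
  then obtain xs where xs: "shortest_walk ?T xs" "hd xs = u" "last xs = u'" by (rule shortest_walk_exists)
  have wk: "walk ?T xs" using xs(1) by (simp add: shortest_walk_def)
  have "xs \<noteq> []" using wk by (simp add: walk_def)
  then obtain p0 xs1 where x1: "xs = p0 # xs1" by (cases xs) auto
  have "xs1 \<noteq> []" using x1 xs u'(3) by auto
  then obtain p1 xs2 where x2: "xs1 = p1 # xs2" by (cases xs1) auto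
  have "xs2 \<noteq> []"
  proof
    assume "xs2 = []"
    then have "{u, u'} \<in> edges ?T" using wk x1 x2 xs by (simp add: walk_def)
    then show False using na by simp
  qed
  then obtain p2 rest where x3: "xs2 = p2 # rest" by (cases xs2) auto
  have X: "xs = p0 # p1 # p2 # rest" using x1 x2 x3 by simp
  have p0: "p0 = u" using xs(2) X by simp
  have lst: "last (p2 # rest) = u'" using xs(3) X by simp
  have XT: "set xs \<subseteq> T" using walk_verts[OF sT wk] X by simp
  then have pT: "p0 \<in> T" "p1 \<in> T" "p2 \<in> T" "set rest \<subseteq> T" using X by auto
  have dist: "distinct xs" by (rule shortest_walk_distinct[OF xs(1)])
  have e01: "{p0, p1} \<in> edges ?T" and e12: "{p1, p2} \<in> edges ?T" and wr: "walk ?T (p2 # rest)"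
    using wk unfolding X by (auto simp: walk_def)
  have CT: "e \<in> edges C" if "e \<in> edges ?T" for e using that by simp
  have n02: "{p0, p2} \<notin> edges ?T"
  proof
    assume "{p0, p2} \<in> edges ?T"
    then show False using shortest_walk_no_shortcut[of ?T "[]" p0 "[p1]" p2 rest "[]"] xs(1) X by (simp add: walk_def)
  qed
  have far0: "{p0, z} \<notin> edges ?T" if "z \<in> set rest" for z
  proof
    assume e: "{p0, z} \<in> edges ?T"
    obtain bs cs where "rest = bs @ z # cs" using \<open>z \<in> set rest\<close> split_list by metis
    then show False using shortest_walk_no_shortcut[of ?T "[]" p0 "p1 # p2 # bs" z cs "[]"] xs(1) X e by (simp add: walk_def)
  qed
  have far1: "{p1, z} \<notin> edges ?T" if "z \<in> set rest" for z
  proof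
    assume e: "{p1, z} \<in> edges ?T"
    obtain bs cs where "rest = bs @ z # cs" using \<open>z \<in> set rest\<close> split_list by metis
    then show False using shortest_walk_no_shortcut[of ?T "[p0]" p1 "p2 # bs" z cs "[]"] xs(1) X e by (simp add: walk_def)
  qed
  obtain w0 where w0: "{p0, w0} \<in> edges ?T" "{p1, w0} \<in> edges ?T"
    using block_seq_edge_in_triangle[OF Hs(1)] e01 Hs(2) by metis
  obtain w1 where w1: "{p1, w1} \<in> edges ?T" "{p2, w1} \<in> edges ?T"
    using block_seq_edge_in_triangle[OF Hs(1)] e12 Hs(2) by metis
  have w0T: "w0 \<in> T" and w1T: "w1 \<in> T" using w0 w1 by auto
  have w0x: "w0 \<notin> set xs"
    using w0 n02 far0 edge_neq[OF sT w0(1)] edge_neq[OF sT w0(2)] unfolding X by auto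
  have w1x: "w1 \<notin> set xs"
    using w1 n02 far1 edge_neq[OF sT w1(1)] edge_neq[OF sT w1(2)] unfolding X by (auto simp: insert_commute)
  have yT: "y \<notin> T" "y \<in> verts C" using y by auto
  have cr: "conn C (set (p2 # rest) \<union> {y})"
  proof -
    have "conn C (set (p2 # rest))" by (rule conn_mono_edges[OF conn_walk[OF wr]]) auto
    then show ?thesis using conn_insert[of C "set (p2 # rest)" y u'] lst last_in_set[of "p2 # rest"] adj_sym[OF u'(2)]
      by (simp add: insert_commute)
  qed
  \<comment> \<open>A common tip, the two inner vertices and the rest of the cycle would be a complete graph.\<close>
  have ne01: "w0 \<noteq> w1"
  proof
    assume w: "w0 = w1"
    have "minor (complete_graph {..<4::nat}) C"
    proof (rule K4_minor[of C "{w0}" "{p1}" "{p0}" "set (p2 # rest) \<union> {y}"])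
      show "conn C (set (p2 # rest) \<union> {y})" by (rule cr)
      show "{w0} \<union> {p1} \<union> {p0} \<union> (set (p2 # rest) \<union> {y}) \<subseteq> verts C" using w0T pT yT Hs(3) by auto
      show "touches C {w0} {p1}" by (rule touch2[OF CT[OF w0(2)]]) auto
      show "touches C {w0} {p0}" by (rule touch2[OF CT[OF w0(1)]]) auto
      show "touches C {w0} (set (p2 # rest) \<union> {y})" by (rule touch2[OF CT[OF w1(2)]]) (use w in auto)
      show "touches C {p1} {p0}" by (rule touch2[OF CT[OF e01]]) auto
      show "touches C {p1} (set (p2 # rest) \<union> {y})" by (rule touch1[OF CT[OF e12]]) auto
      show "touches C {p0} (set (p2 # rest) \<union> {y})" by (rule touch1[OF u(2)]) (use p0 in auto)
    qed (use w0x w0T yT pT dist X in auto)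
    then show False using no_K4 by simp
  qed
  show False
  proof (cases rest)
    case (Cons p3 rest')
    have e23: "{p2, p3} \<in> edges ?T" and wr': "walk ?T rest" using wr Cons by (auto simp: walk_def)
    obtain w2 where w2: "{p2, w2} \<in> edges ?T" "{p3, w2} \<in> edges ?T"
      using block_seq_edge_in_triangle[OF Hs(1)] e23 Hs(2) by metis
    have w2T: "w2 \<in> T" using w2 by auto
    have far2: "{p2, z} \<notin> edges ?T" if "z \<in> set rest'" for z
    proof
      assume e: "{p2, z} \<in> edges ?T"
      obtain bs cs where "rest' = bs @ z # cs" using \<open>z \<in> set rest'\<close> split_list by metis
      then show False using shortest_walk_no_shortcut[of ?T "[p0, p1]" p2 "p3 # bs" z cs "[]"] xs(1) X Cons e by (simp add: walk_def)
    qed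
    have n13: "{p1, p3} \<notin> edges ?T" using far1 Cons by simp
    have w2x: "w2 \<notin> set xs"
      using w2 n02 n13 far2 edge_neq[OF sT w2(1)] edge_neq[OF sT w2(2)] unfolding X Cons by (auto simp: insert_commute)
    have ne02: "w0 \<noteq> w2"
    proof
      assume "w0 = w2"
      then have "walk ?T (p0 # [w0] @ [p3])" using w0 w2 by (simp add: walk_def insert_commute)
      then show False using shortest_walk_no_shortcut[of ?T "[]" p0 "[p1, p2]" p3 rest' "[w0]"] xs(1) X Cons by simp
    qed
    have cA: "conn C (set rest \<union> {y, p0})"
    proof -
      have cr': "conn C (set rest)" by (rule conn_mono_edges[OF conn_walk[OF wr']]) auto
      moreover have "u' \<in> set rest" using lst Cons by (metis last_ConsR last_in_set list.discI)
      ultimately have "conn C (insert y (set rest))" using conn_insert[OF cr' adj_sym[OF u'(2)]] by simp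
      then show ?thesis using conn_insert[of C "insert y (set rest)" p0 y] u(2) p0 by (simp add: insert_commute)
    qed
    have ne12: "w1 \<noteq> w2"
    proof
      assume w: "w1 = w2"
      have "minor (complete_graph {..<4::nat}) C"
      proof (rule K4_minor[of C "{w1}" "{p2}" "{p1}" "set rest \<union> {y, p0}"])
        show "conn C (set rest \<union> {y, p0})" by (rule cA)
        show "{w1} \<union> {p2} \<union> {p1} \<union> (set rest \<union> {y, p0}) \<subseteq> verts C" using w1T pT yT Hs(3) by auto
        show "touches C {w1} {p2}" by (rule touch2[OF CT[OF w1(2)]]) auto
        show "touches C {w1} {p1}" by (rule touch2[OF CT[OF w1(1)]]) auto
        show "touches C {w1} (set rest \<union> {y, p0})" by (rule touch2[OF CT[OF w2(2)]]) (use w Cons in auto)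
        show "touches C {p2} {p1}" by (rule touch2[OF CT[OF e12]]) auto
        show "touches C {p2} (set rest \<union> {y, p0})" by (rule touch1[OF CT[OF e23]]) (use Cons in auto)
        show "touches C {p1} (set rest \<union> {y, p0})" by (rule touch2[OF CT[OF e01]]) auto
      qed (use w1x w1T yT pT dist X in auto)
      then show False using no_K4 by simp
    qed
    have "minor sun C"
    proof (rule sun_minor[of C "set rest \<union> {y, p0}" "{p1}" "{p2}" w0 w1 w2])
      show "conn C (set rest \<union> {y, p0})" by (rule cA)
      show "set rest \<union> {y, p0} \<union> {p1} \<union> {p2} \<union> {w0, w1, w2} \<subseteq> verts C" using w0T w1T w2T pT yT Hs(3) by auto
      show "w0 \<noteq> w1" "w0 \<noteq> w2" "w1 \<noteq> w2" by fact+
      show "touches C (set rest \<union> {y, p0}) {p1}" by (rule touch1[OF CT[OF e01]]) auto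
      show "touches C {p1} {p2}" by (rule touch1[OF CT[OF e12]]) auto
      show "touches C (set rest \<union> {y, p0}) {p2}" by (rule touch2[OF CT[OF e23]]) (use Cons in auto)
      show "touches C {w0} (set rest \<union> {y, p0})" by (rule touch2[OF CT[OF w0(1)]]) auto
      show "touches C {w0} {p1}" by (rule touch2[OF CT[OF w0(2)]]) auto
      show "touches C {w1} {p1}" by (rule touch2[OF CT[OF w1(1)]]) auto
      show "touches C {w1} {p2}" by (rule touch2[OF CT[OF w1(2)]]) auto
      show "touches C {w2} (set rest \<union> {y, p0})" by (rule touch2[OF CT[OF w2(2)]]) (use Cons in auto)
      show "touches C {w2} {p2}" by (rule touch2[OF CT[OF w2(1)]]) auto
    qed (use w0x w1x w2x w0T w1T w2T yT pT dist X in auto)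
    then show False using no_sun by simp
  next
    case Nil
    then have p2: "p2 = u'" using lst by simp
    have y0: "{p0, y} \<in> edges C" and y2: "{p2, y} \<in> edges C" using u(2) u'(2) p0 p2 by auto
    show False
    proof (cases "{p1, y} \<in> edges C")
      case True
      have "minor fan C"
        by (rule fan_minor[of p0 p1 y p2 w0 w1])
           (use True y0 y2 CT[OF e01] CT[OF e12] CT[OF w0(1)] CT[OF w0(2)] CT[OF w1(1)] CT[OF w1(2)]
             w0x w1x w0T w1T yT pT dist X ne01 Hs(3) in \<open>auto simp: insert_commute\<close>)
      then show False using no_fan by simp
    next
      case False
      obtain t where t: "{p0, t} \<in> edges C" "{y, t} \<in> edges C" using in_triangle[OF y0] by blast
      have tv: "t \<in> verts C" using edge_verts[OF simple t(1)] by simp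
      have t_ne: "t \<noteq> p0" "t \<noteq> y" "t \<noteq> p1" "t \<noteq> p2"
        using edge_neq[OF simple t(1)] edge_neq[OF simple t(2)] t False n02 pT by (auto simp: insert_commute)
      have c2: "conn C {p1, p2}" by (rule conn_doubleton[OF CT[OF e12]])
      have K: "t \<noteq> w" if w: "w \<in> T" "w \<notin> set xs" "{p1, w} \<in> edges ?T" for w
      proof
        assume tw: "t = w"
        have "minor (complete_graph {..<4::nat}) C"
        proof (rule K4_minor[of C "{w}" "{p0}" "{y}" "{p1, p2}"])
          show "conn C {p1, p2}" by (rule c2)
          show "{w} \<union> {p0} \<union> {y} \<union> {p1, p2} \<subseteq> verts C" using w pT yT Hs(3) by auto
          show "touches C {w} {p0}" by (rule touch2[OF t(1)]) (use tw in auto)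
          show "touches C {w} {y}" by (rule touch2[OF t(2)]) (use tw in auto)
          show "touches C {w} {p1, p2}" by (rule touch2[OF CT[OF w(3)]]) auto
          show "touches C {p0} {y}" by (rule touch1[OF y0]) auto
          show "touches C {p0} {p1, p2}" by (rule touch1[OF CT[OF e01]]) auto
          show "touches C {y} {p1, p2}" by (rule touch2[OF y2]) auto
        qed (use w yT pT dist X in auto)
        then show False using no_K4 by simp
      qed
      have tw: "t \<noteq> w0" "t \<noteq> w1" using K[OF w0T w0x w0(2)] K[OF w1T w1x w1(1)] by auto
      have "minor sun C"
      proof (rule sun_minor[of C "{p0}" "{p1}" "{p2, y}" w0 w1 t])
        show "conn C {p2, y}" by (rule conn_doubleton[OF y2])
        show "{p0} \<union> {p1} \<union> {p2, y} \<union> {w0, w1, t} \<subseteq> verts C" using w0T w1T tv pT yT Hs(3) by auto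
        show "w0 \<noteq> w1" "w0 \<noteq> t" "w1 \<noteq> t" using ne01 tw by auto
        show "touches C {p0} {p1}" by (rule touch1[OF CT[OF e01]]) auto
        show "touches C {p1} {p2, y}" by (rule touch1[OF CT[OF e12]]) auto
        show "touches C {p0} {p2, y}" by (rule touch1[OF y0]) auto
        show "touches C {w0} {p0}" by (rule touch2[OF CT[OF w0(1)]]) auto
        show "touches C {w0} {p1}" by (rule touch2[OF CT[OF w0(2)]]) auto
        show "touches C {w1} {p1}" by (rule touch2[OF CT[OF w1(1)]]) auto
        show "touches C {w1} {p2, y}" by (rule touch2[OF CT[OF w1(2)]]) auto
        show "touches C {t} {p0}" by (rule touch2[OF t(1)]) auto
        show "touches C {t} {p2, y}" by (rule touch2[OF t(2)]) auto
      qed (use w0x w1x t_ne w0T w1T yT pT dist X in auto)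
      then show False using no_sun by simp
    qed
  qed
qed

text \<open>The neighbours in \<open>T\<close> of an outside vertex form a clique, so if there are two they are the ends of one edge, and
  the vertex becomes a tip.  If no outside vertex has two neighbours in \<open>T\<close>, then the triangle
  on an edge leaving \<open>T\<close> can be attached as a new part.  In both cases the larger subgraph is again induced.\<close>

lemma enlarge:
  assumes Hs: "block_seq Hs" "glue Hs = induced C T" "T \<subset> verts C"
  obtains T' Hs' where "T \<subset> T'" "T' \<subseteq> verts C" "block_seq Hs'" "glue Hs' = induced C T'"
    "sizes Hs' = add_mset 3 (sizes Hs) \<or> (\<exists>m M. sizes Hs = add_mset m M \<and> sizes Hs' = add_mset (Suc m) M)"
proof (cases "\<exists>y\<in>verts C - T. \<exists>a\<in>T. \<exists>b\<in>T. a \<noteq> b \<and> {a, y} \<in> edges C \<and> {b, y} \<in> edges C")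
  case True
  then obtain y a b where y: "y \<in> verts C - T" and ab: "a \<in> T" "b \<in> T" "a \<noteq> b" "{a, y} \<in> edges C" "{b, y} \<in> edges C"
    by blast
  have TC: "T \<subseteq> verts C" using Hs by auto
  note adj = outside_neighbours_adjacent[OF Hs(1,2) TC y]
  have e: "{a, b} \<in> edges C" by (rule adj) (use ab in auto)
  have only: "c = a \<or> c = b" if c: "c \<in> T" "{c, y} \<in> edges C" for c
  proof (rule ccontr)
    assume n: "\<not> (c = a \<or> c = b)"
    have "{a, c} \<in> edges C" "{b, c} \<in> edges C" using adj ab c n by blast+
    then have "minor (complete_graph {..<4::nat}) C"
      using ab c y TC e n by (intro K4_minor[of C "{a}" "{b}" "{c}" "{y}"]) (auto simp: touches_def)
    then show False using no_K4 by simp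
  qed
  have "{a, b} \<in> edges (glue Hs)" using e ab Hs(2) by simp
  then obtain H where H: "H \<in> set Hs" "{a, b} \<in> edges H" by (auto simp: glue_def)
  obtain As Bs where AB: "Hs = As @ H # Bs" using H(1) split_list by metis
  have gv: "verts (glue Hs) = T" using Hs(2) by simp
  have yH: "y \<notin> verts H" using glue_member(1)[OF H(1)] gv y by auto
  have tt: "two_tree H" by (rule block_seq_two_tree[OF Hs(1) H(1)])
  let ?H' = "add_tip H y a b"
  have bs: "block_seq (As @ ?H' # Bs)"
  proof (rule block_seq_grow_part[of As H Bs])
    show "block_seq (As @ H # Bs)" using Hs(1) AB by simp
    show "two_tree ?H'" by (rule two_tree_add_tip[OF tt yH H(2) two_tree_card(1)[OF tt]])
    show "verts ?H' = insert y (verts H)" by (simp add: add_tip_def)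
    show "y \<notin> verts (glue (As @ H # Bs))" using gv AB y by simp
  qed
  have ev: "edges (glue (As @ ?H' # Bs)) = insert {y, a} (insert {y, b} (edges (glue Hs)))"
    using AB by (auto simp: add_tip_def)
  have eh: "{e \<in> edges C. e \<subseteq> insert y T} = insert {y, a} (insert {y, b} {e \<in> edges C. e \<subseteq> T})"
  proof (intro equalityI subsetI)
    fix e assume e: "e \<in> {e \<in> edges C. e \<subseteq> insert y T}"
    show "e \<in> insert {y, a} (insert {y, b} {e \<in> edges C. e \<subseteq> T})"
    proof (cases "y \<in> e")
      case True
      then obtain c where c: "e = {c, y}" "c \<noteq> y"
        using edgeE[OF simple, of e] e by (metis (no_types, lifting) insertE insert_commute mem_Collect_eq singletonD)
      then show ?thesis using only[of c] e by (auto simp: insert_commute)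
    qed (use e in auto)
  qed (use ab adj_sym in \<open>auto simp: insert_commute\<close>)
  have "glue (As @ ?H' # Bs) = induced C (insert y T)"
  proof (rule prod_eqI)
    show "verts (glue (As @ ?H' # Bs)) = verts (induced C (insert y T))"
      using gv AB by (auto simp: add_tip_def)
    show "edges (glue (As @ ?H' # Bs)) = edges (induced C (insert y T))"
      unfolding ev Hs(2) edges_induced eh ..
  qed
  moreover have "sizes Hs = add_mset (card (verts H)) (sizes As + sizes Bs)" using AB by simp
  moreover have "sizes (As @ ?H' # Bs) = add_mset (Suc (card (verts H))) (sizes As + sizes Bs)"
    using yH finite_verts[OF two_tree_simple[OF tt]] by (simp add: add_tip_def)
  ultimately show ?thesis using bs y TC by (intro that[of "insert y T" "As @ ?H' # Bs"]) auto
next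
  case False
  have TC: "T \<subseteq> verts C" using Hs by auto
  have gv: "verts (glue Hs) = T" using Hs(2) by simp
  have neT: "T \<noteq> {}" using conn_nonempty[OF block_seq_conn[OF Hs(1)]] gv by simp
  have "touches C T (verts C - T)" by (rule connD[OF connected TC neT]) (use Hs in auto)
  then obtain x y where xy: "x \<in> T" "y \<in> verts C - T" "{x, y} \<in> edges C" by (rule touchesE)
  obtain z where z: "{x, z} \<in> edges C" "{y, z} \<in> edges C" using in_triangle[OF xy(3)] by blast
  have ne: "x \<noteq> z" "y \<noteq> z" "x \<noteq> y" using edge_neq[OF simple] z xy(3) by blast+
  have zv: "z \<in> verts C" using edge_verts[OF simple z(1)] by simp
  have zT: "z \<notin> T" using False xy z ne adj_sym by blast
  have only_y: "c = x" if "c \<in> T" "{c, y} \<in> edges C" for c using False xy that by blast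
  have only_z: "c = x" if "c \<in> T" "{c, z} \<in> edges C" for c using False xy(1) z(1) zv zT that by blast
  let ?H = "tri_graph x y z"
  have "two_tree ?H" by (rule two_tree.base[OF triangle_tri_graph]) (use ne in auto)
  moreover have "verts ?H \<inter> verts (glue Hs) = {x}" using gv xy zT by (auto simp: tri_graph_def)
  ultimately have bs: "block_seq (?H # Hs)" using Hs(1) by auto
  have eh: "{e \<in> edges C. e \<subseteq> T \<union> {y, z}} = {{x, y}, {y, z}, {x, z}} \<union> {e \<in> edges C. e \<subseteq> T}"
  proof (intro equalityI subsetI)
    fix e assume e: "e \<in> {e \<in> edges C. e \<subseteq> T \<union> {y, z}}"
    have eC: "e \<in> edges C" using e by simp
    obtain c d where cd: "e = {c, d}" "c \<noteq> d" using edgeE[OF simple eC] by metis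
    have main: "{c, d} \<in> {{x, y}, {y, z}, {x, z}}" if "c \<in> T \<union> {y, z}" "d \<in> {y, z}" "{c, d} \<in> edges C" "c \<noteq> d" for c d
      using that only_y[of c] only_z[of c] by (auto simp: insert_commute)
    consider "c \<in> T" "d \<in> T" | "d \<in> {y, z}" | "c \<in> {y, z}" using e cd by auto
    then show "e \<in> {{x, y}, {y, z}, {x, z}} \<union> {e \<in> edges C. e \<subseteq> T}"
    proof cases
      case 1
      then show ?thesis using e cd by auto
    next
      case 2
      have "{c, d} \<in> {{x, y}, {y, z}, {x, z}}" by (rule main) (use 2 e cd in auto)
      then show ?thesis using cd by blast
    next
      case 3
      have "{d, c} \<in> {{x, y}, {y, z}, {x, z}}" by (rule main) (use 3 e cd in \<open>auto simp: insert_commute\<close>)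
      moreover have "e = {d, c}" using cd(1) by auto
      ultimately show ?thesis by blast
    qed
  qed (use xy z in auto)
  have "glue (?H # Hs) = induced C (T \<union> {y, z})"
  proof (rule prod_eqI)
    show "verts (glue (?H # Hs)) = verts (induced C (T \<union> {y, z}))"
      using gv xy by (auto simp: tri_graph_def)
    show "edges (glue (?H # Hs)) = edges (induced C (T \<union> {y, z}))"
      unfolding edges_induced eh using Hs(2) by (simp add: tri_graph_def)
  qed
  moreover have "sizes (?H # Hs) = add_mset 3 (sizes Hs)" using ne by (simp add: tri_graph_def)
  ultimately show ?thesis using bs xy zv TC by (intro that[of "T \<union> {y, z}" "?H # Hs"]) auto
qed

lemma seed:
  assumes "edges C \<noteq> {}"
  obtains T Hs where "T \<subseteq> verts C" "block_seq Hs" "glue Hs = induced C T" "sizes Hs = {#3#}"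
proof -
  obtain e where e: "e \<in> edges C" using assms by blast
  then obtain x y where xy: "{x, y} \<in> edges C" using edgeE[OF simple e] by metis
  obtain z where z: "{x, z} \<in> edges C" "{y, z} \<in> edges C" using in_triangle[OF xy] by blast
  have ne: "x \<noteq> z" "y \<noteq> z" "x \<noteq> y" using edge_neq[OF simple] z xy by blast+
  have v: "{x, y, z} \<subseteq> verts C" using edge_verts[OF simple xy] edge_verts[OF simple z(1)] by simp
  have "glue [tri_graph x y z] = induced C {x, y, z}"
  proof (rule prod_eqI)
    have "e \<in> {{x, y}, {y, z}, {x, z}}" if e: "e \<in> edges C" "e \<subseteq> {x, y, z}" for e
      using edgeE[OF simple e(1)] e(2) by (smt (verit) doubleton_eq_iff insert_iff insert_subset empty_iff)
    then show "edges (glue [tri_graph x y z]) = edges (induced C {x, y, z})"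
      using xy z by (auto simp: tri_graph_def)
  qed (simp add: tri_graph_def)
  moreover have "block_seq [tri_graph x y z]" using ne by (simp add: two_tree.base triangle_tri_graph)
  ultimately show ?thesis using that[of "{x, y, z}" "[tri_graph x y z]"] v ne by (simp add: tri_graph_def)
qed

end

subsection \<open>Part sizes and the number of triangles\<close>

text \<open>With the excess of a part being its size minus \<open>3\<close>, the small shapes are those of total excess at most
  \<open>2\<close>, and the large ones those of total excess exactly \<open>3\<close>.  Up to triangles these are the part sizes of
  the families \<open>\<E>1\<close> to \<open>\<E>4\<close>, and of \<open>\<A>6\<close>, \<open>\<A>8\<close> and \<open>\<A>10\<close>.\<close>

definition small_shape :: "nat multiset \<Rightarrow> bool" where
  "small_shape M \<longleftrightarrow> (\<exists>n. 1 \<le> n \<and> M = replicate_mset n 3 \<or>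
     M = {#4#} + replicate_mset n 3 \<or> M = {#5#} + replicate_mset n 3 \<or> M = {#4, 4#} + replicate_mset n 3)"

definition large_shape :: "nat multiset \<Rightarrow> bool" where
  "large_shape M \<longleftrightarrow> (\<exists>n. M = {#6#} + replicate_mset n 3 \<or> M = {#5, 4#} + replicate_mset n 3 \<or>
     M = {#4, 4, 4#} + replicate_mset n 3)"

text \<open>One enlargement raises the total excess by at most one.\<close>

lemma shape_step:
  assumes M: "small_shape M" and M': "M' = add_mset 3 M \<or> (\<exists>m N. M = add_mset m N \<and> M' = add_mset (Suc m) N)"
  shows "small_shape M' \<or> large_shape M'"
proof -
  obtain n where n: "1 \<le> n \<and> M = replicate_mset n 3 \<or>
     M = {#4#} + replicate_mset n 3 \<or> M = {#5#} + replicate_mset n 3 \<or> M = {#4, 4#} + replicate_mset n 3"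
    using M unfolding small_shape_def by blast
  from M' show ?thesis
  proof
    assume "M' = add_mset 3 M"
    then have "small_shape M'" unfolding small_shape_def using n by (intro exI[of _ "Suc n"]) auto
    then show ?thesis ..
  next
    assume "\<exists>m N. M = add_mset m N \<and> M' = add_mset (Suc m) N"
    then obtain m N where mN: "M = add_mset m N" "M' = add_mset (Suc m) N" by blast
    then have m: "m \<in># M" "M' = add_mset (Suc m) (M - {#m#})" by simp_all
    have sm: "small_shape ({#4#} + replicate_mset k 3)" "small_shape ({#5#} + replicate_mset k 3)"
      "small_shape ({#4, 4#} + replicate_mset k 3)" for k
      unfolding small_shape_def by blast+
    have lg: "large_shape ({#6#} + replicate_mset k 3)" "large_shape ({#5, 4#} + replicate_mset k 3)"
      "large_shape ({#4, 4, 4#} + replicate_mset k 3)" for k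
      unfolding large_shape_def by blast+
    consider "M = replicate_mset n 3" | "M = {#4#} + replicate_mset n 3"
      | "M = {#5#} + replicate_mset n 3" | "M = {#4, 4#} + replicate_mset n 3" using n by blast
    then show ?thesis
    proof cases
      case 1
      then have "m = 3" "n \<noteq> 0" using m(1) by (auto split: if_splits)
      then obtain k where "n = Suc k" by (cases n) auto
      then have "M' = {#4#} + replicate_mset k 3" using m(2) 1 \<open>m = 3\<close> by simp
      then show ?thesis using sm by simp
    next
      case 2
      show ?thesis
      proof (cases "m = 4")
        case True
        then have "M' = {#5#} + replicate_mset n 3" using m(2) 2 by simp
        then show ?thesis using sm by simp
      next
        case False
        then have "m = 3" "n \<noteq> 0" using m(1) 2 by (auto split: if_splits)
        then obtain k where "n = Suc k" by (cases n) auto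
        then have "M' = {#4, 4#} + replicate_mset k 3" using m(2) 2 \<open>m = 3\<close> by simp
        then show ?thesis using sm by simp
      qed
    next
      case 3
      show ?thesis
      proof (cases "m = 5")
        case True
        then have "M' = {#6#} + replicate_mset n 3" using m(2) 3 by simp
        then show ?thesis using lg by simp
      next
        case False
        then have "m = 3" "n \<noteq> 0" using m(1) 3 by (auto split: if_splits)
        then obtain k where "n = Suc k" by (cases n) auto
        then have "M' = {#5, 4#} + replicate_mset k 3" using m(2) 3 \<open>m = 3\<close> by (simp add: add_mset_commute)
        then show ?thesis using lg by simp
      qed
    next
      case 4
      show ?thesis
      proof (cases "m = 4")
        case True
        then have "M' = {#5, 4#} + replicate_mset n 3" using m(2) 4 by simp
        then show ?thesis using lg by simp
      next
        case False
        then have "m = 3" "n \<noteq> 0" using m(1) 4 by (auto split: if_splits)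
        then obtain k where "n = Suc k" by (cases n) auto
        then have "M' = {#4, 4, 4#} + replicate_mset k 3" using m(2) 4 \<open>m = 3\<close> by simp
        then show ?thesis using lg by simp
      qed
    qed
  qed
qed

lemma large_shape_target:
  fixes Hs :: "nat sgraph list"
  assumes "block_seq Hs" "large_shape (sizes Hs)"
  shows "\<exists>A\<in>\<A>. minor A (glue Hs)"
proof -
  obtain n where n: "sizes Hs = {#6#} + replicate_mset n 3 \<or> sizes Hs = {#5, 4#} + replicate_mset n 3 \<or>
     sizes Hs = {#4, 4, 4#} + replicate_mset n 3" using assms(2) unfolding large_shape_def by blast
  have *: "\<exists>Hs' :: nat sgraph list. block_seq Hs' \<and> sizes Hs' = M \<and> minor (glue Hs') (glue Hs)"
    if "sizes Hs = M + replicate_mset n 3" "M \<noteq> {#}" for M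
    using collapse_triangles[OF assms(1) that] .
  from n consider "sizes Hs = {#6#} + replicate_mset n 3" | "sizes Hs = {#5, 4#} + replicate_mset n 3"
    | "sizes Hs = {#4, 4, 4#} + replicate_mset n 3" by blast
  then show ?thesis
  proof cases
    case 1
    then obtain Hs' :: "nat sgraph list" where h: "block_seq Hs'" "sizes Hs' = {#6#}" "minor (glue Hs') (glue Hs)"
      using *[OF 1] by auto
    then show ?thesis using glue_A6[OF h(1,2)] unfolding \<A>_def by blast
  next
    case 2
    then obtain Hs' :: "nat sgraph list" where h: "block_seq Hs'" "sizes Hs' = {#5, 4#}" "minor (glue Hs') (glue Hs)"
      using *[OF 2] by auto
    then show ?thesis using glue_A8[OF h(1,2)] unfolding \<A>_def by blast
  next
    case 3
    then obtain Hs' :: "nat sgraph list" where h: "block_seq Hs'" "sizes Hs' = {#4, 4, 4#}" "minor (glue Hs') (glue Hs)"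
      using *[OF 3] by auto
    then show ?thesis using glue_A10[OF h(1,2)] unfolding \<A>_def by blast
  qed
qed

text \<open>\<open>\<beta>\<close> is the least number of triangles, at least \<open>b\<close>, for which the count exceeds density \<open>\<delta>\<close>.\<close>

lemma beta_le:
  assumes "\<delta> < 3 / 2" "b \<le> n" "\<delta> * c - a < real n * (3 - 2 * \<delta>)"
  shows "\<beta> b a c \<delta> \<le> n"
proof -
  have "(\<delta> * c - a) / (3 - 2 * \<delta>) < real n" using assms by (simp add: divide_less_eq)
  then have "\<lfloor>(\<delta> * c - a) / (3 - 2 * \<delta>)\<rfloor> < int n" by (simp add: floor_less_iff)
  then show ?thesis using assms(2) by (simp add: \<beta>_def)
qed

lemma beta_ge: "b \<le> \<beta> b a c \<delta>"
  by (simp add: \<beta>_def nat_le_iff le_nat_iff)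

text \<open>With \<open>n\<close> parts and total size \<open>s\<close> a tree of two-trees has \<open>s - n + 1\<close> vertices and \<open>2 s - 3 n\<close> edges, so
  exceeding density \<open>\<delta>\<close> bounds the number of triangles from below by \<open>\<beta>\<close>; surplus triangles collapse.\<close>

lemma small_shape_target:
  fixes Hs :: "nat sgraph list" and \<delta> :: real
  assumes Hs: "block_seq Hs" "small_shape (sizes Hs)" and \<delta>: "\<delta> < 3 / 2"
    and dense: "\<delta> * real (card (verts (glue Hs))) < real (card (edges (glue Hs)))"
  shows "\<exists>A\<in>\<U> \<delta>. minor A (glue Hs)"
proof -
  have len: "length Hs = size (sizes Hs)" by (simp add: sizes_def)
  obtain n where n: "1 \<le> n \<and> sizes Hs = replicate_mset n 3 \<or>
     sizes Hs = {#4#} + replicate_mset n 3 \<or> sizes Hs = {#5#} + replicate_mset n 3 \<or>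
     sizes Hs = {#4, 4#} + replicate_mset n 3" using Hs(2) unfolding small_shape_def by blast
  have rep: "replicate_mset n 3 = replicate_mset k 3 + replicate_mset (n - k) (3::nat)" if "k \<le> n" for k
    using that by (intro multiset_eqI) simp
  have collapse: "\<exists>Hs' :: nat sgraph list. block_seq Hs' \<and> sizes Hs' = M + replicate_mset k 3 \<and> minor (glue Hs') (glue Hs)"
    if "sizes Hs = M + replicate_mset n 3" "k \<le> n" "M + replicate_mset k 3 \<noteq> {#}" for M k
    using collapse_triangles[OF Hs(1), of "M + replicate_mset k 3" "n - k"] that rep by (metis add.assoc)
  note cnt = block_seq_card[OF Hs(1)]
  from n consider "1 \<le> n" "sizes Hs = {#} + replicate_mset n 3" | "sizes Hs = {#4#} + replicate_mset n 3"
    | "sizes Hs = {#5#} + replicate_mset n 3" | "sizes Hs = {#4, 4#} + replicate_mset n 3" by auto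
  then show ?thesis
  proof cases
    case 1
    have "card (verts (glue Hs)) = 1 + 2 * n" "card (edges (glue Hs)) = 3 * n" using cnt len 1 by simp_all
    then have "\<delta> * 1 - 0 < real n * (3 - 2 * \<delta>)" using dense by (simp add: algebra_simps)
    then have "\<beta> 1 0 1 \<delta> \<le> n" by (rule beta_le[OF \<delta> 1(1)])
    moreover have "1 \<le> \<beta> 1 0 1 \<delta>" by (rule beta_ge)
    ultimately obtain Hs' :: "nat sgraph list" where "block_seq Hs'" "sizes Hs' = replicate_mset (\<beta> 1 0 1 \<delta>) 3" "minor (glue Hs') (glue Hs)"
      using collapse[OF 1(2), of "\<beta> 1 0 1 \<delta>"] by (auto simp: not_le)
    then show ?thesis using glue_E1 unfolding \<U>_def by blast
  next
    case 2
    have "card (verts (glue Hs)) = 4 + 2 * n" "card (edges (glue Hs)) = 5 + 3 * n" using cnt len 2 by simp_all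
    then have "\<delta> * 4 - 5 < real n * (3 - 2 * \<delta>)" using dense by (simp add: algebra_simps)
    then have "\<beta> 0 5 4 \<delta> \<le> n" by (intro beta_le[OF \<delta>]) simp_all
    then obtain Hs' :: "nat sgraph list" where "block_seq Hs'" "sizes Hs' = add_mset 4 (replicate_mset (\<beta> 0 5 4 \<delta>) 3)" "minor (glue Hs') (glue Hs)"
      using collapse[OF 2, of "\<beta> 0 5 4 \<delta>"] by auto
    then show ?thesis using glue_E2 unfolding \<U>_def by blast
  next
    case 3
    have "card (verts (glue Hs)) = 5 + 2 * n" "card (edges (glue Hs)) = 7 + 3 * n" using cnt len 3 by simp_all
    then have "\<delta> * 5 - 7 < real n * (3 - 2 * \<delta>)" using dense by (simp add: algebra_simps)
    then have "\<beta> 0 7 5 \<delta> \<le> n" by (intro beta_le[OF \<delta>]) simp_all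
    then obtain Hs' :: "nat sgraph list" where "block_seq Hs'" "sizes Hs' = add_mset 5 (replicate_mset (\<beta> 0 7 5 \<delta>) 3)" "minor (glue Hs') (glue Hs)"
      using collapse[OF 3, of "\<beta> 0 7 5 \<delta>"] by auto
    then show ?thesis using glue_E3 unfolding \<U>_def by blast
  next
    case 4
    have "card (verts (glue Hs)) = 7 + 2 * n" "card (edges (glue Hs)) = 10 + 3 * n" using cnt len 4 by simp_all
    then have "\<delta> * 7 - 10 < real n * (3 - 2 * \<delta>)" using dense by (simp add: algebra_simps)
    then have "\<beta> 0 10 7 \<delta> \<le> n" by (intro beta_le[OF \<delta>]) simp_all
    then obtain Hs' :: "nat sgraph list" where "block_seq Hs'" "sizes Hs' = add_mset 4 (add_mset 4 (replicate_mset (\<beta> 0 10 7 \<delta>) 3))" "minor (glue Hs') (glue Hs)"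
      using collapse[OF 4, of "\<beta> 0 10 7 \<delta>"] by auto
    then show ?thesis using glue_E4 unfolding \<U>_def by blast
  qed
qed

subsection \<open>Minor-minimal dense graphs\<close>

lemma A_simple: "A \<in> \<A> \<Longrightarrow> simple_graph A"
  unfolding \<A>_def \<A>4_def \<A>6_def \<A>8_def \<A>10_def two_tree_on_def graph_iso_def
  using two_tree_simple[of A] by blast

lemma U_simple: "A \<in> \<U> \<delta> \<Longrightarrow> simple_graph A"
  unfolding \<U>_def \<E>1_def \<E>2_def \<E>3_def \<E>4_def by auto

text \<open>A largest induced tree of two-trees of small shape either is the whole graph, and then its density
  provides enough triangles, or can be enlarged to large shape.\<close>

lemma reduced_target:
  fixes C :: "nat sgraph" and \<delta> :: real
  assumes "simple_graph C" "conn C (verts C)"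
    "\<And>a b. {a, b} \<in> edges C \<Longrightarrow> \<exists>c. {a, c} \<in> edges C \<and> {b, c} \<in> edges C"
    and dense: "\<delta> * real (card (verts C)) < real (card (edges C))" and \<delta>: "0 \<le> \<delta>" "\<delta> < 3 / 2"
  shows "\<exists>A\<in>\<A> \<union> \<U> \<delta>. minor A C"
proof (rule ccontr)
  assume none: "\<not> ?thesis"
  have "complete_graph {..<4::nat} \<in> \<A>" "sun \<in> \<A>" "fan \<in> \<A>"
    using K4_in_A4 sun_in_A6 fan_in_A6 by (auto simp: \<A>_def)
  then interpret reduced C by unfold_locales (use assms none in blast)+
  let ?P = "\<lambda>T. T \<subseteq> verts C \<and> (\<exists>Hs. block_seq Hs \<and> glue Hs = induced C T \<and> small_shape (sizes Hs))"
  have "0 \<le> \<delta> * real (card (verts C))" using \<delta>(1) by simp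
  then have "edges C \<noteq> {}" using dense by auto
  then obtain T0 Hs0 where "T0 \<subseteq> verts C" "block_seq Hs0" "glue Hs0 = induced C T0" "sizes Hs0 = {#3#}"
    using seed by blast
  moreover have "small_shape {#3#}" unfolding small_shape_def by (intro exI[of _ 1]) simp
  ultimately have P0: "?P T0" by auto
  have "\<exists>T. ?P T \<and> (\<forall>T'. ?P T' \<longrightarrow> card T' \<le> card T)"
  proof (rule ex_has_greatest_nat[where P = ?P and k = T0 and b = "Suc (card (verts C))"])
    show "\<forall>T. ?P T \<longrightarrow> card T < Suc (card (verts C))"
      using card_mono[OF finite_verts[OF simple]] by (auto simp: less_Suc_eq_le)
  qed (fact P0)
  then obtain T Hs where T: "T \<subseteq> verts C" "block_seq Hs" "glue Hs = induced C T" "small_shape (sizes Hs)"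
    and max: "\<And>T'. ?P T' \<Longrightarrow> card T' \<le> card T" by blast
  show False
  proof (cases "T = verts C")
    case True
    then have "glue Hs = C" using T(3) induced_whole[OF simple] by simp
    then show False using small_shape_target[OF T(2,4) \<delta>(2)] dense none by auto
  next
    case False
    then obtain T' Hs' where T': "T \<subset> T'" "T' \<subseteq> verts C" "block_seq Hs'" "glue Hs' = induced C T'"
      "sizes Hs' = add_mset 3 (sizes Hs) \<or> (\<exists>m M. sizes Hs = add_mset m M \<and> sizes Hs' = add_mset (Suc m) M)"
      using enlarge[OF T(2,3)] T(1) by (metis psubsetI)
    have fT': "finite T'" using T'(2) finite_verts[OF simple] finite_subset by blast
    from shape_step[OF T(4) T'(5)] show False
    proof
      assume "small_shape (sizes Hs')"
      then have "card T' \<le> card T" using max T' by blast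
      then show False using psubset_card_mono[OF fT' T'(1)] by simp
    next
      assume "large_shape (sizes Hs')"
      then obtain A where A: "A \<in> \<A>" "minor A (induced C T')" using large_shape_target[OF T'(3)] T'(4) by auto
      then have "minor A C" using minor_trans[OF A_simple _ minor_induced[OF simple T'(2)]] by blast
      then show False using none A by blast
    qed
  qed
qed

text \<open>Only at a common neighbour of \<open>a\<close> and \<open>b\<close> could two edges merge, so one vertex and one edge are lost.\<close>

lemma contract_edge:
  fixes G :: "'a sgraph"
  assumes G: "simple_graph G" and ab: "{a, b} \<in> edges G"
    and no: "\<not> (\<exists>c. {a, c} \<in> edges G \<and> {b, c} \<in> edges G)"
  shows "\<exists>H :: 'a sgraph. simple_graph H \<and> minor H G \<and> card (verts H) + 1 = card (verts G) \<and>
    card (edges H) + 1 = card (edges G)"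
proof -
  have v: "a \<in> verts G" "b \<in> verts G" "a \<noteq> b" using edge_verts[OF G ab] edge_neq[OF G ab] by auto
  let ?q = "\<lambda>v. if v = b then a else v"
  let ?E = "edges G - {{a, b}}"
  let ?H = "(verts G - {b}, (\<lambda>e. ?q ` e) ` ?E)"
  have img: "?q ` e = (if b \<in> e then insert a (e - {b}) else e)" for e by auto
  have inj: "inj_on (\<lambda>e. ?q ` e) ?E"
  proof (rule inj_onI)
    have *: False if "{b, x} \<in> ?E" "{a, x} \<in> edges G" for x using no that by (auto simp: insert_commute)
    have form: "\<exists>x. e = {b, x} \<and> x \<noteq> b \<and> x \<noteq> a" if be: "e \<in> ?E" "b \<in> e" for e
    proof -
      have "e \<in> edges G" using be by simp
      then obtain u w where "e = {u, w}" "u \<noteq> w" using edgeE[OF G] by metis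
      then show ?thesis using be by (auto simp: insert_commute)
    qed
    fix e e' assume e: "e \<in> ?E" "e' \<in> ?E" "?q ` e = ?q ` e'"
    consider "b \<in> e" "b \<in> e'" | "b \<in> e" "b \<notin> e'" | "b \<notin> e" "b \<in> e'" | "b \<notin> e" "b \<notin> e'" by blast
    then show "e = e'"
    proof cases
      case 1
      obtain x y where xy: "e = {b, x}" "x \<noteq> b" "x \<noteq> a" "e' = {b, y}" "y \<noteq> b" "y \<noteq> a"
        using form[OF e(1) 1(1)] form[OF e(2) 1(2)] by blast
      then have "{a, x} = {a, y}" using e(3) by (simp add: insert_commute)
      then show ?thesis using xy by (auto simp: doubleton_eq_iff)
    next
      case 2
      obtain x where x: "e = {b, x}" "x \<noteq> b" "x \<noteq> a" using form[OF e(1) 2(1)] by blast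
      moreover have "?q ` e' = e'" using 2 by (auto simp: img)
      moreover have "?q ` e = {a, x}" using x by auto
      ultimately have "e' = {a, x}" using e(3) by metis
      then show ?thesis using *[of x] e x by auto
    next
      case 3
      obtain x where x: "e' = {b, x}" "x \<noteq> b" "x \<noteq> a" using form[OF e(2) 3(2)] by blast
      moreover have "?q ` e = e" using 3 by (auto simp: img)
      moreover have "?q ` e' = {a, x}" using x by auto
      ultimately have "e = {a, x}" using e(3) by metis
      then show ?thesis using *[of x] e x by auto
    next
      case 4
      then have "?q ` e = e" "?q ` e' = e'" by (auto simp: img)
      then show ?thesis using e(3) by metis
    qed
  qed
  have "simple_graph ?H"
    unfolding simple_graph_def
  proof (intro conjI subsetI)
    show "finite (verts ?H)" using finite_verts[OF G] by simp
    fix f assume "f \<in> edges ?H"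
    then obtain e where e: "e \<in> edges G" "e \<noteq> {a, b}" "f = ?q ` e" by auto
    obtain u w where uw: "e = {u, w}" "u \<noteq> w" "u \<in> verts G" "w \<in> verts G" using edgeE[OF G e(1)] .
    then have "?q u \<noteq> ?q w" using e(2) by (auto simp: insert_commute)
    moreover have "f = {?q u, ?q w}" using e(3) uw by simp
    moreover have "?q u \<in> verts G - {b}" "?q w \<in> verts G - {b}" using uw v by auto
    ultimately show "f \<in> {e. e \<subseteq> verts ?H \<and> card e = 2}" by (simp add: card_insert_if del: if_split)
  qed
  moreover have "minor ?H G"
  proof (rule minor_quotient[where q = ?q])
    show "verts ?H \<subseteq> ?q ` verts G" by auto
    show "simple_graph G" by (rule G)
    fix x assume x: "x \<in> verts ?H"
    show "conn G {w \<in> verts G. ?q w = x}"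
    proof (cases "x = a")
      case True
      then have "{w \<in> verts G. ?q w = x} = {a, b}" using v by auto
      then show ?thesis using conn_doubleton[OF ab] by simp
    next
      case False
      then have "{w \<in> verts G. ?q w = x} = {x}" using x by auto
      then show ?thesis by simp
    qed
  next
    fix f assume "f \<in> edges ?H"
    then obtain e where e: "e \<in> edges G" "f = ?q ` e" by auto
    then obtain u w where uw: "e = {u, w}" using edgeE[OF G] by metis
    have "f = {?q u, ?q w}" using e(2) unfolding uw by (simp only: image_insert image_empty)
    then show "\<exists>u v. f = {?q u, ?q v} \<and> {u, v} \<in> edges G" using e(1) uw by metis
  qed
  moreover have "card (verts ?H) + 1 = card (verts G)"
    using card_Suc_Diff1[OF finite_verts[OF G] v(2)] by simp
  moreover have "card (edges ?H) + 1 = card (edges G)"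
    using card_image[OF inj] card_Suc_Diff1[OF finite_edges[OF G] ab] by simp
  ultimately show ?thesis by blast
qed

text \<open>A minor-minimal graph of density above \<open>\<delta> \<ge> 1\<close> is connected, and each of its edges lies in a triangle
  since contracting it would otherwise keep the density above \<open>\<delta>\<close>.\<close>

lemma dense_has_target:
  fixes G :: "'a sgraph" and \<delta> :: real
  assumes G: "simple_graph G" and dense: "\<delta> * real (card (verts G)) < real (card (edges G))"
    and \<delta>: "1 \<le> \<delta>" "\<delta> < 3 / 2"
  shows "\<exists>A\<in>\<A> \<union> \<U> \<delta>. minor A G"
proof -
  let ?P = "\<lambda>R :: nat sgraph. simple_graph R \<and> minor R G \<and> \<delta> * real (card (verts R)) < real (card (edges R))"
  obtain R0 :: "nat sgraph" where R0: "graph_iso G R0" using nat_copy[OF G] .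
  have P0: "?P R0"
    using R0 graph_iso_card[OF R0] graph_iso_minor[OF graph_iso_sym[OF R0]] dense by (auto elim: graph_isoE)
  let ?f = "\<lambda>R :: nat sgraph. card (verts R) + card (edges R)"
  define C where "C = arg_min ?f ?P"
  have C: "?P C" unfolding C_def by (rule arg_min_natI[of ?P, OF P0])
  have min: "?f C \<le> ?f R" if "?P R" for R unfolding C_def by (rule arg_min_nat_le[of ?P, OF that])
  have sC: "simple_graph C" using C by simp
  have fin: "finite (verts C)" by (rule finite_verts[OF sC])
  have minC: "\<not> \<delta> * real (card (verts R)) < real (card (edges R))"
    if "simple_graph R" "minor R C" "?f R < ?f C" for R
  proof
    assume d: "\<delta> * real (card (verts R)) < real (card (edges R))"
    have "minor R G" using minor_trans[OF that(1,2)] C by blast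
    then have "?f C \<le> ?f R" using min[of R] that(1) d by blast
    then show False using that(3) by simp
  qed
  have "conn C (verts C)"
  proof (rule ccontr)
    assume nc: "\<not> conn C (verts C)"
    have "verts C \<noteq> {}"
    proof
      assume "verts C = {}"
      then have "edges C = {}" using sC by (auto simp: simple_graph_def)
      then show False using C \<open>verts C = {}\<close> by simp
    qed
    then obtain A where A: "A \<subseteq> verts C" "A \<noteq> {}" "A \<noteq> verts C" "\<not> touches C A (verts C - A)"
      using nc by (auto simp: conn_cut_iff)
    have small: "real (card (edges (induced C B))) \<le> \<delta> * real (card B)" if B: "B \<subset> verts C" for B
    proof -
      have "?f (induced C B) < ?f C"
        using psubset_card_mono[OF fin B] card_mono[OF finite_edges[OF sC], of "edges (induced C B)"] by fastforce
      then have "\<not> \<delta> * real (card (verts (induced C B))) < real (card (edges (induced C B)))"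
        using B by (intro minC simple_graph_induced[OF sC] minor_induced[OF sC]) auto
      then show ?thesis by (simp del: edges_induced)
    qed
    let ?B = "verts C - A"
    note closed_split[OF sC A(1,4)]
    moreover have "real (card (edges (induced C A))) \<le> \<delta> * real (card A)" by (rule small) (use A in blast)
    moreover have "real (card (edges (induced C ?B))) \<le> \<delta> * real (card ?B)" by (rule small) (use A in blast)
    ultimately have "real (card (edges C)) \<le> \<delta> * real (card (verts C))"
      by (simp add: algebra_simps del: edges_induced)
    then show False using C by simp
  qed
  moreover have "\<exists>c. {a, c} \<in> edges C \<and> {b, c} \<in> edges C" if ab: "{a, b} \<in> edges C" for a b
  proof (rule ccontr)
    assume "\<not> ?thesis"
    then obtain H :: "nat sgraph" where H: "simple_graph H" "minor H C" "card (verts H) + 1 = card (verts C)"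
        "card (edges H) + 1 = card (edges C)" using contract_edge[OF sC ab] by blast
    then have "\<not> \<delta> * real (card (verts H)) < real (card (edges H))" by (intro minC) auto
    moreover have "real (card (verts C)) = real (card (verts H)) + 1" "real (card (edges C)) = real (card (edges H)) + 1"
      using H(3,4) by linarith+
    ultimately show False using C \<delta>(1) by (simp add: algebra_simps)
  qed
  ultimately obtain A where "A \<in> \<A> \<union> \<U> \<delta>" "minor A C"
    using reduced_target[OF sC, of \<delta>] C \<delta> by auto
  then show ?thesis using minor_trans[of A C G] A_simple U_simple C by blast
qed

section \<open>Counting through blocks\<close>

lemma two_connected_Un:
  assumes B: "two_connected B" and C: "two_connected C" and ab: "a \<noteq> b" "{a, b} \<subseteq> verts B \<inter> verts C"
  shows "two_connected (verts B \<union> verts C, edges B \<union> edges C)"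
proof -
  let ?U = "(verts B \<union> verts C, edges B \<union> edges C)"
  note b = two_connectedD[OF B] and c = two_connectedD[OF C]
  have s: "simple_graph ?U" using b(1) c(1) by (auto simp: simple_graph_def)
  have m: "edges B \<subseteq> edges ?U" "edges C \<subseteq> edges ?U" by auto
  have d: "conn ?U (verts ?U - {v})" for v
  proof -
    have "conn ?U (verts B - {v} \<union> (verts C - {v}))"
    proof (rule conn_Un)
      show "conn ?U (verts B - {v})" by (rule conn_mono_edges[OF b(4) m(1)])
      show "conn ?U (verts C - {v})" by (rule conn_mono_edges[OF c(4) m(2)])
    qed (use ab in blast)
    moreover have "verts B - {v} \<union> (verts C - {v}) = verts ?U - {v}" by auto
    ultimately show ?thesis by simp
  qed
  have "conn ?U (verts B \<union> verts C)"
    by (rule conn_Un[OF conn_mono_edges[OF b(3) m(1)] conn_mono_edges[OF c(3) m(2)]]) (use ab in blast)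
  then have "graph_connected ?U" using graph_connected_iff_conn[OF s] by simp
  moreover have "3 \<le> card (verts ?U)"
    using b(2) card_mono[of "verts ?U" "verts B"] finite_verts[OF s] by simp
  ultimately show ?thesis using s d unfolding two_connected_def del_vertex_def conn_def by simp
qed

text \<open>An edge that is not a bridge lies on a cycle; the subgraph induced by the vertices of a shortest
  path between its ends that avoids it is two-connected.\<close>

lemma edge_in_two_connected:
  assumes G: "simple_graph G" and e: "e \<in> edges G" and nb: "\<not> bridge G e"
  shows "\<exists>B. subgraph B G \<and> two_connected B \<and> e \<in> edges B"
proof -
  obtain u v where uv: "e = {u, v}" "u \<noteq> v" "u \<in> verts G" "v \<in> verts G" using edgeE[OF G e] .
  let ?G' = "(verts G, edges G - {e})"
  have "reachable ?G' u v" using nb e uv unfolding bridge_def by blast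
  then obtain xs where xs: "shortest_walk ?G' xs" "hd xs = u" "last xs = v" by (rule shortest_walk_exists)
  have dist: "distinct xs" by (rule shortest_walk_distinct[OF xs(1)])
  have wk: "walk ?G' xs" using xs(1) by (simp add: shortest_walk_def)
  have sG': "simple_graph ?G'" using G by (auto simp: simple_graph_def)
  have wG: "walk G ys" if "walk ?G' ys" for ys
    using that unfolding walk_def by (auto elim: successively_mono)
  have len: "3 \<le> length xs"
  proof (rule ccontr)
    assume n: "\<not> 3 \<le> length xs"
    consider "xs = []" | a where "xs = [a]" | a b where "xs = [a, b]" | a b c ys where "xs = a # b # c # ys"
      by (metis list.exhaust)
    then show False
    proof cases
      case 1 then show ?thesis using wk by (simp add: walk_def)
    next
      case 2 then show ?thesis using xs uv by simp
    next
      case 3 then show ?thesis using wk xs uv by (simp add: walk_def)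
    next
      case 4 then show ?thesis using n by simp
    qed
  qed
  let ?S = "set xs" and ?B = "induced G (set xs)"
  have SV: "?S \<subseteq> verts G" using walk_verts[OF sG' wk] len by simp
  have ne: "xs \<noteq> []" using len by auto
  have "u \<in> ?S" "v \<in> ?S" using xs ne by auto
  have del: "conn G (?S - {w})" for w
  proof (cases "w \<in> ?S")
    case False
    then show ?thesis using conn_walk[OF wG[OF wk]] by simp
  next
    case True
    then obtain as bs where ab: "xs = as @ w # bs" using split_list by metis
    have S: "?S - {w} = set (bs @ as)" using dist ab by auto
    have "walk G (bs @ as)"
    proof (cases "as = [] \<or> bs = []")
      case True
      then show ?thesis using wG[OF wk] ab len by (auto simp: walk_def successively_append_iff successively_Cons)
    next
      case False
      have "last bs = v" "hd as = u" using xs ab False by auto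
      then have "{last bs, hd as} \<in> edges G" using e uv by (simp add: insert_commute)
      moreover have "walk G as" "walk G bs" using wG[OF wk] ab False
        by (auto simp: walk_def successively_append_iff successively_Cons)
      ultimately show ?thesis using False by (simp add: walk_append)
    qed
    then show ?thesis using conn_walk S by metis
  qed
  have sB: "simple_graph ?B" by (rule simple_graph_induced[OF G SV])
  have "conn G ?S" using conn_walk[OF wG[OF wk]] .
  then have "graph_connected ?B" by (simp add: conn_def)
  moreover have "graph_connected (del_vertex ?B w)" for w
  proof -
    have "del_vertex ?B w = induced G (?S - {w})" by (auto simp: del_vertex_def induced_def)
    then show ?thesis using del[of w] by (simp add: conn_def)
  qed
  moreover have "3 \<le> card ?S" using len distinct_card[OF dist] by simp
  ultimately have "two_connected ?B" using sB by (simp add: two_connected_def)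
  moreover have "subgraph ?B G" using sB SV by (simp add: subgraph_def)
  moreover have "e \<in> edges ?B" using e uv \<open>u \<in> ?S\<close> \<open>v \<in> ?S\<close> by simp
  ultimately show ?thesis by blast
qed

text \<open>A largest two-connected subgraph containing \<open>B\<close> is a block.\<close>

lemma two_connected_extends_to_block:
  assumes G: "simple_graph G" and B: "subgraph B G" "two_connected B"
  shows "\<exists>C\<in>blocks G. subgraph B C"
proof -
  let ?P = "\<lambda>C. subgraph C G \<and> two_connected C \<and> subgraph B C"
  have sB: "simple_graph B" by (rule two_connectedD(1)[OF B(2)])
  have PB: "?P B" using B sB by (simp add: subgraph_def)
  have bound: "\<forall>C. ?P C \<longrightarrow> card (verts C) + card (edges C) < Suc (card (verts G) + card (edges G))"
    using card_mono[OF finite_verts[OF G]] card_mono[OF finite_edges[OF G]]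
    by (auto simp: subgraph_def less_Suc_eq_le intro!: add_mono)
  obtain C where C: "?P C" and max: "\<And>D. ?P D \<Longrightarrow> card (verts D) + card (edges D) \<le> card (verts C) + card (edges C)"
    using ex_has_greatest_nat[where P = ?P and f = "\<lambda>C. card (verts C) + card (edges C)", OF PB bound] by blast
  have "D = C" if D: "subgraph D G" "two_connected D" "subgraph C D" for D
  proof -
    have sD: "simple_graph D" by (rule two_connectedD(1)[OF D(2)])
    have "subgraph B D" using C D(3) by (auto simp: subgraph_def)
    then have le: "card (verts D) + card (edges D) \<le> card (verts C) + card (edges C)" using max D by blast
    have sub: "verts C \<subseteq> verts D" "edges C \<subseteq> edges D" using D(3) by (auto simp: subgraph_def)
    note f = finite_verts[OF sD] finite_edges[OF sD]
    have "card (verts C) \<le> card (verts D)" "card (edges C) \<le> card (edges D)"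
      using card_mono[OF f(1) sub(1)] card_mono[OF f(2) sub(2)] by auto
    then have "verts C = verts D" "edges C = edges D"
      using le card_subset_eq[OF f(1) sub(1)] card_subset_eq[OF f(2) sub(2)] by auto
    then show "D = C" by (simp add: prod_eq_iff)
  qed
  then have "C \<in> blocks G" using C unfolding blocks_def by blast
  then show ?thesis using C by blast
qed

text \<open>If all blocks are two-connected, they are edge-disjoint, and adding them one at a time along the
  connected graph shows how few vertices there are.\<close>

lemma blocks_count:
  assumes G: "simple_graph G" "graph_connected G" and fin: "finite (blocks G)" "blocks G \<noteq> {}"
    and three: "\<And>B. B \<in> blocks G \<Longrightarrow> 3 \<le> card (verts B)"
  shows "(\<Sum>B\<in>blocks G. card (edges B)) \<le> card (edges G)"
    "card (verts G) \<le> 1 + (\<Sum>B\<in>blocks G. card (verts B) - 1)"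
proof -
  have nobridge: "\<not> bridge G e" for e
  proof
    assume "bridge G e"
    then have "(e, {e}) \<in> blocks G" "e \<in> edges G" by (auto simp: blocks_def bridge_def)
    then show False using three[of "(e, {e})"] G(1) by (auto simp: simple_graph_def)
  qed
  have B: "subgraph B G" "two_connected B" "\<And>C. subgraph C G \<Longrightarrow> two_connected C \<Longrightarrow> subgraph B C \<Longrightarrow> C = B"
    if "B \<in> blocks G" for B
    using that nobridge unfolding blocks_def by blast+
  have share: "edges B \<inter> edges C = {}" if BC: "B \<in> blocks G" "C \<in> blocks G" "B \<noteq> C" for B C
  proof (rule ccontr)
    assume "edges B \<inter> edges C \<noteq> {}"
    then obtain e where e: "e \<in> edges B" "e \<in> edges C" by blast
    note sB = two_connectedD(1)[OF B(2)[OF BC(1)]] and sC = two_connectedD(1)[OF B(2)[OF BC(2)]]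
    obtain a b where ab: "e = {a, b}" "a \<noteq> b" using edgeE[OF sB e(1)] by metis
    have "{a, b} \<subseteq> verts B \<inter> verts C" using e ab sB sC by (auto simp: simple_graph_def)
    then have tc: "two_connected (verts B \<union> verts C, edges B \<union> edges C)" (is "two_connected ?U")
      using two_connected_Un[OF B(2)[OF BC(1)] B(2)[OF BC(2)] ab(2)] by blast
    have "subgraph ?U G" using B(1)[OF BC(1)] B(1)[OF BC(2)] two_connectedD(1)[OF tc] by (auto simp: subgraph_def)
    moreover have "subgraph B ?U" "subgraph C ?U" using sB sC by (auto simp: subgraph_def)
    ultimately show False using B(3)[OF BC(1)] B(3)[OF BC(2)] tc BC(3) by metis
  qed
  have finE: "finite (edges B)" if "B \<in> blocks G" for B
    using finite_edges[OF two_connectedD(1)[OF B(2)[OF that]]] .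
  have "(\<Sum>B\<in>blocks G. card (edges B)) = card (\<Union>B\<in>blocks G. edges B)"
    by (rule card_UN_disjoint[symmetric]) (use fin finE share in auto)
  also have "\<dots> \<le> card (edges G)"
    by (rule card_mono[OF finite_edges[OF G(1)]]) (use B(1) in \<open>auto simp: subgraph_def\<close>)
  finally show "(\<Sum>B\<in>blocks G. card (edges B)) \<le> card (edges G)" .
  have cov: "\<exists>B\<in>blocks G. e \<in> edges B" if eG: "e \<in> edges G" for e
  proof -
    obtain B0 where B0: "subgraph B0 G" "two_connected B0" "e \<in> edges B0"
      using edge_in_two_connected[OF G(1) eG nobridge] by blast
    then obtain C where "C \<in> blocks G" "subgraph B0 C" using two_connected_extends_to_block[OF G(1)] by blast
    then show ?thesis using B0(3) by (auto simp: subgraph_def)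
  qed
  let ?V = "\<lambda>\<C>. \<Union>(verts ` \<C>)"
  let ?P = "\<lambda>\<C>. \<C> \<subseteq> blocks G \<and> \<C> \<noteq> {} \<and> card (?V \<C>) \<le> 1 + (\<Sum>B\<in>\<C>. card (verts B) - 1)"
  obtain B0 where B0: "B0 \<in> blocks G" using fin(2) by blast
  have P0: "?P {B0}" using B0 three[OF B0] by simp
  have bd: "\<forall>\<C>. ?P \<C> \<longrightarrow> card \<C> < Suc (card (blocks G))"
    using card_mono[OF fin(1)] by (auto simp: less_Suc_eq_le)
  obtain \<C> where C: "?P \<C>" and max: "\<And>\<D>. ?P \<D> \<Longrightarrow> card \<D> \<le> card \<C>"
    using ex_has_greatest_nat[where P = ?P and f = card, OF P0 bd] by blast
  have finC: "finite \<C>" using C fin(1) finite_subset by blast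
  have VC: "?V \<C> \<subseteq> verts G" using C B(1) by (auto simp: subgraph_def)
  have "?V \<C> = verts G"
  proof (rule ccontr)
    assume ne: "?V \<C> \<noteq> verts G"
    obtain B1 where B1: "B1 \<in> \<C>" using C by blast
    then have "3 \<le> card (verts B1)" using three C by blast
    then have "verts B1 \<noteq> {}" by auto
    then have "?V \<C> \<noteq> {}" using B1 by blast
    then have "touches G (?V \<C>) (verts G - ?V \<C>)"
      using connD[of G "verts G" "?V \<C>"] G VC ne by (simp add: graph_connected_iff_conn)
    then obtain x y where xy: "x \<in> ?V \<C>" "y \<in> verts G - ?V \<C>" "{x, y} \<in> edges G" by (rule touchesE)
    obtain D where D: "D \<in> blocks G" "{x, y} \<in> edges D" using cov[OF xy(3)] by blast
    have sD: "simple_graph D" by (rule two_connectedD(1)[OF B(2)[OF D(1)]])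
    have xyD: "x \<in> verts D" "y \<in> verts D" using edge_verts[OF sD D(2)] by auto
    then have nD: "D \<notin> \<C>" using xy(2) by blast
    have fV: "finite (?V \<C>)" by (rule finite_subset[OF VC finite_verts[OF G(1)]])
    have "card (verts D \<union> ?V \<C>) + card (verts D \<inter> ?V \<C>) = card (verts D) + card (?V \<C>)"
      using card_Un_Int[OF finite_verts[OF sD] fV] by simp
    moreover have "1 \<le> card (verts D \<inter> ?V \<C>)"
      using xyD xy(1) finite_verts[OF sD] by (simp add: Suc_le_eq card_gt_0_iff) blast
    ultimately have "card (verts D \<union> ?V \<C>) \<le> (card (verts D) - 1) + card (?V \<C>)" using three[OF D(1)] by linarith
    then have "?P (insert D \<C>)" using C D(1) nD finC by simp
    then have "card (insert D \<C>) \<le> card \<C>" by (rule max)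
    then show False using nD finC by simp
  qed
  then have "card (verts G) \<le> 1 + (\<Sum>B\<in>\<C>. card (verts B) - 1)" using C by simp
  also have "\<dots> \<le> 1 + (\<Sum>B\<in>blocks G. card (verts B) - 1)"
    using C by (intro add_left_mono sum_mono2[OF fin(1)]) auto
  finally show "card (verts G) \<le> 1 + (\<Sum>B\<in>blocks G. card (verts B) - 1)" .
qed

subsection \<open>The targets are dense\<close>

lemma two_tree_on_card: "two_tree_on n B \<Longrightarrow> card (verts B) = n" "two_tree_on n B \<Longrightarrow> card (edges B) = 2 * n - 3"
  "two_tree_on n B \<Longrightarrow> 3 \<le> n"
  using two_tree_card[of B] by (auto simp: two_tree_on_def)

lemma triangle_card: "triangle B \<Longrightarrow> card (verts B) = 3" "triangle B \<Longrightarrow> card (edges B) = 3"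
  using two_tree_card[OF two_tree.base, of B] graph_iso_card[of B "complete_graph {..<3::nat}"]
  by (auto simp: triangle_def complete_graph_def)

text \<open>The strict inequality for which \<open>\<beta>\<close> was chosen.\<close>

lemma beta_gt:
  assumes "\<delta> < 3 / 2"
  shows "\<delta> * c - a < real (\<beta> b a c \<delta>) * (3 - 2 * \<delta>)"
proof -
  let ?x = "(\<delta> * c - a) / (3 - 2 * \<delta>)"
  have "?x < of_int (1 + \<lfloor>?x\<rfloor>)" by linarith
  also have "\<dots> \<le> real (\<beta> b a c \<delta>)" by (simp add: \<beta>_def)
  finally show ?thesis using assms by (simp add: divide_less_eq)
qed

lemma sum_all_equal: "(\<And>x. x \<in> A \<Longrightarrow> f x = c) \<Longrightarrow> sum f A = card A * (c::nat)"
  using sum.cong[OF refl, of A f "\<lambda>_. c"] by simp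

lemma triangle_sums:
  assumes "\<forall>B\<in>\<B>. triangle B"
  shows "(\<Sum>B\<in>\<B>. card (edges B)) = card \<B> * 3" "(\<Sum>B\<in>\<B>. card (verts B) - 1) = card \<B> * 2"
proof -
  show "(\<Sum>B\<in>\<B>. card (edges B)) = card \<B> * 3"
    by (rule sum_all_equal) (rule triangle_card(2)[OF bspec[OF assms]])
  have "card (verts B) - 1 = 2" if "B \<in> \<B>" for B using triangle_card(1)[OF bspec[OF assms that]] by simp
  then show "(\<Sum>B\<in>\<B>. card (verts B) - 1) = card \<B> * 2" by (rule sum_all_equal)
qed

lemma E1_count:
  assumes "G \<in> \<E>1 b" "1 \<le> b"
  shows "3 * b \<le> card (edges G)" "card (verts G) \<le> 1 + 2 * b"
proof -
  have G: "simple_graph G" "graph_connected G" "card (blocks G) = b" "\<And>B. B \<in> blocks G \<Longrightarrow> triangle B"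
    using assms(1) by (auto simp: \<E>1_def)
  have fin: "finite (blocks G)" "blocks G \<noteq> {}" using G(3) assms(2) by (auto intro: card_ge_0_finite)
  have "3 \<le> card (verts B)" if "B \<in> blocks G" for B using triangle_card(1)[OF G(4)[OF that]] by simp
  note c = blocks_count[OF G(1,2) fin this]
  have "(\<Sum>B\<in>blocks G. card (edges B)) = card (blocks G) * 3"
    "(\<Sum>B\<in>blocks G. card (verts B) - 1) = card (blocks G) * 2"
    using G(4) by (intro triangle_sums ballI; blast)+
  then show "3 * b \<le> card (edges G)" "card (verts G) \<le> 1 + 2 * b" using c G(3) by auto
qed

lemma E23_count:
  assumes G: "simple_graph G" "graph_connected G" "card (blocks G) = b + 1"
    and B: "B \<in> blocks G" "two_tree_on m B" "\<forall>C\<in>blocks G - {B}. triangle C"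
  shows "2 * m - 3 + 3 * b \<le> card (edges G)" "card (verts G) \<le> m + 2 * b"
proof -
  have fin: "finite (blocks G)" "blocks G \<noteq> {}" using G(3) by (auto intro: card_ge_0_finite)
  note t = two_tree_on_card[OF B(2)]
  have three: "3 \<le> card (verts C)" if "C \<in> blocks G" for C
    using that t B(3) triangle_card(1)[of C] by (cases "C = B") auto
  note c = blocks_count[OF G(1,2) fin three]
  have k: "card (blocks G - {B}) = b" using G(3) B(1) fin by simp
  have "(\<Sum>C\<in>blocks G. card (edges C)) = 2 * m - 3 + (\<Sum>C\<in>blocks G - {B}. card (edges C))"
    "(\<Sum>C\<in>blocks G. card (verts C) - 1) = m - 1 + (\<Sum>C\<in>blocks G - {B}. card (verts C) - 1)"
    using sum.remove[OF fin(1) B(1), of "\<lambda>C. card (edges C)"]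
      sum.remove[OF fin(1) B(1), of "\<lambda>C. card (verts C) - 1"] t by auto
  moreover have "(\<Sum>C\<in>blocks G - {B}. card (edges C)) = card (blocks G - {B}) * 3"
    "(\<Sum>C\<in>blocks G - {B}. card (verts C) - 1) = card (blocks G - {B}) * 2"
    by (rule triangle_sums[OF B(3)])+
  ultimately show "2 * m - 3 + 3 * b \<le> card (edges G)" "card (verts G) \<le> m + 2 * b" using c t k by auto
qed

lemma E4_count:
  assumes G: "simple_graph G" "graph_connected G" "card (blocks G) = b + 2"
    and B: "B \<in> blocks G" "B' \<in> blocks G" "B \<noteq> B'" "two_tree_on m B" "two_tree_on m' B'"
      "\<forall>C\<in>blocks G - {B, B'}. triangle C"
  shows "2 * m - 3 + (2 * m' - 3) + 3 * b \<le> card (edges G)" "card (verts G) + 1 \<le> m + m' + 2 * b"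
proof -
  have fin: "finite (blocks G)" "blocks G \<noteq> {}" using G(3) by (auto intro: card_ge_0_finite)
  note t = two_tree_on_card[OF B(4)] two_tree_on_card[OF B(5)]
  have three: "3 \<le> card (verts C)" if "C \<in> blocks G" for C
    using that t B(6) triangle_card(1)[of C] by (cases "C = B"; cases "C = B'") auto
  note c = blocks_count[OF G(1,2) fin three]
  have d: "blocks G - {B} - {B'} = blocks G - {B, B'}" by auto
  have B2: "B' \<in> blocks G - {B}" using B by simp
  have k: "card (blocks G - {B, B'}) = b" using G(3) B(1) B2 fin by (simp add: d[symmetric])
  have "(\<Sum>C\<in>blocks G. card (edges C)) = 2 * m - 3 + (2 * m' - 3) + (\<Sum>C\<in>blocks G - {B, B'}. card (edges C))"
    "(\<Sum>C\<in>blocks G. card (verts C) - 1) = m - 1 + (m' - 1) + (\<Sum>C\<in>blocks G - {B, B'}. card (verts C) - 1)"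
    using sum.remove[OF fin(1) B(1), of "\<lambda>C. card (edges C)"]
      sum.remove[OF fin(1) B(1), of "\<lambda>C. card (verts C) - 1"]
      sum.remove[OF finite_Diff[OF fin(1)] B2, of "\<lambda>C. card (edges C)"]
      sum.remove[OF finite_Diff[OF fin(1)] B2, of "\<lambda>C. card (verts C) - 1"] t
    unfolding d by auto
  moreover have "(\<Sum>C\<in>blocks G - {B, B'}. card (edges C)) = card (blocks G - {B, B'}) * 3"
    "(\<Sum>C\<in>blocks G - {B, B'}. card (verts C) - 1) = card (blocks G - {B, B'}) * 2"
    by (rule triangle_sums[OF B(6)])+
  ultimately show "2 * m - 3 + (2 * m' - 3) + 3 * b \<le> card (edges G)" "card (verts G) + 1 \<le> m + m' + 2 * b"
    using c t k by auto
qed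

lemma U_dense:
  assumes G: "G \<in> \<U> \<delta>" and \<delta>: "0 \<le> \<delta>" "\<delta> < 3 / 2"
  shows "\<delta> * real (card (verts G)) < real (card (edges G))" "graph_connected G"
    "card (verts G) \<le> 10 + 2 * (\<beta> 1 0 1 \<delta> + \<beta> 0 5 4 \<delta> + \<beta> 0 7 5 \<delta> + \<beta> 0 10 7 \<delta>)" (is "_ \<le> ?M")
proof -
  have main: "\<delta> * real v < real e" if "\<delta> * c - a < real b * (3 - 2 * \<delta>)" "real v \<le> c + 2 * real b" "a + 3 * real b \<le> real e"
    for v e b a c
  proof -
    have "\<delta> * real v \<le> \<delta> * (c + 2 * real b)" using that(2) \<delta>(1) by (rule mult_left_mono)
    also have "\<dots> < a + 3 * real b" using that(1) by (simp add: algebra_simps)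
    finally show ?thesis using that(3) by simp
  qed
  from G consider "G \<in> \<E>1 (\<beta> 1 0 1 \<delta>)" | "G \<in> \<E>2 (\<beta> 0 5 4 \<delta>)" | "G \<in> \<E>3 (\<beta> 0 7 5 \<delta>)" | "G \<in> \<E>4 (\<beta> 0 10 7 \<delta>)"
    unfolding \<U>_def by blast
  then have "\<delta> * real (card (verts G)) < real (card (edges G)) \<and> card (verts G) \<le> ?M"
  proof cases
    case 1
    note c = E1_count[OF 1 beta_ge]
    have "\<delta> * real (card (verts G)) < real (card (edges G))"
      by (rule main[OF beta_gt[OF \<delta>(2), where b = 1 and c = 1 and a = 0]]) (use c in linarith)+
    moreover have "card (verts G) \<le> ?M" by (rule le_trans[OF c(2)]) simp
    ultimately show ?thesis ..
  next
    case 2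
    then obtain B where "simple_graph G" "graph_connected G" "card (blocks G) = \<beta> 0 5 4 \<delta> + 1" "B \<in> blocks G"
      "two_tree_on 4 B" "\<forall>C\<in>blocks G - {B}. triangle C" by (auto simp: \<E>2_def)
    note c = E23_count[OF this]
    have "\<delta> * real (card (verts G)) < real (card (edges G))"
      by (rule main[OF beta_gt[OF \<delta>(2), where b = 0 and c = 4 and a = 5]]) (use c in linarith)+
    moreover have "card (verts G) \<le> ?M" by (rule le_trans[OF c(2)]) simp
    ultimately show ?thesis ..
  next
    case 3
    then obtain B where "simple_graph G" "graph_connected G" "card (blocks G) = \<beta> 0 7 5 \<delta> + 1" "B \<in> blocks G"
      "two_tree_on 5 B" "\<forall>C\<in>blocks G - {B}. triangle C" by (auto simp: \<E>3_def)
    note c = E23_count[OF this]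
    have "\<delta> * real (card (verts G)) < real (card (edges G))"
      by (rule main[OF beta_gt[OF \<delta>(2), where b = 0 and c = 5 and a = 7]]) (use c in linarith)+
    moreover have "card (verts G) \<le> ?M" by (rule le_trans[OF c(2)]) simp
    ultimately show ?thesis ..
  next
    case 4
    then obtain B B' where "simple_graph G" "graph_connected G" "card (blocks G) = \<beta> 0 10 7 \<delta> + 2" "B \<in> blocks G"
      "B' \<in> blocks G" "B \<noteq> B'" "two_tree_on 4 B" "two_tree_on 4 B'" "\<forall>C\<in>blocks G - {B, B'}. triangle C"
      unfolding \<E>4_def by blast
    note c = E4_count[OF this]
    have "\<delta> * real (card (verts G)) < real (card (edges G))"
      by (rule main[OF beta_gt[OF \<delta>(2), where b = 0 and c = 7 and a = 10]]) (use c in linarith)+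
    moreover have "card (verts G) \<le> 7 + 2 * \<beta> 0 10 7 \<delta>" using c(2) by linarith
    then have "card (verts G) \<le> ?M" by (rule le_trans) simp
    ultimately show ?thesis ..
  qed
  then show "\<delta> * real (card (verts G)) < real (card (edges G))" "card (verts G) \<le> ?M" by auto
  show "graph_connected G" using G unfolding \<U>_def \<E>1_def \<E>2_def \<E>3_def \<E>4_def by auto
qed

lemma complete_connected: "finite S \<Longrightarrow> S \<noteq> {} \<Longrightarrow> graph_connected (complete_graph S)"
proof -
  assume S: "finite S" "S \<noteq> {}"
  have "conn (complete_graph S) S"
    unfolding conn_cut_iff
  proof (intro conjI allI impI)
    fix A assume A: "A \<subseteq> S \<and> A \<noteq> {} \<and> A \<noteq> S"
    then obtain a b where "a \<in> A" "b \<in> S" "b \<notin> A" by blast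
    then show "touches (complete_graph S) A (S - A)" using A
      by (intro touchesI[of a b]) (auto simp: complete_graph_def card_insert_if)
  qed (use S in simp)
  then show ?thesis using graph_connected_iff_conn[OF simple_complete[OF S(1)]] by (simp add: complete_graph_def)
qed

lemma graph_iso_connected:
  assumes "graph_iso G H" "graph_connected G"
  shows "graph_connected H"
proof -
  obtain f where f: "simple_graph G" "simple_graph H" "inj_on f (verts G)" "H = rename f G"
    using assms(1) by (metis graph_isoE)
  have "conn G (verts G)" using assms(2) f(1) by (simp add: graph_connected_iff_conn)
  then have "conn H (f ` verts G)"
  proof (rule conn_image)
    fix u v assume "{u, v} \<in> edges G"
    then have "f ` {u, v} \<in> edges H" unfolding f(4) edges_rename by (rule imageI)
    then show "f u = f v \<or> {f u, f v} \<in> edges H" by simp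
  qed
  then show ?thesis using f by (simp add: graph_connected_iff_conn)
qed

lemma A_dense:
  assumes A: "A \<in> \<A>" and \<delta>: "0 \<le> \<delta>" "\<delta> < 3 / 2"
  shows "\<delta> * real (card (verts A)) < real (card (edges A))" "graph_connected A" "card (verts A) \<le> 10"
proof -
  have main: "\<delta> * real v < real e" if "3 * v \<le> 2 * e" "0 < e" for v e :: nat
  proof (cases "v = 0")
    case False
    then have "\<delta> * real v < 3 / 2 * real v" using \<delta> by simp
    also have "\<dots> \<le> real e" using that(1) by linarith
    finally show ?thesis .
  qed (use that in simp)
  from A consider "A \<in> \<A>4" | "A \<in> \<A>6" | "A \<in> \<A>8" | "A \<in> \<A>10" unfolding \<A>_def by blast
  then have "3 * card (verts A) \<le> 2 * card (edges A) \<and> 0 < card (edges A) \<and> graph_connected A \<and> card (verts A) \<le> 10"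
  proof cases
    case 1
    then have iso: "graph_iso (complete_graph {..<4::nat}) A" by (simp add: \<A>4_def graph_iso_sym)
    have "card {e. e \<subseteq> {..<4::nat} \<and> card e = 2} = 6" by (subst n_subsets) (simp_all add: choose_two)
    then have "card (verts A) = 4" "card (edges A) = 6" using graph_iso_card[OF iso] by (simp_all add: complete_graph_def)
    moreover have "0 \<in> {..<4::nat}" by simp
    then have "{..<4::nat} \<noteq> {}" by blast
    ultimately show ?thesis using graph_iso_connected[OF iso complete_connected] by simp
  next
    case 2
    then have "two_tree A" "card (verts A) = 6" "card (edges A) = 9"
      using two_tree_on_card[of 6 A] by (auto simp: \<A>6_def two_tree_on_def)
    then show ?thesis using two_tree_conn_delete[of A] two_tree_simple[of A] by (simp add: graph_connected_iff_conn)
  next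
    case 3
    then obtain B C where *: "simple_graph A" "graph_connected A" "B \<noteq> C" "blocks A = {B, C}" "two_tree_on 5 B" "two_tree_on 4 C"
      unfolding \<A>8_def by blast
    have "2 * 5 - 3 + (2 * 4 - 3) + 3 * 0 \<le> card (edges A)" "card (verts A) + 1 \<le> 5 + 4 + 2 * 0"
      by (rule E4_count[OF *(1,2), where B = B and B' = C]; use * in simp)+
    then show ?thesis using * by simp
  next
    case 4
    then have *: "simple_graph A" "graph_connected A" "card (blocks A) = 3" "\<And>B. B \<in> blocks A \<Longrightarrow> two_tree_on 4 B"
      unfolding \<A>10_def by auto
    have fin: "finite (blocks A)" "blocks A \<noteq> {}" using *(3) by (auto intro: card_ge_0_finite)
    have three: "3 \<le> card (verts B)" if "B \<in> blocks A" for B using two_tree_on_card(1)[OF *(4)[OF that]] by simp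
    have "(\<Sum>B\<in>blocks A. card (edges B)) = card (blocks A) * 5" "(\<Sum>B\<in>blocks A. card (verts B) - 1) = card (blocks A) * 3"
    proof -
      have c: "card (edges B) = 5" "card (verts B) - 1 = 3" if "B \<in> blocks A" for B
        using two_tree_on_card[OF *(4)[OF that]] by simp_all
      show "(\<Sum>B\<in>blocks A. card (edges B)) = card (blocks A) * 5" by (rule sum_all_equal[OF c(1)])
      show "(\<Sum>B\<in>blocks A. card (verts B) - 1) = card (blocks A) * 3" by (rule sum_all_equal[OF c(2)])
    qed
    then show ?thesis using *(3) blocks_count[OF *(1,2) fin three] *(2) by simp
  qed
  then show "\<delta> * real (card (verts A)) < real (card (edges A))" "graph_connected A" "card (verts A) \<le> 10"
    using main by auto
qed

section \<open>Edge counts of minor-closed classes\<close>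

lemma class_simple: "minor_closed_class \<G> \<Longrightarrow> G \<in> \<G> \<Longrightarrow> simple_graph G"
  by (simp add: minor_closed_class_def)

lemma class_closed: "minor_closed_class \<G> \<Longrightarrow> G \<in> \<G> \<Longrightarrow> simple_graph H \<Longrightarrow> minor H G \<Longrightarrow> H \<in> \<G>"
  unfolding minor_closed_class_def by blast

lemma class_copy:
  assumes \<G>: "minor_closed_class \<G>" and G: "G \<in> \<G>" and X: "simple_graph X" "minor X G"
  obtains R where "R \<in> \<G>" "graph_iso X R" "verts R = {..<card (verts X)}"
proof -
  obtain R :: "nat sgraph" where R: "graph_iso X R" "verts R = {..<card (verts X)}" using nat_copy[OF X(1)] .
  then have s: "simple_graph R" by (auto elim: graph_isoE)
  have "minor R X" using graph_iso_minor graph_iso_sym R(1) by blast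
  then have "minor R G" using minor_trans[OF s _ X(2)] by blast
  then show ?thesis using that R class_closed[OF \<G> G s] by blast
qed

lemma card_edges_le_square: "simple_graph G \<Longrightarrow> card (edges G) \<le> card (verts G) * card (verts G)"
proof -
  assume G: "simple_graph G"
  have "edges G \<subseteq> (\<lambda>(u, v). {u, v}) ` (verts G \<times> verts G)"
  proof
    fix e assume "e \<in> edges G"
    then obtain u v where "e = {u, v}" "u \<in> verts G" "v \<in> verts G" using edgeE[OF G] by metis
    then show "e \<in> (\<lambda>(u, v). {u, v}) ` (verts G \<times> verts G)" by auto
  qed
  then have "card (edges G) \<le> card (verts G \<times> verts G)"
    using finite_verts[OF G] by (meson card_image_le card_mono finite_SigmaI finite_imageI le_trans)
  then show ?thesis by (simp add: card_cartesian_product)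
qed

lemma ex_edges_Max: "ex_edges \<G> n = Max ((\<lambda>G. card (edges G)) ` {G \<in> \<G>. card (verts G) = n})"
proof -
  have "{card (edges G) | G. G \<in> \<G> \<and> card (verts G) = n} = (\<lambda>G. card (edges G)) ` {G \<in> \<G>. card (verts G) = n}"
    by blast
  then show ?thesis by (simp only: ex_edges_def)
qed

lemma ex_values_finite:
  assumes "minor_closed_class \<G>"
  shows "finite ((\<lambda>G. card (edges G)) ` {G \<in> \<G>. card (verts G) = n})"
proof (rule finite_subset)
  show "(\<lambda>G. card (edges G)) ` {G \<in> \<G>. card (verts G) = n} \<subseteq> {..n * n}"
  proof (rule image_subsetI)
    fix G assume "G \<in> {G \<in> \<G>. card (verts G) = n}"
    then show "card (edges G) \<in> {..n * n}" using card_edges_le_square[OF class_simple[OF assms, of G]] by simp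
  qed
qed simp

lemma ex_edges_ge:
  assumes "minor_closed_class \<G>" "G \<in> \<G>" "card (verts G) = n"
  shows "card (edges G) \<le> ex_edges \<G> n"
  unfolding ex_edges_Max
  by (rule Max_ge[OF ex_values_finite[OF assms(1)]], rule imageI) (simp add: assms)

lemma ex_edges_attained:
  assumes "minor_closed_class \<G>" "G \<in> \<G>" "card (verts G) = n"
  obtains H where "H \<in> \<G>" "card (verts H) = n" "card (edges H) = ex_edges \<G> n"
proof -
  have "{G \<in> \<G>. card (verts G) = n} \<noteq> {}" using assms(2,3) by blast
  then have "ex_edges \<G> n \<in> (\<lambda>G. card (edges G)) ` {G \<in> \<G>. card (verts G) = n}"
    unfolding ex_edges_Max by (intro Max_in[OF ex_values_finite[OF assms(1)]]) blast
  then obtain H where H: "H \<in> {G \<in> \<G>. card (verts G) = n}" "ex_edges \<G> n = card (edges H)" by (rule imageE)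
  show ?thesis by (rule that[of H]) (use H in simp_all)
qed

lemma finite_graphs_below: "finite {R :: nat sgraph. simple_graph R \<and> verts R \<subseteq> {..<n}}"
proof (rule finite_subset)
  show "{R :: nat sgraph. simple_graph R \<and> verts R \<subseteq> {..<n}} \<subseteq> Pow {..<n} \<times> Pow (Pow {..<n})"
  proof
    fix R :: "nat sgraph" assume "R \<in> {R. simple_graph R \<and> verts R \<subseteq> {..<n}}"
    then have "verts R \<subseteq> {..<n}" "edges R \<subseteq> Pow {..<n}" unfolding simple_graph_def by blast+
    then show "R \<in> Pow {..<n} \<times> Pow (Pow {..<n})" by (simp add: mem_Times_iff)
  qed
qed simp

text \<open>If some order is missing, then by closure under subgraphs all larger ones are, and finitely many
  isomorphism types remain.\<close>

lemma infinite_class_all_sizes: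
  assumes \<G>: "minor_closed_class \<G>" and inf: "\<not> finite_class \<G>"
  shows "\<exists>G\<in>\<G>. card (verts G) = n"
proof (rule ccontr)
  assume none: "\<not> ?thesis"
  have small: "card (verts G) < n" if G: "G \<in> \<G>" for G
  proof (rule ccontr)
    assume "\<not> card (verts G) < n"
    note s = class_simple[OF \<G> G]
    obtain S where S: "S \<subseteq> verts G" "card S = n"
      using \<open>\<not> card (verts G) < n\<close> by (metis obtain_subset_with_card_n not_less)
    have "induced G S \<in> \<G>"
      by (rule class_closed[OF \<G> G simple_graph_induced[OF s S(1)] minor_induced[OF s S(1)]])
    moreover have "card (verts (induced G S)) = n" using S(2) by simp
    ultimately show False using none by blast
  qed
  let ?F = "{R \<in> \<G>. verts R \<subseteq> {..<n}}"
  have "finite ?F"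
  proof (rule finite_subset[OF _ finite_graphs_below[of n]])
    show "?F \<subseteq> {R. simple_graph R \<and> verts R \<subseteq> {..<n}}"
    proof
      fix R assume "R \<in> ?F"
      then show "R \<in> {R. simple_graph R \<and> verts R \<subseteq> {..<n}}" using class_simple[OF \<G>, of R] by simp
    qed
  qed
  moreover have "\<exists>R\<in>?F. graph_iso G R" if G: "G \<in> \<G>" for G
  proof -
    obtain R where R: "R \<in> \<G>" "graph_iso G R" "verts R = {..<card (verts G)}"
      using class_copy[OF \<G> G class_simple[OF \<G> G] minor_refl[OF class_simple[OF \<G> G]]] .
    then have "verts R \<subseteq> {..<n}" using small[OF G] by simp
    then show ?thesis using R by (intro bexI[of _ R]) simp_all
  qed
  ultimately have "finite_class \<G>" unfolding finite_class_def by (intro exI[of _ ?F]) blast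
  then show False using inf by simp
qed

lemma all_sizes_infinite_class:
  assumes "\<And>n. \<exists>G\<in>\<G>. card (verts G) = n"
  shows "\<not> finite_class \<G>"
proof
  assume "finite_class \<G>"
  then obtain F :: "nat sgraph set" where F: "finite F" "\<forall>G\<in>\<G>. \<exists>H\<in>F. graph_iso G H"
    unfolding finite_class_def by blast
  obtain n where n: "n \<notin> (\<lambda>H. card (verts H)) ` F"
    using ex_new_if_finite[OF infinite_UNIV_nat, of "(\<lambda>H. card (verts H)) ` F"] F(1) by blast
  obtain G where G: "G \<in> \<G>" "card (verts G) = n" using assms by blast
  obtain H where H: "H \<in> F" "graph_iso G H" using F(2) G(1) by blast
  have "card (verts H) = n" using graph_iso_card(1)[OF H(2)] G(2) by simp
  then show False using n H(1) by blast
qed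

definition slope_le :: "(nat \<Rightarrow> nat) \<Rightarrow> real \<Rightarrow> bool" where
  "slope_le f d \<longleftrightarrow> (\<exists>C. \<forall>n. real (f n) \<le> d * real n + C)"

definition slope_ge :: "(nat \<Rightarrow> nat) \<Rightarrow> real \<Rightarrow> bool" where
  "slope_ge f d \<longleftrightarrow> (\<exists>C. \<forall>n. d * real n - C \<le> real (f n))"

lemma slope_le_eventually:
  assumes "slope_le f d" "d < e"
  shows "\<forall>\<^sub>F n in sequentially. real (f n) / real n < e"
proof -
  obtain C where C: "\<And>n. real (f n) \<le> d * real n + C" using assms(1) unfolding slope_le_def by blast
  have "(\<lambda>n. d + C / real n) \<longlonglongrightarrow> d + 0" by (intro tendsto_intros lim_const_over_n)
  then have "\<forall>\<^sub>F n in sequentially. d + C / real n < e" using assms(2) by (intro order_tendstoD(2)) auto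
  then show ?thesis using eventually_gt_at_top[of 0]
  proof eventually_elim
    case (elim n)
    have "real (f n) / real n \<le> (d * real n + C) / real n" using C[of n] by (intro divide_right_mono) auto
    also have "\<dots> = d + C / real n" using elim(2) by (simp add: field_simps)
    finally show ?case using elim(1) by simp
  qed
qed

lemma slope_ge_eventually:
  assumes "slope_ge f d" "e < d"
  shows "\<forall>\<^sub>F n in sequentially. e < real (f n) / real n"
proof -
  obtain C where C: "\<And>n. d * real n - C \<le> real (f n)" using assms(1) unfolding slope_ge_def by blast
  have "(\<lambda>n. d - C / real n) \<longlonglongrightarrow> d - 0" by (intro tendsto_intros lim_const_over_n)
  then have "\<forall>\<^sub>F n in sequentially. e < d - C / real n" using assms(2) by (intro order_tendstoD(1)) auto
  then show ?thesis using eventually_gt_at_top[of 0]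
  proof eventually_elim
    case (elim n)
    have "d - C / real n = (d * real n - C) / real n" using elim(2) by (simp add: field_simps)
    also have "\<dots> \<le> real (f n) / real n" using C[of n] by (intro divide_right_mono) auto
    finally show ?case using elim(1) by simp
  qed
qed

text \<open>The limit is the infimum of the asymptotic upper bounds for the slope: each smaller number \<open>d \<ge> L\<close> is not an upper bound,
  hence lies below an asymptotic lower bound.\<close>

lemma slope_limit:
  assumes up: "slope_le f u" and lo: "slope_ge f L"
    and dich: "\<And>d. L \<le> d \<Longrightarrow> slope_le f d \<or> (\<exists>d'>d. slope_ge f d')"
  obtains l where "(\<lambda>n. real (f n) / real n) \<longlonglongrightarrow> l" "L \<le> l" "l \<le> u"
proof -
  have sep: "d \<le> e" if "slope_ge f d" "slope_le f e" for d e
  proof (rule ccontr)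
    assume "\<not> d \<le> e"
    then obtain m where m: "e < m" "m < d" using dense[of e d] by auto
    have "\<forall>\<^sub>F n in sequentially. False"
      using slope_ge_eventually[OF that(1) m(2)] slope_le_eventually[OF that(2) m(1)]
      by eventually_elim simp
    then show False by simp
  qed
  define S where "S = {d. slope_le f d}"
  define l where "l = Inf S"
  have S: "u \<in> S" "\<And>d. d \<in> S \<Longrightarrow> L \<le> d" using up sep[OF lo] by (auto simp: S_def)
  then have bdd: "bdd_below S" by (intro bdd_belowI[of S L])
  have Ll: "L \<le> l" unfolding l_def by (rule cInf_greatest) (use S in auto)
  have lu: "l \<le> u" unfolding l_def by (rule cInf_lower[OF S(1) bdd])
  have "(\<lambda>n. real (f n) / real n) \<longlonglongrightarrow> l"
  proof (rule order_tendstoI)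
    fix a assume "a < l"
    have "\<exists>d>a. slope_ge f d"
    proof (cases "L \<le> a")
      case True
      have "\<not> slope_le f a" using cInf_lower[of a S] bdd \<open>a < l\<close> by (auto simp: S_def l_def)
      then show ?thesis using dich[OF True] by blast
    next
      case False
      then show ?thesis using lo by (intro exI[of _ L]) auto
    qed
    then show "\<forall>\<^sub>F n in sequentially. a < real (f n) / real n" using slope_ge_eventually by blast
  next
    fix a assume "l < a"
    then obtain d where "d \<in> S" "d < a" using cInf_lessD[of S a] S(1) by (auto simp: l_def)
    then show "\<forall>\<^sub>F n in sequentially. real (f n) / real n < a" using slope_le_eventually by (auto simp: S_def)
  qed
  then show ?thesis using that Ll lu by blast
qed

lemma limiting_density_eq:
  assumes "\<not> finite_class \<G>" "(\<lambda>n. real (ex_edges \<G> n) / real n) \<longlonglongrightarrow> l"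
  shows "limiting_density \<G> = ereal l"
proof -
  have "(\<lambda>n. ereal (real (ex_edges \<G> n) / real n)) \<longlonglongrightarrow> ereal l" using assms(2) by simp
  then show ?thesis using assms(1) by (simp add: limiting_density_def limI)
qed

lemma slope_ge_density:
  assumes "slope_ge (ex_edges \<G>) d" "e < d" "(\<lambda>n. real (ex_edges \<G> n) / real n) \<longlonglongrightarrow> l"
  shows "e < l"
proof -
  obtain m where m: "e < m" "m < d" using dense[OF assms(2)] by blast
  have "m \<le> l"
    by (rule tendsto_lowerbound[OF assms(3)])
       (use slope_ge_eventually[OF assms(1) m(2)] in \<open>auto elim: eventually_mono\<close>)
  then show ?thesis using m by simp
qed

subsection \<open>Classes generated by disjoint copies\<close>

lemma card_edges_copies: "simple_graph H \<Longrightarrow> card (edges (copies k H)) = k * card (edges H)"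
proof -
  assume H: "simple_graph H"
  have "edges (copies k H) = (\<lambda>(i, e). Pair i ` e) ` ({..<k} \<times> edges H)"
    unfolding edges_copies by auto
  moreover have "inj_on (\<lambda>(i, e). Pair i ` e) ({..<k} \<times> edges H)"
  proof (rule inj_onI)
    fix p q assume pq: "p \<in> {..<k} \<times> edges H" "q \<in> {..<k} \<times> edges H"
      "(\<lambda>(i, e). Pair i ` e) p = (\<lambda>(i, e). Pair i ` e) q"
    obtain i e j d where ij: "p = (i, e)" "q = (j, d)" "e \<in> edges H" "d \<in> edges H" using pq by auto
    have eq: "Pair i ` e = Pair j ` d" using pq(3) ij by simp
    have "snd ` Pair i ` e = snd ` Pair j ` d" using eq by simp
    then have "e = d" by (simp add: image_comp)
    moreover obtain x where "x \<in> e" using edgeE[OF H ij(3)] by blast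
    then have "(i, x) \<in> Pair j ` d" using eq by blast
    then have "i = j" by auto
    ultimately show "p = q" using ij by simp
  qed
  ultimately show ?thesis by (simp add: card_image card_cartesian_product)
qed

text \<open>As many whole copies as fit, filled up with vertices of one more copy.\<close>

lemma copies_class_member:
  assumes H: "simple_graph H" and v: "verts H \<noteq> {}"
  shows "\<exists>R\<in>copies_class H. card (verts R) = n \<and> n div card (verts H) * card (edges H) \<le> card (edges R)"
proof -
  let ?v = "card (verts H)" and ?k = "n div card (verts H)"
  let ?X = "copies (Suc ?k) H"
  have fv: "finite (verts H)" by (rule finite_verts[OF H])
  have v0: "0 < ?v" using v fv by (simp add: card_gt_0_iff)
  have "card ({..<?k} \<times> verts H) \<le> n" by (simp add: card_cartesian_product)
  moreover have "n \<le> card (verts ?X)"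
  proof -
    have "n mod ?v < ?v" using v0 by simp
    moreover have "n = ?k * ?v + n mod ?v" by simp
    ultimately have "n \<le> ?k * ?v + ?v" by linarith
    then show ?thesis by (simp add: card_cartesian_product)
  qed
  moreover have "{..<?k} \<times> verts H \<subseteq> verts ?X" by auto
  ultimately obtain W where W: "{..<?k} \<times> verts H \<subseteq> W" "W \<subseteq> verts ?X" "card W = n"
    using exists_subset_between[of "{..<?k} \<times> verts H" n "verts ?X"] fv by auto
  note sX = simple_copies[OF H, of "Suc ?k"]
  note sW = simple_graph_induced[OF sX W(2)]
  obtain R :: "nat sgraph" where R: "graph_iso (induced ?X W) R" using nat_copy[OF sW] .
  have sR: "simple_graph R" using R by (auto elim: graph_isoE)
  have "minor R (induced ?X W)" using graph_iso_minor graph_iso_sym R by blast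
  then have "minor R ?X" using minor_trans[OF sR _ minor_induced[OF sX W(2)]] by blast
  then have "R \<in> copies_class H" using sR unfolding copies_class_def by (auto intro!: exI[of _ "Suc ?k"])
  moreover have "card (verts R) = n" using graph_iso_card(1)[OF R] W(3) by simp
  moreover have "?k * card (edges H) \<le> card (edges R)"
  proof -
    have "edges (copies ?k H) \<subseteq> edges (induced ?X W)"
    proof
      fix e assume e: "e \<in> edges (copies ?k H)"
      have "e \<subseteq> verts (copies ?k H)" using e simple_copies[OF H, of ?k] unfolding simple_graph_def by blast
      then have "e \<subseteq> W" using W(1) by auto
      moreover obtain i d where "e = Pair i ` d" "i < ?k" "d \<in> edges H" using e unfolding edges_copies by blast
      then have "e \<in> edges ?X" unfolding edges_copies using less_SucI by blast
      ultimately show "e \<in> edges (induced ?X W)" by simp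
    qed
    then have "card (edges (copies ?k H)) \<le> card (edges (induced ?X W))"
      by (rule card_mono[OF finite_edges[OF sW]])
    then show ?thesis using graph_iso_card(2)[OF R] card_edges_copies[OF H] by simp
  qed
  ultimately show ?thesis by blast
qed

lemma copies_slope_ge:
  assumes \<G>: "minor_closed_class \<G>" and H: "simple_graph H" "verts H \<noteq> {}" and sub: "copies_class H \<subseteq> \<G>"
  shows "slope_ge (ex_edges \<G>) (real (card (edges H)) / real (card (verts H)))"
  unfolding slope_ge_def
proof (intro exI allI)
  fix n
  let ?v = "card (verts H)" and ?e = "card (edges H)"
  have v0: "0 < ?v" using H(2) finite_verts[OF H(1)] by (simp add: card_gt_0_iff)
  obtain R where R: "R \<in> \<G>" "card (verts R) = n" "n div ?v * ?e \<le> card (edges R)"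
    using copies_class_member[OF H, of n] sub by blast
  have "real n / real ?v - 1 \<le> real (n div ?v)"
  proof -
    have "n < ?v + n div ?v * ?v" by (rule dividend_less_div_times[OF v0])
    then have "real n \<le> real (?v + n div ?v * ?v)" by linarith
    also have "\<dots> = (real (n div ?v) + 1) * real ?v" by (simp add: algebra_simps)
    finally have "real n / real ?v \<le> real (n div ?v) + 1" using v0 by (simp add: divide_le_eq)
    then show ?thesis by simp
  qed
  then have "(real n / real ?v - 1) * real ?e \<le> real (n div ?v) * real ?e" by (rule mult_right_mono) simp
  also have "\<dots> \<le> real (card (edges R))" using R(3) by (metis of_nat_le_iff of_nat_mult)
  also have "\<dots> \<le> real (ex_edges \<G> n)" using ex_edges_ge[OF \<G> R(1,2)] by simp
  finally show "real ?e / real ?v * real n - real ?e \<le> real (ex_edges \<G> n)" by (simp add: algebra_simps)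
qed

lemma not_copies_class:
  assumes \<G>: "minor_closed_class \<G>" and "\<not> copies_class H \<subseteq> \<G>"
  obtains k where "\<And>G. G \<in> \<G> \<Longrightarrow> \<not> minor (copies k H) G"
proof -
  obtain X k where X: "simple_graph X" "minor X (copies k H)" "X \<notin> \<G>"
    using assms(2) unfolding copies_class_def by blast
  have "\<not> minor (copies k H) G" if "G \<in> \<G>" for G
    using minor_trans[OF X(1,2)] class_closed[OF \<G> that X(1)] X(3) by blast
  then show ?thesis using that by blast
qed

definition packs :: "nat sgraph set \<Rightarrow> nat sgraph \<Rightarrow> nat set set \<Rightarrow> bool" where
  "packs Rs G \<S> \<longleftrightarrow> finite \<S> \<and> (\<forall>S\<in>\<S>. S \<subseteq> verts G \<and> (\<exists>R\<in>Rs. minor R (induced G S))) \<and>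
     (\<forall>S\<in>\<S>. \<forall>T\<in>\<S>. S \<noteq> T \<longrightarrow> S \<inter> T = {})"

text \<open>By pigeonhole, a large packing contains many disjoint models of one and the same member of \<open>Rs\<close>.\<close>

lemma packing_bounded:
  assumes \<G>: "minor_closed_class \<G>" and Rs: "finite Rs" "\<And>R. R \<in> Rs \<Longrightarrow> simple_graph R"
    and no: "\<And>R. R \<in> Rs \<Longrightarrow> \<exists>k. \<forall>G\<in>\<G>. \<not> minor (copies k R) G"
  obtains N where "\<And>G \<S>. G \<in> \<G> \<Longrightarrow> packs Rs G \<S> \<Longrightarrow> card \<S> \<le> N"
proof -
  obtain k where k: "\<And>R G. R \<in> Rs \<Longrightarrow> G \<in> \<G> \<Longrightarrow> \<not> minor (copies (k R) R) G" using no by metis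
  define N where "N = (\<Sum>R\<in>Rs. k R)"
  have "card \<S> \<le> N" if G: "G \<in> \<G>" and pack: "packs Rs G \<S>" for G \<S>
  proof -
    have fin: "finite \<S>" and S: "\<And>S. S \<in> \<S> \<Longrightarrow> S \<subseteq> verts G \<and> (\<exists>R\<in>Rs. minor R (induced G S))"
      and disj: "\<And>S T. S \<in> \<S> \<Longrightarrow> T \<in> \<S> \<Longrightarrow> S \<noteq> T \<Longrightarrow> S \<inter> T = {}"
      using pack unfolding packs_def by simp_all
    let ?F = "\<lambda>R. {S \<in> \<S>. minor R (induced G S)}"
    have "\<S> \<subseteq> (\<Union>R\<in>Rs. ?F R)" using S by blast
    then have "card \<S> \<le> card (\<Union>R\<in>Rs. ?F R)" using fin Rs(1) by (intro card_mono) auto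
    also have "\<dots> \<le> (\<Sum>R\<in>Rs. card (?F R))" by (rule card_UN_le[OF Rs(1)])
    also have "\<dots> \<le> (\<Sum>R\<in>Rs. k R)"
    proof (rule sum_mono)
      fix R assume R: "R \<in> Rs"
      show "card (?F R) \<le> k R"
      proof (rule ccontr)
        assume "\<not> card (?F R) \<le> k R"
        then obtain f where f: "inj_on f {..<k R}" "f ` {..<k R} \<subseteq> ?F R"
          using indexed_subset[of "?F R" "k R"] fin by auto
        have fi: "f i \<in> \<S>" "minor R (induced G (f i))" if "i < k R" for i using f(2) that by auto
        have "minor (copies (k R) R) G"
        proof (rule minor_copies_disjoint[OF Rs(2)[OF R], where S = f])
          fix i assume i: "i < k R"
          show "f i \<subseteq> verts G" using S[OF fi(1)[OF i]] by blast
          show "minor R (induced G (f i))" by (rule fi(2)[OF i])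
          fix j assume j: "j < k R" "i \<noteq> j"
          then have "f i \<noteq> f j" using f(1) i by (auto simp: inj_on_def)
          then show "f i \<inter> f j = {}" using disj fi(1) i j by blast
        qed
        then show False using k[OF R G] by simp
      qed
    qed
    finally show ?thesis by (simp add: N_def)
  qed
  then show ?thesis by (rule that)
qed

lemma slope_le_class:
  assumes \<G>: "minor_closed_class \<G>" and inf: "\<not> finite_class \<G>"
    and b: "\<And>G. G \<in> \<G> \<Longrightarrow> real (card (edges G)) \<le> d * real (card (verts G)) + C"
  shows "slope_le (ex_edges \<G>) d"
  unfolding slope_le_def
proof (intro exI allI)
  fix n
  obtain G where "G \<in> \<G>" "card (verts G) = n" using infinite_class_all_sizes[OF \<G> inf] by blast
  then obtain H where "H \<in> \<G>" "card (verts H) = n" "card (edges H) = ex_edges \<G> n"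
    using ex_edges_attained[OF \<G>] by metis
  then show "real (ex_edges \<G> n) \<le> d * real n + C" using b[of H] by simp
qed

subsection \<open>Classes with bounded components\<close>

definition components_le :: "nat \<Rightarrow> 'a sgraph \<Rightarrow> bool" where
  "components_le B G \<longleftrightarrow> (\<forall>S\<subseteq>verts G. conn G S \<longrightarrow> card S \<le> B)"

lemma components_le_induced: "components_le B G \<Longrightarrow> W \<subseteq> verts G \<Longrightarrow> components_le B (induced G W)"
  unfolding components_le_def by (auto simp: conn_induced)

text \<open>Components are removed one at a time; the dense ones enter the packing and account for at most \<open>B\<^sup>2\<close>
  edges each.\<close>

lemma bounded_component_packing:
  fixes d :: real
  assumes "simple_graph G" "components_le B G" and d: "0 \<le> d"
  shows "\<exists>\<S>. dense_packing d G \<S> \<and> (\<forall>S\<in>\<S>. card S \<le> B) \<and>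
    real (card (edges G)) \<le> d * real (card (verts G)) + real (B * B) * real (card \<S>)"
  using assms(1,2)
proof (induction "card (verts G)" arbitrary: G rule: less_induct)
  case less
  note G = less.prems(1)
  have fin: "finite (verts G)" by (rule finite_verts[OF G])
  show ?case
  proof (cases "verts G = {}")
    case True
    then have "edges G = {}" using G by (auto simp: simple_graph_def)
    then show ?thesis using True by (intro exI[of _ "{}"]) (simp add: dense_packing_empty)
  next
    case False
    then obtain u where "u \<in> verts G" by blast
    then obtain T where T: "u \<in> T" "T \<subseteq> verts G" "conn G T" "\<not> touches G T (verts G - T)"
      by (rule component_exists)
    let ?W = "verts G - T"
    have TB: "card T \<le> B" using less.prems(2) T by (auto simp: components_le_def)
    have "card (verts (induced G ?W)) < card (verts G)"
      using psubset_card_mono[OF fin, of ?W] T by auto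
    then obtain \<T> where IH: "dense_packing d (induced G ?W) \<T>" "\<forall>S\<in>\<T>. card S \<le> B"
      "real (card (edges (induced G ?W))) \<le> d * real (card ?W) + real (B * B) * real (card \<T>)"
      using less.hyps[of "induced G ?W"] simple_graph_induced[OF G, of ?W] components_le_induced[OF less.prems(2), of ?W]
      by auto
    note le = closed_split(1)[OF G T(2,4)]
    have sT: "simple_graph (induced G T)" by (rule simple_graph_induced[OF G T(2)])
    note cv = closed_split(2)[OF G T(2,4)]
    show ?thesis
    proof (cases "dense d G T")
      case True
      have "dense_packing d (induced G T) {T}"
        using True by (intro dense_packing_single) (simp_all add: dense_induced)
      note pack = dense_packing_Un[OF this IH(1) T(2) _ _ G]
      have "card (edges (induced G T)) \<le> card T * card T" using card_edges_le_square[OF sT] by simp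
      also have "\<dots> \<le> B * B" using TB by (intro mult_le_mono)
      finally have "real (card (edges (induced G T))) \<le> real (B * B)" by (simp only: of_nat_le_iff)
      moreover have "card ({T} \<union> \<T>) = 1 + card \<T>" using pack(2) by auto
      moreover have "0 \<le> d * real (card T)" using d by simp
      ultimately have "real (card (edges G)) \<le> d * real (card (verts G)) + real (B * B) * real (card ({T} \<union> \<T>))"
        using IH(3) le cv by (simp add: algebra_simps del: edges_induced Un_insert_left card.insert)
      then show ?thesis using pack(1) IH(2) TB by (intro exI[of _ "{T} \<union> \<T>"]) auto
    next
      case False
      then have "real (card (edges (induced G T))) \<le> d * real (card T)" by (simp add: dense_def del: edges_induced)
      then have "real (card (edges G)) \<le> d * real (card (verts G)) + real (B * B) * real (card \<T>)"
        using IH(3) le cv by (simp add: algebra_simps del: edges_induced)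
      then show ?thesis using dense_packing_induced[OF IH(1)] IH(2) by (intro exI[of _ \<T>]) auto
    qed
  qed
qed

lemma components_le_class:
  assumes \<G>: "minor_closed_class \<G>" and B: "\<And>G. G \<in> \<G> \<Longrightarrow> graph_connected G \<Longrightarrow> card (verts G) \<le> B" and G: "G \<in> \<G>"
  shows "components_le B G"
  unfolding components_le_def
proof (intro allI impI)
  fix S assume S: "S \<subseteq> verts G" "conn G S"
  note s = class_simple[OF \<G> G]
  have "induced G S \<in> \<G>" using class_closed[OF \<G> G simple_graph_induced[OF s S(1)] minor_induced[OF s S(1)]] .
  then show "card S \<le> B" using B[of "induced G S"] S(2) by (simp add: conn_def)
qed

text \<open>There are finitely many dense graphs with at most \<open>B\<close> vertices.  Either copies of one of them are
  unlimited in \<open>\<G>\<close>, or the number of dense components is bounded.\<close>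

lemma bounded_component_dichotomy:
  fixes d :: real
  assumes \<G>: "minor_closed_class \<G>" and inf: "\<not> finite_class \<G>"
    and B: "\<And>G. G \<in> \<G> \<Longrightarrow> graph_connected G \<Longrightarrow> card (verts G) \<le> B" and d: "0 \<le> d"
  shows "slope_le (ex_edges \<G>) d \<or> (\<exists>d'>d. slope_ge (ex_edges \<G>) d')"
proof -
  define Rs where "Rs = {R :: nat sgraph. simple_graph R \<and> verts R \<subseteq> {..<Suc B} \<and>
    d * real (card (verts R)) < real (card (edges R))}"
  have finRs: "finite Rs" by (rule finite_subset[OF _ finite_graphs_below[of "Suc B"]]) (auto simp: Rs_def)
  show ?thesis
  proof (cases "\<exists>R\<in>Rs. copies_class R \<subseteq> \<G>")
    case True
    then obtain R where R: "R \<in> Rs" "copies_class R \<subseteq> \<G>" by blast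
    have s: "simple_graph R" and de: "d * real (card (verts R)) < real (card (edges R))" using R by (auto simp: Rs_def)
    have ne: "verts R \<noteq> {}"
    proof
      assume e: "verts R = {}"
      then have "edges R = {}" using s by (auto simp: simple_graph_def)
      then show False using e de by simp
    qed
    then have "0 < card (verts R)" using finite_verts[OF s] by (simp add: card_gt_0_iff)
    then have "d < real (card (edges R)) / real (card (verts R))" using de by (simp add: less_divide_eq)
    then show ?thesis using copies_slope_ge[OF \<G> s ne R(2)] by blast
  next
    case False
    have no: "\<exists>k. \<forall>G\<in>\<G>. \<not> minor (copies k R) G" if "R \<in> Rs" for R
      using not_copies_class[OF \<G>, of R] False that by metis
    have sRs: "simple_graph R" if "R \<in> Rs" for R using that by (simp add: Rs_def)
    obtain N where N: "\<And>G \<S>. G \<in> \<G> \<Longrightarrow> packs Rs G \<S> \<Longrightarrow> card \<S> \<le> N"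
      using packing_bounded[OF \<G> finRs sRs no] by blast
    have "slope_le (ex_edges \<G>) d"
    proof (rule slope_le_class[OF \<G> inf])
      fix G assume G: "G \<in> \<G>"
      note s = class_simple[OF \<G> G]
      have "components_le B G" by (rule components_le_class[OF \<G> _ G]) (rule B)
      from bounded_component_packing[OF s this d] obtain \<S> where S: "dense_packing d G \<S>" "\<forall>S\<in>\<S>. card S \<le> B"
        "real (card (edges G)) \<le> d * real (card (verts G)) + real (B * B) * real (card \<S>)"
        by blast
      have "\<exists>R\<in>Rs. minor R (induced G S)" if "S \<in> \<S>" for S
      proof -
        have SS: "S \<subseteq> verts G" "dense d G S" "card S \<le> B" using S that by (auto simp: dense_packing_def)
        obtain R :: "nat sgraph" where R: "graph_iso (induced G S) R" "verts R = {..<card S}"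
          using nat_copy[OF simple_graph_induced[OF s SS(1)]] by auto
        have "R \<in> Rs" using R SS graph_iso_card[OF R(1)] unfolding Rs_def dense_def
          by (auto elim: graph_isoE simp del: edges_induced)
        then show ?thesis using graph_iso_minor graph_iso_sym R(1) by blast
      qed
      then have "packs Rs G \<S>" using S(1) unfolding packs_def dense_packing_def by simp
      then have "card \<S> \<le> N" by (rule N[OF G])
      then have "real (B * B) * real (card \<S>) \<le> real (B * B) * real N" by (intro mult_left_mono) auto
      then show "real (card (edges G)) \<le> d * real (card (verts G)) + real (B * B) * real N" using S(3) by linarith
    qed
    then show ?thesis ..
  qed
qed

section \<open>The obstructions are minor-closed classes of large density\<close>

lemma connected_in_copies_class:
  assumes H: "simple_graph H" and G: "G \<in> copies_class H" "graph_connected G"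
  shows "card (verts G) \<le> card (verts H)"
proof -
  obtain k where "simple_graph G" "minor G (copies k H)" using G(1) by (auto simp: copies_class_def)
  then have "minor G H" using connected_minor_of_copies[OF H _ G(2)] by blast
  then show ?thesis by (rule minor_card_verts[OF _ finite_verts[OF H]])
qed

text \<open>A complete graph on more than \<open>card (verts H)\<close> vertices shows that the class is proper.\<close>

lemma copies_class_minor_closed:
  assumes H: "simple_graph H"
  shows "minor_closed_class (copies_class H)"
  unfolding minor_closed_class_def
proof (intro conjI ballI allI impI)
  show "simple_graph G" if "G \<in> copies_class H" for G using that by (simp add: copies_class_def)
  show "K \<in> copies_class H" if G: "G \<in> copies_class H" and K: "simple_graph K \<and> minor K G" for G K
  proof -
    obtain k where "1 \<le> k" "minor G (copies k H)" using G by (auto simp: copies_class_def)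
    moreover from this have "minor K (copies k H)" using minor_trans[of K G "copies k H"] K by blast
    ultimately show ?thesis using K by (auto simp: copies_class_def)
  qed
  let ?K = "complete_graph {..<Suc (card (verts H))} :: nat sgraph"
  have "?K \<notin> copies_class H"
  proof
    assume K: "?K \<in> copies_class H"
    have "graph_connected ?K" by (rule complete_connected) (simp_all add: lessThan_Suc)
    then have "card (verts ?K) \<le> card (verts H)" by (rule connected_in_copies_class[OF H K])
    then show False by (simp add: complete_graph_def)
  qed
  moreover have "simple_graph ?K" by (rule simple_complete) simp
  ultimately show "copies_class H \<noteq> {G. simple_graph G}" by blast
qed

lemma components_le_edges:
  assumes G: "simple_graph G" and B: "components_le B G"
  shows "card (edges G) \<le> card (verts G) * B"
proof -
  have fin: "finite (verts G)" by (rule finite_verts[OF G])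
  have nb: "nbhd G v \<subseteq> verts G" for v using edge_verts[OF G] by (auto simp: nbhd_def)
  have fnb: "finite (nbhd G v)" for v by (rule finite_subset[OF nb fin])
  have deg: "card (nbhd G v) \<le> B" if v: "v \<in> verts G" for v
  proof -
    have "conn G ({v} \<union> (\<Union>u\<in>nbhd G v. {u}))"
      by (rule conn_UN) (auto simp: nbhd_def touches_def)
    then have "card (insert v (nbhd G v)) \<le> B"
      using B nb[of v] v unfolding components_le_def by simp
    then show ?thesis using card_mono[of "insert v (nbhd G v)" "nbhd G v"] fnb[of v] by fastforce
  qed
  have "edges G \<subseteq> (\<Union>v\<in>verts G. (\<lambda>u. {u, v}) ` nbhd G v)"
  proof
    fix e assume e: "e \<in> edges G"
    then obtain u v where "e = {u, v}" "v \<in> verts G" using edgeE[OF G] by metis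
    then show "e \<in> (\<Union>v\<in>verts G. (\<lambda>u. {u, v}) ` nbhd G v)" using e by (auto simp: nbhd_def)
  qed
  then have "card (edges G) \<le> card (\<Union>v\<in>verts G. (\<lambda>u. {u, v}) ` nbhd G v)"
    using fin fnb by (intro card_mono) auto
  also have "\<dots> \<le> (\<Sum>v\<in>verts G. card ((\<lambda>u. {u, v}) ` nbhd G v))" by (rule card_UN_le[OF fin])
  also have "\<dots> \<le> (\<Sum>v\<in>verts G. B)"
    by (rule sum_mono[OF le_trans[OF card_image_le[OF fnb] deg]])
  finally show ?thesis by simp
qed

text \<open>The components of members are bounded by the size of \<open>H\<close>, so the dichotomy yields a limit, which is at least
  the density of \<open>H\<close>.\<close>

lemma copies_class_density:
  fixes d :: real
  assumes H: "simple_graph H" and d: "d * real (card (verts H)) < real (card (edges H))"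
  shows "\<not> limiting_density (copies_class H) \<le> ereal d"
proof -
  let ?\<G> = "copies_class H"
  have ne: "verts H \<noteq> {}"
  proof
    assume e: "verts H = {}"
    then have "edges H = {}" using H by (auto simp: simple_graph_def)
    then show False using e d by simp
  qed
  then have v0: "0 < card (verts H)" using finite_verts[OF H] by (simp add: card_gt_0_iff)
  note \<G> = copies_class_minor_closed[OF H]
  have inf: "\<not> finite_class ?\<G>"
    by (rule all_sizes_infinite_class) (use copies_class_member[OF H ne] in blast)
  have B: "card (verts G) \<le> card (verts H)" if "G \<in> ?\<G>" "graph_connected G" for G
    by (rule connected_in_copies_class[OF H that])
  have up: "slope_le (ex_edges ?\<G>) (real (card (verts H)))"
  proof (rule slope_le_class[OF \<G> inf, where C = 0])
    fix G assume G: "G \<in> ?\<G>"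
    have "card (edges G) \<le> card (verts G) * card (verts H)"
      by (rule components_le_edges[OF class_simple[OF \<G> G] components_le_class[OF \<G> _ G]]) (rule B)
    then have "real (card (edges G)) \<le> real (card (verts G) * card (verts H))" by (simp only: of_nat_le_iff)
    then show "real (card (edges G)) \<le> real (card (verts H)) * real (card (verts G)) + 0" by (simp add: mult.commute)
  qed
  have lo: "slope_ge (ex_edges ?\<G>) 0" unfolding slope_ge_def by (intro exI[of _ 0]) simp
  obtain l where l: "(\<lambda>n. real (ex_edges ?\<G> n) / real n) \<longlonglongrightarrow> l" "0 \<le> l" "l \<le> real (card (verts H))"
    by (rule slope_limit[OF up lo bounded_component_dichotomy[OF \<G> inf B]])
  have "d < real (card (edges H)) / real (card (verts H))" using d v0 by (simp add: less_divide_eq)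
  then have "d < l" by (rule slope_ge_density[OF copies_slope_ge[OF \<G> H ne order_refl] _ l(1)])
  then show ?thesis using limiting_density_eq[OF inf l(1)] by simp
qed

lemma exact_slope_density:
  fixes d s :: real
  assumes inf: "\<not> finite_class \<G>" and up: "slope_le (ex_edges \<G>) s" and lo: "slope_ge (ex_edges \<G>) s" and d: "d < s"
  shows "\<not> limiting_density \<G> \<le> ereal d"
proof -
  have mono: "slope_le (ex_edges \<G>) e" if "s \<le> e" for e
  proof -
    obtain C where C: "\<And>n. real (ex_edges \<G> n) \<le> s * real n + C" using up unfolding slope_le_def by blast
    have "real (ex_edges \<G> n) \<le> e * real n + C" for n
      using C[of n] mult_right_mono[OF that, of "real n"] by simp
    then show ?thesis unfolding slope_le_def by blast
  qed
  obtain l where l: "(\<lambda>n. real (ex_edges \<G> n) / real n) \<longlonglongrightarrow> l" "s \<le> l" "l \<le> s"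
    by (rule slope_limit[OF up lo disjI1[OF mono]])
  then show ?thesis using limiting_density_eq[OF inf l(1)] d by simp
qed

text \<open>The common form of \<open>daisy_class\<close> and \<open>diamond_class\<close>.\<close>

definition family_class :: "(nat \<Rightarrow> nat sgraph) \<Rightarrow> nat sgraph set" where
  "family_class X = {G. simple_graph G \<and> (\<exists>k\<ge>1. minor G (X k))}"

lemma daisy_class_family: "daisy_class = family_class daisy"
  and diamond_class_family: "diamond_class = family_class diamond"
  by (simp_all add: daisy_class_def diamond_class_def family_class_def)

lemma family_class_minor_closed:
  assumes b: "\<And>G. G \<in> family_class X \<Longrightarrow> card (edges G) \<le> 2 * card (verts G)"
  shows "minor_closed_class (family_class X)"
  unfolding minor_closed_class_def
proof (intro conjI ballI allI impI)
  show "simple_graph G" if "G \<in> family_class X" for G using that by (simp add: family_class_def)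
  show "K \<in> family_class X" if G: "G \<in> family_class X" and K: "simple_graph K \<and> minor K G" for G K
  proof -
    obtain k where "1 \<le> k" "minor G (X k)" using G by (auto simp: family_class_def)
    moreover from this have "minor K (X k)" using minor_trans[of K G "X k"] K by blast
    ultimately show ?thesis using K by (auto simp: family_class_def)
  qed
  let ?K = "complete_graph {..<6::nat}"
  have "card {e. e \<subseteq> {..<6::nat} \<and> card e = 2} = 15" by (subst n_subsets) (simp_all add: choose_two)
  then have "?K \<notin> family_class X" using b[of ?K] by (auto simp: complete_graph_def)
  moreover have "simple_graph ?K" by (rule simple_complete) simp
  ultimately show "family_class X \<noteq> {G. simple_graph G}" by blast
qed

lemma family_class_density:
  fixes s d :: real
  assumes b: "\<And>G. G \<in> family_class X \<Longrightarrow> card (edges G) \<le> 2 * card (verts G)"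
    and up: "\<And>G. G \<in> family_class X \<Longrightarrow> real (card (edges G)) \<le> s * real (card (verts G))"
    and lo: "\<And>n. \<exists>G\<in>family_class X. card (verts G) = n \<and> s * real n - C \<le> real (card (edges G))"
    and d: "d < s"
  shows "\<not> limiting_density (family_class X) \<le> ereal d"
proof (rule exact_slope_density[OF _ _ _ d])
  note \<G> = family_class_minor_closed[OF b]
  show inf: "\<not> finite_class (family_class X)" by (rule all_sizes_infinite_class) (use lo in blast)
  show "slope_le (ex_edges (family_class X)) s"
    by (rule slope_le_class[OF \<G> inf, where C = 0]) (use up in auto)
  show "slope_ge (ex_edges (family_class X)) s"
    unfolding slope_ge_def
  proof (intro exI allI)
    fix n
    obtain G where G: "G \<in> family_class X" "card (verts G) = n" "s * real n - C \<le> real (card (edges G))" using lo by blast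
    then have "card (edges G) \<le> ex_edges (family_class X) n" by (intro ex_edges_ge[OF family_class_minor_closed[OF b]])
    then show "s * real n - C \<le> real (ex_edges (family_class X) n)" using G(3) by linarith
  qed
qed

lemma card_edges_through:
  assumes "simple_graph G"
  shows "card {e \<in> edges G. c \<in> e} \<le> card (verts G)"
proof -
  have "{e \<in> edges G. c \<in> e} \<subseteq> (\<lambda>u. {u, c}) ` verts G"
  proof
    fix e assume e: "e \<in> {e \<in> edges G. c \<in> e}"
    then have "e \<in> edges G" "c \<in> e" by auto
    then obtain u v where uv: "e = {u, v}" "u \<in> verts G" "v \<in> verts G" using edgeE[OF assms] by metis
    then have "c = u \<or> c = v" using e by auto
    then show "e \<in> (\<lambda>u. {u, c}) ` verts G" using uv by (auto simp: insert_commute)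
  qed
  then show ?thesis by (meson assms card_image_le card_mono finite_imageI finite_verts le_trans)
qed

text \<open>Let \<open>c\<close> be the vertex whose branch set contains the centre.  The edges avoiding \<open>c\<close> are disjoint, since two of
  them meeting would need three branch sets within a single petal.\<close>

lemma daisy_minor_edges:
  assumes G: "simple_graph G" and m: "minor G (daisy k)"
  shows "2 * card (edges G) \<le> 3 * card (verts G)"
proof -
  obtain \<phi> where \<phi>: "\<And>x. x \<in> verts G \<Longrightarrow> \<phi> x \<subseteq> verts (daisy k) \<and> conn (daisy k) (\<phi> x)"
    "\<And>x y. x \<in> verts G \<Longrightarrow> y \<in> verts G \<Longrightarrow> x \<noteq> y \<Longrightarrow> \<phi> x \<inter> \<phi> y = {}"
    "\<And>x y. {x, y} \<in> edges G \<Longrightarrow> touches (daisy k) (\<phi> x) (\<phi> y)"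
    using m unfolding minor_iff by metis
  \<comment> \<open>If no branch set contains the centre, \<open>c\<close> is arbitrary and the argument is unaffected.\<close>
  define c where "c = (SOME c. c \<in> verts G \<and> 0 \<in> \<phi> c)"
  have c: "x = c" if "x \<in> verts G" "0 \<in> \<phi> x" for x
  proof -
    have "c \<in> verts G \<and> 0 \<in> \<phi> c" unfolding c_def by (rule someI[of _ x]) (use that in simp)
    then show ?thesis using \<phi>(2)[of x c] that by blast
  qed
  \<comment> \<open>the number of the petal that contains \<open>v\<close>\<close>
  let ?\<kappa> = "\<lambda>v::nat. (v + 1) div 2"
  have rim: "?\<kappa> a = ?\<kappa> b" if ab: "{a, b} \<in> edges (daisy k)" "a \<noteq> 0" "b \<noteq> 0" for a b
  proof -
    have "{a, b} \<in> {{0, i} | i. i \<in> {1..2 * k}} \<or> {a, b} \<in> {{2 * i - 1, 2 * i} | i. i \<in> {1..k}}"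
      using ab(1) unfolding daisy_def snd_conv by (rule UnE) blast+
    then have "\<exists>i\<ge>1. {a, b} = {2 * i - 1, 2 * i}"
    proof
      assume "{a, b} \<in> {{0, i} | i. i \<in> {1..2 * k}}"
      then show ?thesis using ab(2,3) by (auto simp: doubleton_eq_iff)
    qed auto
    then obtain i where i: "1 \<le> i" "{a, b} = {2 * i - 1, 2 * i}" by blast
    then have "a = 2 * i - 1 \<and> b = 2 * i \<or> a = 2 * i \<and> b = 2 * i - 1" by (simp add: doubleton_eq_iff)
    then show ?thesis using i(1) by auto
  qed
  have petal: "?\<kappa> a = ?\<kappa> b"
    if xy: "{x, y} \<in> edges G" "x \<noteq> c" "y \<noteq> c" and ab: "a \<in> \<phi> x \<union> \<phi> y" "b \<in> \<phi> x \<union> \<phi> y" for x y a b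
  proof -
    have v: "x \<in> verts G" "y \<in> verts G" using edge_verts[OF G xy(1)] by auto
    have cc: "conn (daisy k) (\<phi> x \<union> \<phi> y)"
      by (rule conn_Un) (use \<phi>(1)[OF v(1)] \<phi>(1)[OF v(2)] \<phi>(3)[OF xy(1)] in auto)
    have no0: "0 \<notin> \<phi> x \<union> \<phi> y" using c v xy by blast
    show ?thesis
    proof (rule conn_constant[where c = ?\<kappa>, OF cc _ ab])
      fix u w assume uw: "u \<in> \<phi> x \<union> \<phi> y" "w \<in> \<phi> x \<union> \<phi> y" "{u, w} \<in> edges (daisy k)"
      then have "u \<noteq> 0" "w \<noteq> 0" using no0 by metis+
      then show "?\<kappa> u = ?\<kappa> w" by (rule rim[OF uw(3)])
    qed
  qed
  let ?M = "{e \<in> edges G. c \<notin> e}"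
  have disj: "e \<inter> f = {}" if ef: "e \<in> ?M" "f \<in> ?M" "e \<noteq> f" for e f
  proof (rule ccontr)
    assume "e \<inter> f \<noteq> {}"
    then obtain x where x: "x \<in> e" "x \<in> f" by blast
    have other: "\<exists>y. d = {x, y} \<and> y \<noteq> x" if "d \<in> edges G" "x \<in> d" for d
      using edgeE[OF G that(1)] that(2) by (metis insertE insert_commute singletonD)
    obtain y z where y: "e = {x, y}" "y \<noteq> x" and z: "f = {x, z}" "z \<noteq> x" using other x ef by blast
    have e: "{x, y} \<in> edges G" "{x, z} \<in> edges G" "x \<noteq> c" "y \<noteq> c" "z \<noteq> c" using ef y z by auto
    have v: "x \<in> verts G" "y \<in> verts G" "z \<in> verts G" using edge_verts[OF G e(1)] edge_verts[OF G e(2)] by auto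
    have nonempty: "\<phi> w \<noteq> {}" if "w \<in> verts G" for w using \<phi>(1)[OF that] conn_nonempty[of "daisy k" "\<phi> w"] by simp
    obtain a b d where abd: "a \<in> \<phi> x" "b \<in> \<phi> y" "d \<in> \<phi> z"
      using nonempty[OF v(1)] nonempty[OF v(2)] nonempty[OF v(3)] by auto
    have ne: "a \<noteq> b" "a \<noteq> d" "b \<noteq> d" using \<phi>(2) v abd y z ef(3) by blast+
    have "a \<noteq> 0" "b \<noteq> 0" "d \<noteq> 0" using c v abd e by metis+
    moreover have "?\<kappa> a = ?\<kappa> b" "?\<kappa> a = ?\<kappa> d"
      using petal[OF e(1,3,4), of a b] petal[OF e(2,3,5), of a d] abd by blast+
    ultimately show False using ne by arith
  qed
  have finE: "finite (edges G)" by (rule finite_edges[OF G])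
  have "card (\<Union>e\<in>?M. e) = (\<Sum>e\<in>?M. card e)"
  proof (rule card_UN_disjoint)
    show "finite ?M" using finE by simp
    show "\<forall>e\<in>?M. finite e" using edgeE[OF G] by (metis (no_types, lifting) finite.emptyI finite_insert mem_Collect_eq)
    show "\<forall>e\<in>?M. \<forall>f\<in>?M. e \<noteq> f \<longrightarrow> e \<inter> f = {}" using disj by blast
  qed
  also have "\<dots> = card ?M * 2"
    by (rule sum_all_equal) (use G in \<open>auto simp: simple_graph_def\<close>)
  finally have "2 * card ?M = card (\<Union>e\<in>?M. e)" by simp
  also have "\<dots> \<le> card (verts G)"
    by (rule card_mono[OF finite_verts[OF G]]) (use G in \<open>auto simp: simple_graph_def\<close>)
  finally have M: "2 * card ?M \<le> card (verts G)" .
  have "edges G = {e \<in> edges G. c \<in> e} \<union> ?M" by auto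
  then have "card (edges G) \<le> card {e \<in> edges G. c \<in> e} + card ?M" by (metis card_Un_le)
  then show ?thesis using M card_edges_through[OF G, of c] by linarith
qed

text \<open>An edge of the diamond meets a hub, so an edge of the minor is incident with a vertex whose branch set
  contains a hub.\<close>

lemma diamond_minor_edges:
  assumes G: "simple_graph G" and m: "minor G (diamond k)"
  shows "card (edges G) \<le> 2 * card (verts G)"
proof -
  obtain \<phi> where \<phi>: "\<And>x y. x \<in> verts G \<Longrightarrow> y \<in> verts G \<Longrightarrow> x \<noteq> y \<Longrightarrow> \<phi> x \<inter> \<phi> y = {}"
    "\<And>x y. {x, y} \<in> edges G \<Longrightarrow> touches (diamond k) (\<phi> x) (\<phi> y)"
    using m unfolding minor_iff by metis
  define c where "c h = (SOME c. c \<in> verts G \<and> h \<in> \<phi> c)" for h :: nat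
  have c: "x = c h" if "x \<in> verts G" "h \<in> \<phi> x" for x h
  proof -
    have "c h \<in> verts G \<and> h \<in> \<phi> (c h)" unfolding c_def by (rule someI[of _ x]) (use that in simp)
    then show ?thesis using \<phi>(1)[of x "c h"] that by blast
  qed
  have "edges G \<subseteq> {e \<in> edges G. c 0 \<in> e} \<union> {e \<in> edges G. c 1 \<in> e}"
  proof
    fix e assume e: "e \<in> edges G"
    then obtain x y where xy: "e = {x, y}" "x \<in> verts G" "y \<in> verts G" using edgeE[OF G] by metis
    then obtain u w where uw: "u \<in> \<phi> x" "w \<in> \<phi> y" "{u, w} \<in> edges (diamond k)" using \<phi>(2)[of x y] e by (auto elim: touchesE)
    then have "u \<in> {0, 1} \<or> w \<in> {0, 1}" unfolding diamond_def by (auto simp: doubleton_eq_iff)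
    then show "e \<in> {e \<in> edges G. c 0 \<in> e} \<union> {e \<in> edges G. c 1 \<in> e}" using c uw(1,2) xy e by auto
  qed
  then have "card (edges G) \<le> card ({e \<in> edges G. c 0 \<in> e} \<union> {e \<in> edges G. c 1 \<in> e})"
    using finite_edges[OF G] by (intro card_mono) auto
  also have "\<dots> \<le> card {e \<in> edges G. c 0 \<in> e} + card {e \<in> edges G. c 1 \<in> e}" by (rule card_Un_le)
  also have "\<dots> \<le> 2 * card (verts G)" using card_edges_through[OF G, of "c 0"] card_edges_through[OF G, of "c 1"] by simp
  finally show ?thesis .
qed

lemma family_subgraph_member:
  assumes "simple_graph (X k)" "1 \<le> k" "S \<subseteq> verts (X k)"
  shows "induced (X k) S \<in> family_class X"
  using assms minor_induced[OF assms(1,3)] simple_graph_induced[OF assms(1,3)] by (auto simp: family_class_def)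

lemma daisy_class_member:
  "\<exists>G\<in>family_class daisy. card (verts G) = n \<and> 3 / 2 * real n - 3 \<le> real (card (edges G))"
proof -
  let ?X = "daisy (Suc n)" and ?S = "{..<n}"
  let ?E1 = "(\<lambda>i. {0, i}) ` {1..<n}" and ?E2 = "(\<lambda>i. {2 * i - 1, 2 * i}) ` {1..(n - 1) div 2}"
  have sX: "simple_graph ?X" by (rule simple_daisy)
  have SX: "?S \<subseteq> verts ?X" by (auto simp: daisy_def)
  have E1: "?E1 \<subseteq> edges (induced ?X ?S)"
  proof (rule image_subsetI)
    fix i assume i: "i \<in> {1..<n}"
    then have "{0, i} \<in> edges ?X" unfolding daisy_def by auto
    then show "{0, i} \<in> edges (induced ?X ?S)" using i by simp
  qed
  have E2: "?E2 \<subseteq> edges (induced ?X ?S)"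
  proof (rule image_subsetI)
    fix i assume i: "i \<in> {1..(n - 1) div 2}"
    then have "i \<in> {1..Suc n}" "2 * i < n" by auto
    then have "{2 * i - 1, 2 * i} \<in> edges ?X" "2 * i - 1 < n" "2 * i < n" unfolding daisy_def by auto
    then show "{2 * i - 1, 2 * i} \<in> edges (induced ?X ?S)" by simp
  qed
  have "inj_on (\<lambda>i. {0, i}) {1..<n}" by (auto simp: inj_on_def doubleton_eq_iff)
  then have c1: "card ?E1 = n - 1" by (simp add: card_image)
  have "inj_on (\<lambda>i. {2 * i - 1, 2 * i}) {1..(n - 1) div 2}"
    unfolding inj_on_def by (auto simp: doubleton_eq_iff)
  then have c2: "card ?E2 = (n - 1) div 2" by (simp add: card_image)
  have "?E1 \<inter> ?E2 = {}"
  proof -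
    have "0 \<in> e" if "e \<in> ?E1" for e using that by auto
    moreover have "0 \<notin> e" if "e \<in> ?E2" for e using that by auto
    ultimately show ?thesis by blast
  qed
  then have "card (?E1 \<union> ?E2) = (n - 1) + (n - 1) div 2" using c1 c2 by (simp add: card_Un_disjoint)
  moreover have "card (?E1 \<union> ?E2) \<le> card (edges (induced ?X ?S))"
    by (rule card_mono[OF finite_edges[OF simple_graph_induced[OF sX SX]]]) (use E1 E2 in blast)
  ultimately have "(n - 1) + (n - 1) div 2 \<le> card (edges (induced ?X ?S))" by simp
  then have "3 * n \<le> 2 * card (edges (induced ?X ?S)) + 6" by linarith
  then have "3 / 2 * real n - 3 \<le> real (card (edges (induced ?X ?S)))" by linarith
  then show ?thesis using family_subgraph_member[of daisy "Suc n" ?S, OF sX _ SX] by (intro bexI[of _ "induced ?X ?S"]) simp_all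
qed

lemma diamond_class_member:
  "\<exists>G\<in>family_class diamond. card (verts G) = n \<and> 2 * real n - 4 \<le> real (card (edges G))"
proof -
  let ?X = "diamond (Suc n)" and ?S = "{..<n}"
  let ?E0 = "(\<lambda>i. {0, i}) ` {2..<n}" and ?E1 = "(\<lambda>i. {1, i}) ` {2..<n}"
  have sX: "simple_graph ?X" by (rule simple_diamond)
  have SX: "?S \<subseteq> verts ?X" by (auto simp: diamond_def)
  have E: "?E0 \<union> ?E1 \<subseteq> edges (induced ?X ?S)"
  proof
    fix e assume "e \<in> ?E0 \<union> ?E1"
    then obtain i where i: "2 \<le> i" "i < n" "e = {0, i} \<or> e = {1, i}" by auto
    then have "e \<in> edges ?X" unfolding diamond_def by auto
    then show "e \<in> edges (induced ?X ?S)" using i by auto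
  qed
  have "inj_on (\<lambda>i. {0, i}) {2..<n}" "inj_on (\<lambda>i. {1, i}) {2..<n}" by (auto simp: inj_on_def doubleton_eq_iff)
  then have c: "card ?E0 = n - 2" "card ?E1 = n - 2" by (simp_all add: card_image)
  have "?E0 \<inter> ?E1 = {}"
  proof -
    have "0 \<in> e" if "e \<in> ?E0" for e using that by auto
    moreover have "0 \<notin> e" if "e \<in> ?E1" for e using that by auto
    ultimately show ?thesis by blast
  qed
  then have "card (?E0 \<union> ?E1) = 2 * (n - 2)" using c by (simp add: card_Un_disjoint)
  moreover have "card (?E0 \<union> ?E1) \<le> card (edges (induced ?X ?S))"
    by (rule card_mono[OF finite_edges[OF simple_graph_induced[OF sX SX]] E])
  ultimately have "2 * n \<le> card (edges (induced ?X ?S)) + 4" by linarith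
  then have "2 * real n - 4 \<le> real (card (edges (induced ?X ?S)))" by linarith
  then show ?thesis using family_subgraph_member[of diamond "Suc n" ?S, OF sX _ SX] by (intro bexI[of _ "induced ?X ?S"]) simp_all
qed

lemma daisy_class_obstruction:
  fixes d :: real
  assumes "d < 3 / 2"
  shows "minor_closed_class daisy_class" "\<not> limiting_density daisy_class \<le> ereal d"
proof -
  have b: "2 * card (edges G) \<le> 3 * card (verts G)" if "G \<in> family_class daisy" for G
    using daisy_minor_edges[of G] that by (auto simp: family_class_def)
  have b2: "card (edges G) \<le> 2 * card (verts G)" if "G \<in> family_class daisy" for G using b[OF that] by linarith
  have up: "real (card (edges G)) \<le> 3 / 2 * real (card (verts G))" if "G \<in> family_class daisy" for G
    using b[OF that] by linarith
  show "minor_closed_class daisy_class" unfolding daisy_class_family by (rule family_class_minor_closed[OF b2])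
  show "\<not> limiting_density daisy_class \<le> ereal d"
    unfolding daisy_class_family by (rule family_class_density[OF b2 up daisy_class_member assms])
qed

lemma diamond_class_obstruction:
  fixes d :: real
  assumes "d < 2"
  shows "minor_closed_class diamond_class" "\<not> limiting_density diamond_class \<le> ereal d"
proof -
  have b: "card (edges G) \<le> 2 * card (verts G)" if "G \<in> family_class diamond" for G
    using diamond_minor_edges[of G] that by (auto simp: family_class_def)
  have up: "real (card (edges G)) \<le> 2 * real (card (verts G))" if "G \<in> family_class diamond" for G
    using b[OF that] by linarith
  show "minor_closed_class diamond_class" unfolding diamond_class_family by (rule family_class_minor_closed[OF b])
  show "\<not> limiting_density diamond_class \<le> ereal d"
    unfolding diamond_class_family by (rule family_class_density[OF b up diamond_class_member assms])
qed

section \<open>Classes without an obstruction\<close>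

lemma daisy_mono: "k \<le> l \<Longrightarrow> minor (daisy k) (daisy l)"
  by (rule minor_sub[OF simple_daisy]) (auto simp: daisy_def)

lemma diamond_mono: "k \<le> l \<Longrightarrow> minor (diamond k) (diamond l)"
  by (rule minor_sub[OF simple_diamond]) (auto simp: diamond_def)

lemma not_family_class:
  assumes \<G>: "minor_closed_class \<G>" and no: "\<not> family_class X \<subseteq> \<G>"
  obtains k where "\<And>G. G \<in> \<G> \<Longrightarrow> \<not> minor (X k) G"
proof -
  obtain Y k where Y: "simple_graph Y" "minor Y (X k)" "Y \<notin> \<G>" using no unfolding family_class_def by blast
  have "\<not> minor (X k) G" if "G \<in> \<G>" for G
    using minor_trans[OF Y(1,2)] class_closed[OF \<G> that Y(1)] Y(3) by blast
  then show ?thesis using that by blast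
qed

text \<open>The dense sets of a packing contain targets, so there is a bounded number of them, and the excess over
  density \<open>d\<close> is bounded with it.\<close>

lemma sparse_or_target:
  fixes d :: real
  assumes \<G>: "minor_closed_class \<G>" and inf: "\<not> finite_class \<G>"
    and no: "\<And>A. A \<in> \<A> \<Longrightarrow> \<not> copies_class A \<subseteq> \<G>" "\<not> daisy_class \<subseteq> \<G>" "\<not> diamond_class \<subseteq> \<G>"
    and d: "1 \<le> d" "d < 3 / 2" and noU: "\<And>H. H \<in> \<U> d \<Longrightarrow> \<not> copies_class H \<subseteq> \<G>"
  shows "slope_le (ex_edges \<G>) d"
proof -
  obtain k1 where k1: "\<And>G. G \<in> \<G> \<Longrightarrow> \<not> minor (daisy k1) G"
    using not_family_class[OF \<G>] no(2) unfolding daisy_class_family by metis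
  obtain k2 where k2: "\<And>G. G \<in> \<G> \<Longrightarrow> \<not> minor (diamond k2) G"
    using not_family_class[OF \<G>] no(3) unfolding diamond_class_family by metis
  define k where "k = max k1 k2"
  have nD: "\<not> minor (daisy k) G" if "G \<in> \<G>" for G
    using minor_trans[OF simple_daisy daisy_mono, of k1 k G] k1[OF that] unfolding k_def by (meson max.cobounded1 max.cobounded2)
  have nM: "\<not> minor (diamond k) G" if "G \<in> \<G>" for G
    using minor_trans[OF simple_diamond diamond_mono, of k2 k G] k2[OF that] unfolding k_def by (meson max.cobounded1 max.cobounded2)
  \<comment> \<open>The targets have at most \<open>m\<close> vertices, so they fall into finitely many isomorphism types.\<close>
  define m where "m = 10 + 2 * (\<beta> 1 0 1 d + \<beta> 0 5 4 d + \<beta> 0 7 5 d + \<beta> 0 10 7 d)"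
  have cA: "card (verts A) \<le> m" if "A \<in> \<A> \<union> \<U> d" for A
  proof (cases "A \<in> \<A>")
    case True
    then show ?thesis using A_dense(3)[OF True, of d] d by (simp add: m_def)
  next
    case False
    then show ?thesis using U_dense(3)[of A d] that d by (simp add: m_def)
  qed
  have sA: "simple_graph A" if "A \<in> \<A> \<union> \<U> d" for A using that A_simple U_simple by blast
  define Rs where "Rs = {R :: nat sgraph. simple_graph R \<and> verts R \<subseteq> {..<Suc m} \<and> (\<exists>A\<in>\<A> \<union> \<U> d. graph_iso A R)}"
  have finRs: "finite Rs" by (rule finite_subset[OF _ finite_graphs_below[of "Suc m"]]) (auto simp: Rs_def)
  have sRs: "simple_graph R" if "R \<in> Rs" for R using that by (simp add: Rs_def)
  have noRs: "\<exists>k. \<forall>G\<in>\<G>. \<not> minor (copies k R) G" if R: "R \<in> Rs" for R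
  proof -
    obtain A where A: "A \<in> \<A> \<union> \<U> d" "graph_iso A R" using R unfolding Rs_def by blast
    have "\<not> copies_class A \<subseteq> \<G>" using A(1) no(1) noU by blast
    then obtain j where j: "\<And>G. G \<in> \<G> \<Longrightarrow> \<not> minor (copies j A) G" using not_copies_class[OF \<G>] by blast
    have "minor (copies j A) (copies j R)"
      by (rule minor_copies_mono[OF sA[OF A(1)] graph_iso_minor[OF A(2)] sRs[OF R] order_refl])
    then have "\<not> minor (copies j R) G" if "G \<in> \<G>" for G
      using minor_trans[OF simple_copies[OF sA[OF A(1)]]] j[OF that] by blast
    then show ?thesis by blast
  qed
  obtain N where N: "\<And>G \<S>. G \<in> \<G> \<Longrightarrow> packs Rs G \<S> \<Longrightarrow> card \<S> \<le> N"
    using packing_bounded[OF \<G> finRs sRs noRs] by blast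
  define D where "D = k * (k * (k + 1))"
  define c where "c = (D * D + D + 1) * D"
  show ?thesis
  proof (rule slope_le_class[OF \<G> inf])
    fix G assume G: "G \<in> \<G>"
    note s = class_simple[OF \<G> G]
    obtain \<S> where S: "dense_packing d G \<S>"
      "real (card (edges G)) \<le> d * real (card (verts G)) + real c * real (card \<S>)"
      using excess_bounded_by_packing[OF d(1) s nD[OF G] nM[OF G]] unfolding c_def D_def by blast
    have "\<exists>R\<in>Rs. minor R (induced G S)" if "S \<in> \<S>" for S
    proof -
      have SS: "S \<subseteq> verts G" "dense d G S" using S(1) that by (auto simp: dense_packing_def)
      have "d * real (card (verts (induced G S))) < real (card (edges (induced G S)))"
        using SS(2) by (simp add: dense_def del: edges_induced)
      then obtain A where A: "A \<in> \<A> \<union> \<U> d" "minor A (induced G S)"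
        using dense_has_target[OF simple_graph_induced[OF s SS(1)] _ d] by blast
      obtain R :: "nat sgraph" where R: "graph_iso A R" "verts R = {..<card (verts A)}" using nat_copy[OF sA[OF A(1)]] .
      have sR: "simple_graph R" using R(1) by (auto elim: graph_isoE)
      have "verts R \<subseteq> {..<Suc m}" using R(2) cA[OF A(1)] by simp
      then have "R \<in> Rs" unfolding Rs_def using sR A(1) R(1) by blast
      moreover have "minor R (induced G S)" using minor_trans[OF sR graph_iso_minor[OF graph_iso_sym[OF R(1)]] A(2)] .
      ultimately show ?thesis by blast
    qed
    then have "packs Rs G \<S>" using S(1) unfolding packs_def dense_packing_def by simp
    then have "card \<S> \<le> N" by (rule N[OF G])
    then have "real c * real (card \<S>) \<le> real c * real N" by (intro mult_left_mono) auto
    then show "real (card (edges G)) \<le> d * real (card (verts G)) + real c * real N" using S(2) by linarith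
  qed
qed

lemma connected_set_of_size:
  assumes V: "conn G V" and G: "simple_graph G" "V \<subseteq> verts G" and n: "1 \<le> n" "n \<le> card V"
  shows "\<exists>S\<subseteq>V. conn G S \<and> card S = n \<and> n \<le> card (edges (induced G S)) + 1"
  using n
proof (induction n rule: dec_induct)
  case base
  obtain v where "v \<in> V" using conn_nonempty[OF V] by blast
  then show ?case by (intro exI[of _ "{v}"]) simp
next
  case (step n)
  then obtain S where S: "S \<subseteq> V" "conn G S" "card S = n" "n \<le> card (edges (induced G S)) + 1" by auto
  have "S \<noteq> V" using S(3) step.prems by auto
  then have "touches G S (V - S)" by (intro connD[OF V S(1) conn_nonempty[OF S(2)]])
  then obtain a b where ab: "a \<in> S" "b \<in> V - S" "{a, b} \<in> edges G" by (rule touchesE)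
  have SV: "insert b S \<subseteq> verts G" using S(1) ab G(2) by auto
  have finS: "finite S" by (rule finite_subset[OF S(1) finite_subset[OF G(2) finite_verts[OF G(1)]]])
  have "conn G (insert b S)" using conn_insert[OF S(2), of b a] ab by (simp add: insert_commute)
  moreover have "card (insert b S) = Suc n" using finS ab S(3) by simp
  moreover have "Suc (card (edges (induced G S))) \<le> card (edges (induced G (insert b S)))"
  proof -
    have "{a, b} \<notin> edges (induced G S)" using ab by simp
    then have "Suc (card (edges (induced G S))) = card (insert {a, b} (edges (induced G S)))"
      using finite_edges[OF G(1)] by simp
    also have "\<dots> \<le> card (edges (induced G (insert b S)))"
      by (rule card_mono[OF finite_edges[OF simple_graph_induced[OF G(1) SV]]]) (use ab in auto)
    finally show ?thesis .
  qed
  ultimately show ?case using S(1,4) ab(2) by (intro exI[of _ "insert b S"]) auto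
qed

text \<open>A connected graph has connected induced subgraphs of every smaller order, and one of order \<open>n\<close> has at least
  \<open>n - 1\<close> edges.\<close>

lemma unbounded_components_slope:
  assumes \<G>: "minor_closed_class \<G>" and big: "\<And>n. \<exists>G\<in>\<G>. graph_connected G \<and> n \<le> card (verts G)"
  shows "slope_ge (ex_edges \<G>) 1"
  unfolding slope_ge_def
proof (intro exI allI)
  fix n
  show "1 * real n - 1 \<le> real (ex_edges \<G> n)"
  proof (cases "n = 0")
    case False
    obtain G where G: "G \<in> \<G>" "graph_connected G" "n \<le> card (verts G)" using big by blast
    note s = class_simple[OF \<G> G(1)]
    have "conn G (verts G)" using G(2) s by (simp add: graph_connected_iff_conn)
    then obtain S where S: "S \<subseteq> verts G" "card S = n" "n \<le> card (edges (induced G S)) + 1"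
      using connected_set_of_size[OF _ s order_refl _ G(3)] False by auto
    have "induced G S \<in> \<G>" by (rule class_closed[OF \<G> G(1) simple_graph_induced[OF s S(1)] minor_induced[OF s S(1)]])
    moreover have "card (verts (induced G S)) = n" using S(2) by simp
    ultimately have "card (edges (induced G S)) \<le> ex_edges \<G> n" by (rule ex_edges_ge[OF \<G>])
    then show ?thesis using S(3) by linarith
  qed simp
qed

lemma slope_le_mono: "slope_le f d \<Longrightarrow> d \<le> e \<Longrightarrow> slope_le f e"
  unfolding slope_le_def
proof -
  assume "\<exists>C. \<forall>n. real (f n) \<le> d * real n + C" and de: "d \<le> e"
  then obtain C where C: "\<And>n. real (f n) \<le> d * real n + C" by blast
  have "real (f n) \<le> e * real n + C" for n
    using C[of n] mult_right_mono[OF de, of "real n"] by simp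
  then show "\<exists>C. \<forall>n. real (f n) \<le> e * real n + C" by blast
qed

text \<open>Convergence is part of the claim.  With bounded components it follows from the dichotomy above; otherwise
  the slope is at least \<open>1\<close>, and the dichotomy for \<open>d \<ge> 1\<close> comes from comparing with the targets for \<open>d\<close> in place of \<open>\<delta>\<close>.\<close>

lemma unobstructed_density:
  fixes \<delta> :: real
  assumes \<G>: "minor_closed_class \<G>"
    and no: "\<And>A. A \<in> \<A> \<Longrightarrow> \<not> copies_class A \<subseteq> \<G>" "\<not> daisy_class \<subseteq> \<G>" "\<not> diamond_class \<subseteq> \<G>"
    and \<delta>: "1 \<le> \<delta>" "\<delta> < 3 / 2" and noU: "\<And>H. H \<in> \<U> \<delta> \<Longrightarrow> \<not> copies_class H \<subseteq> \<G>"
  shows "limiting_density \<G> \<le> ereal \<delta>"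
proof (cases "finite_class \<G>")
  case True
  then show ?thesis by (simp add: limiting_density_def)
next
  case inf: False
  have up: "slope_le (ex_edges \<G>) \<delta>" by (rule sparse_or_target[OF \<G> inf no \<delta> noU])
  obtain l where l: "(\<lambda>n. real (ex_edges \<G> n) / real n) \<longlonglongrightarrow> l" "l \<le> \<delta>"
  proof (cases "\<exists>B. \<forall>G\<in>\<G>. graph_connected G \<longrightarrow> card (verts G) \<le> B")
    case True
    then obtain B where B: "\<And>G. G \<in> \<G> \<Longrightarrow> graph_connected G \<Longrightarrow> card (verts G) \<le> B" by blast
    have lo: "slope_ge (ex_edges \<G>) 0" unfolding slope_ge_def by (intro exI[of _ 0]) simp
    have dich: "slope_le (ex_edges \<G>) d \<or> (\<exists>d'>d. slope_ge (ex_edges \<G>) d')" if "0 \<le> d" for d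
      by (rule bounded_component_dichotomy[OF \<G> inf B that])
    show ?thesis
    proof (rule slope_limit[OF up lo])
      show "slope_le (ex_edges \<G>) d \<or> (\<exists>d'>d. slope_ge (ex_edges \<G>) d')" if "0 \<le> d" for d
        by (rule dich[OF that])
    qed (rule that)
  next
    case False
    have "\<exists>G\<in>\<G>. graph_connected G \<and> n \<le> card (verts G)" for n using False nat_le_linear by blast
    then have lo: "slope_ge (ex_edges \<G>) 1" by (rule unbounded_components_slope[OF \<G>])
    have dich: "slope_le (ex_edges \<G>) d \<or> (\<exists>d'>d. slope_ge (ex_edges \<G>) d')" if d: "1 \<le> d" for d
    proof (cases "d < 3 / 2 \<and> (\<exists>H\<in>\<U> d. copies_class H \<subseteq> \<G>)")
      case True
      then obtain H where H: "H \<in> \<U> d" "copies_class H \<subseteq> \<G>" and d2: "d < 3 / 2" by blast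
      have d0: "0 \<le> d" using d by simp
      note s = U_simple[OF H(1)]
      have ne: "verts H \<noteq> {}" using U_dense(2)[OF H(1) d0 d2] by (simp add: graph_connected_def)
      then have "0 < card (verts H)" using finite_verts[OF s] by (simp add: card_gt_0_iff)
      then have "d < real (card (edges H)) / real (card (verts H))"
        using U_dense(1)[OF H(1) d0 d2] by (simp add: less_divide_eq)
      then show ?thesis using copies_slope_ge[OF \<G> s ne H(2)] by blast
    next
      case False
      show ?thesis
      proof (cases "d < 3 / 2")
        case True
        then have "slope_le (ex_edges \<G>) d" using False by (intro sparse_or_target[OF \<G> inf no d]) auto
        then show ?thesis ..
      next
        case False
        then have "slope_le (ex_edges \<G>) d" using slope_le_mono[OF up] \<delta>(2) by simp
        then show ?thesis ..
      qed
    qed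
    show ?thesis
    proof (rule slope_limit[OF up lo])
      show "slope_le (ex_edges \<G>) d \<or> (\<exists>d'>d. slope_ge (ex_edges \<G>) d')" if "1 \<le> d" for d
        by (rule dich[OF that])
    qed (rule that)
  qed
  show ?thesis using limiting_density_eq[OF inf l(1)] l(2) by simp
qed

text \<open>A member of \<open>U\<close> of least size below \<open>H\<close> is minimal, because a minor of the same size is isomorphic.\<close>

lemma minimal_graph_below:
  assumes U: "\<And>G. G \<in> U \<Longrightarrow> simple_graph G" and H: "H \<in> U"
  obtains K where "K \<in> min_graphs U" "minor K H"
proof -
  let ?P = "\<lambda>K. K \<in> U \<and> minor K H" and ?f = "\<lambda>K :: nat sgraph. card (verts K) + card (edges K)"
  have PH: "?P H" using H minor_refl[OF U[OF H]] by simp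
  define K where "K = arg_min ?f ?P"
  have K: "?P K" unfolding K_def by (rule arg_min_natI[of ?P, OF PH])
  have min: "?f K \<le> ?f L" if "?P L" for L unfolding K_def by (rule arg_min_nat_le[of ?P, OF that])
  have sK: "simple_graph K" using K U by blast
  have "graph_iso L K" if L: "L \<in> U" "minor L K" for L
  proof -
    note sL = U[OF L(1)]
    have "minor L H" using minor_trans[OF sL L(2)] K by blast
    then have "?f K \<le> ?f L" using min L(1) by blast
    moreover have "card (verts L) \<le> card (verts K)" by (rule minor_card_verts[OF L(2) finite_verts[OF sK]])
    moreover have "card (edges L) \<le> card (edges K)" by (rule minor_card_edges[OF L(2) sL sK])
    ultimately show ?thesis by (intro minor_same_size_iso[OF L(2) sL sK]) linarith+
  qed
  then have "K \<in> min_graphs U" using K unfolding min_graphs_def by blast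
  then show ?thesis using that K by blast
qed

lemma copies_class_mono:
  assumes K: "simple_graph K" "minor K H" and H: "simple_graph H"
  shows "copies_class K \<subseteq> copies_class H"
proof
  fix G assume "G \<in> copies_class K"
  then obtain k where k: "simple_graph G" "1 \<le> k" "minor G (copies k K)" by (auto simp: copies_class_def)
  have "minor G (copies k H)"
    by (rule minor_trans[OF k(1,3) minor_copies_mono[OF K H order_refl]])
  then show "G \<in> copies_class H" using k by (auto simp: copies_class_def)
qed

section \<open>The class obstructions\<close>

theorem theorem3p19:
  fixes \<delta> :: real
  assumes "ereal \<delta> \<in> limiting_densities" and "1 \<le> \<delta>" and "\<delta> < 3 / 2"
  shows "cobs (classes_le (ereal \<delta>)) =
    min_classes (copies_class ` \<A> \<union> {daisy_class, diamond_class} \<union> copies_class ` \<E> \<delta>)"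
proof -
  define Bad where "Bad = {\<G>. minor_closed_class \<G> \<and> \<G> \<notin> classes_le (ereal \<delta>)}"
  define Obs where "Obs = copies_class ` \<A> \<union> {daisy_class, diamond_class} \<union> copies_class ` \<E> \<delta>"
  have \<delta>0: "0 \<le> \<delta>" using assms by simp
  have EU: "H \<in> \<U> \<delta>" if "H \<in> \<E> \<delta>" for H using that by (simp add: \<E>_def min_graphs_def)
  have copies: "copies_class H \<in> Bad" if "simple_graph H" "\<delta> * real (card (verts H)) < real (card (edges H))" for H
    using copies_class_minor_closed[OF that(1)] copies_class_density[OF that] by (simp add: Bad_def classes_le_def)
  have "daisy_class \<in> Bad" "diamond_class \<in> Bad"
    using daisy_class_obstruction[of \<delta>] diamond_class_obstruction[of \<delta>] assms by (simp_all add: Bad_def classes_le_def)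
  then have Obs_Bad: "Obs \<subseteq> Bad"
    using copies[OF A_simple A_dense(1)[OF _ \<delta>0 assms(3)]] copies[OF U_simple U_dense(1)[OF _ \<delta>0 assms(3)]] EU
    unfolding Obs_def by blast
  \<comment> \<open>As every bad class contains a listed one and the listed ones are bad, the minimal elements agree.\<close>
  have below: "\<exists>\<O>\<in>Obs. \<O> \<subseteq> \<G>" if "\<G> \<in> Bad" for \<G>
  proof (rule ccontr)
    assume none: "\<not> ?thesis"
    have \<G>: "minor_closed_class \<G>" "\<not> limiting_density \<G> \<le> ereal \<delta>" using that by (auto simp: Bad_def classes_le_def)
    have noU: "\<not> copies_class H \<subseteq> \<G>" if H: "H \<in> \<U> \<delta>" for H
    proof
      assume sub: "copies_class H \<subseteq> \<G>"
      obtain K where "K \<in> min_graphs (\<U> \<delta>)" "minor K H"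
        by (rule minimal_graph_below[OF U_simple[where \<delta> = \<delta>] H])
      then have K: "K \<in> \<E> \<delta>" "minor K H" by (simp_all add: \<E>_def)
      have "copies_class K \<subseteq> copies_class H"
        by (rule copies_class_mono[OF U_simple[OF EU[OF K(1)]] K(2) U_simple[OF H]])
      then have "copies_class K \<subseteq> \<G>" using sub by blast
      moreover have "copies_class K \<in> Obs" using K(1) by (simp add: Obs_def)
      ultimately show False using none by blast
    qed
    have "limiting_density \<G> \<le> ereal \<delta>"
      by (rule unobstructed_density[OF \<G>(1) _ _ _ assms(2,3) noU]) (use none in \<open>auto simp: Obs_def\<close>)
    then show False using \<G>(2) by simp
  qed
  have "min_classes Bad = min_classes Obs"
  proof (intro equalityI subsetI)
    fix \<G> assume "\<G> \<in> min_classes Bad"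
    then have G: "\<G> \<in> Bad" "\<And>\<H>. \<H> \<in> Bad \<Longrightarrow> \<H> \<subseteq> \<G> \<Longrightarrow> \<H> = \<G>" by (auto simp: min_classes_def)
    obtain \<O> where "\<O> \<in> Obs" "\<O> \<subseteq> \<G>" using below[OF G(1)] by blast
    then have "\<G> \<in> Obs" using G(2) Obs_Bad by blast
    then show "\<G> \<in> min_classes Obs" using G(2) Obs_Bad by (auto simp: min_classes_def)
  next
    fix \<G> assume "\<G> \<in> min_classes Obs"
    then have G: "\<G> \<in> Obs" "\<And>\<H>. \<H> \<in> Obs \<Longrightarrow> \<H> \<subseteq> \<G> \<Longrightarrow> \<H> = \<G>" by (auto simp: min_classes_def)
    have "\<H> = \<G>" if H: "\<H> \<in> Bad" "\<H> \<subseteq> \<G>" for \<H>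
    proof -
      obtain \<O> where O: "\<O> \<in> Obs" "\<O> \<subseteq> \<H>" using below[OF H(1)] by blast
      then have "\<O> = \<G>" using G(2) H(2) by blast
      then show ?thesis using O(2) H(2) by blast
    qed
    then show "\<G> \<in> min_classes Bad" using G(1) Obs_Bad by (auto simp: min_classes_def)
  qed
  then show ?thesis unfolding cobs_def Bad_def Obs_def .
qed

end
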